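(* Let $\Phi\subseteq V^*$ be an essential root system all of whose irreducible components are of classical type ($\mathrm A$, $\mathrm B$, $\mathrm C$ or $\mathrm D$), with root lattice $\mathcal L\subseteq V^*$. A function $g:\mathcal L\to\mathbb R\cup\{+\infty\}$ with $\operatorname{dom} g\ne\emptyset$ is M-convex of type $\Phi$ if and only if it satisfies the following three conditions, where $\gamma_{g,p}:\Phi\to\mathbb R\cup\{+\infty\}$ is $\gamma_{g,p}(\alpha)=g(p+\alpha)-g(p)$ for $p\in\operatorname{dom} g$: • $\operatorname{dom} g$ is an M-convex set of type $\Phi$; • for any $p\in\operatorname{dom} g$, the function $\gamma_{g,p}$ is valid, i.e. $\{x\in V:\langle\alpha,x\rangle\le\gamma_{g,p}(\alpha)\ \forall\alpha\in\Phi\}\ne\emptyset$ (equivalently, $\operatorname{cone}\gamma_{g,p}$ is an M-sublinear function of type $\Phi$); • for any $p,q\in\operatorname{dom} g$, $g(q)\ge g(p)+(\operatorname{cone}\gamma_{g,p})(q-p)$; equivalently, there exist $\beta_1,\dots,\beta_k\in\Phi$ with $p+\beta_\ell\in\operatorname{dom} g$ $(\ell=1,\dots,k)$ and reals $\mu_1,\dots,\mu_k\ge0$ such that $$p+\sum_{\ell=1}^k\mu_\ell\beta_\ell=q\quad\text{and}\quad g(q)\ge g(p)+\sum_{\ell=1}^k\mu_\ell\,\gamma_{g,p}(\beta_\ell).$$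
   Context: Root systems. $V$ is a finite-dimensional real inner product space with dual $V^*$, $\langle p,x\rangle=p(x)$ for $p\in V^*,x\in V$; $V^*$ carries the induced inner product. For $\alpha\in V^*\setminus\{0\}$, $\alpha^\vee\in V$ is $2/\|\alpha\|^2$ times the vector of $V$ representing $\alpha$, and $s_\alpha(p)=p-\langle p,\alpha^\vee\rangle\alpha$. A root system is a nonempty finite set $\Phi\subseteq V^*\setminus\{0\}$ with $s_\alpha(\beta)\in\Phi$, $\mathbb R\alpha\cap\Phi=\{\alpha,-\alpha\}$ and $\langle\alpha,\beta^\vee\rangle\in\mathbb Z$ for all $\alpha,\beta\in\Phi$. It is essential if $\operatorname{span}\Phi=V^*$; it decomposes uniquely into mutually orthogonal irreducible components. The root lattice $\mathcal L$ is the set of integer linear combinations of roots. Convexity notions. $\operatorname{dom}$ denotes the set where a function is finite. An M-convex cone of type $\Phi$ is $\operatorname{cone}\Phi'$ with $\Phi'\subseteq\Phi$ ($\operatorname{cone}\emptyset=\{0\}$). An M-convex polyhedron of type $\Phi$ is a nonempty closed convex set $P\subseteq V^*$ whose tangent cone $\operatorname{cl}(\operatorname{cone}(P-p))$ at every $p\in P$ is an M-convex cone (such $P$ is a polyhedron); it is integral if $P=\operatorname{conv}(P\cap\mathcal L)$. A nonempty $B\subseteq\mathcal L$ is an M-convex set of type $\Phi$ if $B=P\cap\mathcal L$ for some integral M-convex polyhedron $P$ of type $\Phi$. A convex set is locally polyhedral if its intersection with every polytope is a polytope; a function is locally polyhedral convex if its epigraph is a locally polyhedral convex set. For a function $h$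 on $V^*$, $\Pi(h)=\{\operatorname{argmin}(h-x): x\in V,\ \operatorname{argmin}(h-x)\neq\emptyset\}$, where $(h-x)(p)=h(p)-\langle p,x\rangle$. A primal-integral locally polyhedral M-convex function of type $\Phi$ is a proper locally polyhedral convex function $\hat g:V^*\to\mathbb R\cup\{+\infty\}$ such that every member of $\Pi(\hat g)$ is an integral M-convex polyhedron of type $\Phi$. A function $g:\mathcal L\to\mathbb R\cup\{+\infty\}$ is M-convex of type $\Phi$ if it is the restriction to $\mathcal L$ of some such $\hat g$. For $\gamma:\Phi\to\mathbb R\cup\{+\infty\}$ (a distance function), $(\operatorname{cone}\gamma)(p)=\inf\{\sum_{\alpha\in\operatorname{dom}\gamma}\mu(\alpha)\gamma(\alpha):\mu(\alpha)\ge0,\ p=\sum_{\alpha\in\operatorname{dom}\gamma}\mu(\alpha)\alpha\}$ for $p\in V^*$ ($\inf\emptyset=+\infty$). An M-sublinear function of type $\Phi$ is a function of the form $\operatorname{cone}\gamma$ with $\gamma$ valid. *)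

theory Defs
  imports "HOL-Analysis.Analysis"
begin

section \<open>The dual space\<close>

type_synonym 'v dual = "'v \<Rightarrow>\<^sub>L real"

definition riesz :: "'v::euclidean_space dual \<Rightarrow> 'v" where
  "riesz p = (THE v. \<forall>x. blinfun_apply p x = v \<bullet> x)"

lemma riesz_inner: "riesz p \<bullet> x = blinfun_apply p x"
proof -
  let ?v = "\<Sum>b\<in>Basis. blinfun_apply p b *\<^sub>R b"
  have "blinfun_apply p x = ?v \<bullet> x" for x
  proof -
    have "blinfun_apply p x = blinfun_apply p (\<Sum>b\<in>Basis. (x \<bullet> b) *\<^sub>R b)"
      by (simp add: euclidean_representation)
    also have "\<dots> = (\<Sum>b\<in>Basis. (x \<bullet> b) * blinfun_apply p b)"
      by (simp add: blinfun.sum_right blinfun.scaleR_right)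
    also have "\<dots> = ?v \<bullet> x"
      by (simp add: inner_sum_left) (simp add: inner_commute mult.commute)
    finally show ?thesis .
  qed
  then obtain v where v: "\<forall>x. blinfun_apply p x = v \<bullet> x"
    by blast
  have "riesz p = v"
    unfolding riesz_def
  proof (rule the_equality)
    show "w = v" if "\<forall>x. blinfun_apply p x = w \<bullet> x" for w
      using that v vector_eq_rdot[of w v] by metis
  qed (fact v)
  with v show ?thesis
    by metis
qed

definition dual_inner :: "'v::euclidean_space dual \<Rightarrow> 'v dual \<Rightarrow> real" where
  "dual_inner p q = riesz p \<bullet> riesz q"

text \<open>The operator norm on the dual is the norm of the induced inner product.\<close>

lemma norm_riesz: "norm (riesz p) = norm p"
proof (rule antisym)
  have "norm (riesz p) * norm (riesz p) = blinfun_apply p (riesz p)"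
    by (simp add: riesz_inner[symmetric] power2_norm_eq_inner[symmetric] power2_eq_square)
  also have "\<dots> \<le> norm p * norm (riesz p)"
    using norm_blinfun[of p "riesz p"] by (simp add: abs_le_iff)
  finally show "norm (riesz p) \<le> norm p"
    by (cases "riesz p = 0") auto
  show "norm p \<le> norm (riesz p)"
    by (rule norm_blinfun_bound)
       (simp_all add: riesz_inner[symmetric] Cauchy_Schwarz_ineq2)
qed


section \<open>Root systems\<close>

definition coroot :: "'v::euclidean_space dual \<Rightarrow> 'v" where
  "coroot \<alpha> = (2 / (norm \<alpha>)\<^sup>2) *\<^sub>R riesz \<alpha>"

definition reflection :: "'v::euclidean_space dual \<Rightarrow> 'v dual \<Rightarrow> 'v dual" where
  "reflection \<alpha> p = p - blinfun_apply p (coroot \<alpha>) *\<^sub>R \<alpha>"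

definition root_system :: "'v::euclidean_space dual set \<Rightarrow> bool" where
  "root_system \<Phi> \<longleftrightarrow>
     finite \<Phi> \<and> \<Phi> \<noteq> {} \<and> 0 \<notin> \<Phi> \<and>
     (\<forall>\<alpha>\<in>\<Phi>. \<forall>\<beta>\<in>\<Phi>. reflection \<alpha> \<beta> \<in> \<Phi>) \<and>
     (\<forall>\<alpha>\<in>\<Phi>. range (\<lambda>c. c *\<^sub>R \<alpha>) \<inter> \<Phi> = {\<alpha>, - \<alpha>}) \<and>
     (\<forall>\<alpha>\<in>\<Phi>. \<forall>\<beta>\<in>\<Phi>. blinfun_apply \<alpha> (coroot \<beta>) \<in> \<int>)"

definition essential :: "'v::euclidean_space dual set \<Rightarrow> bool" where
  "essential \<Phi> \<longleftrightarrow> span \<Phi> = UNIV"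

definition mutually_orthogonal ::
    "'v::euclidean_space dual set \<Rightarrow> 'v dual set \<Rightarrow> bool" where
  "mutually_orthogonal A B \<longleftrightarrow> (\<forall>\<alpha>\<in>A. \<forall>\<beta>\<in>B. dual_inner \<alpha> \<beta> = 0)"

definition irreducible_root_system :: "'v::euclidean_space dual set \<Rightarrow> bool" where
  "irreducible_root_system \<Psi> \<longleftrightarrow> root_system \<Psi> \<and>
     \<not> (\<exists>A B. A \<noteq> {} \<and> B \<noteq> {} \<and> A \<union> B = \<Psi> \<and> A \<inter> B = {} \<and> mutually_orthogonal A B)"

definition irreducible_component ::
    "'v::euclidean_space dual set \<Rightarrow> 'v dual set \<Rightarrow> bool" where
  "irreducible_component \<Phi> \<Psi> \<longleftrightarrow>
     \<Psi> \<subseteq> \<Phi> \<and> irreducible_root_system \<Psi> \<and> mutually_orthogonal \<Psi> (\<Phi> - \<Psi>)"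

definition root_lattice :: "'v::euclidean_space dual set \<Rightarrow> 'v dual set" where
  "root_lattice \<Phi> = {\<Sum>\<alpha>\<in>\<Phi>. of_int (c \<alpha>) *\<^sub>R \<alpha> | c. True}"


subsection \<open>Classical types\<close>

text \<open>
  The standard models live in the coordinate space of the first \<open>N\<close> coordinates;
  a vector is a function \<open>nat \<Rightarrow> real\<close> vanishing at all indices \<open>\<ge> N\<close>,
  with \<open>N = n + 1\<close> for type \<open>A\<close> of rank \<open>n\<close> and \<open>N = n\<close> for the other types.
\<close>

definition unit_coord :: "nat \<Rightarrow> nat \<Rightarrow> real" where
  "unit_coord i k = (if k = i then 1 else 0)"

definition model_A :: "nat \<Rightarrow> (nat \<Rightarrow> real) set" where
  "model_A n = {(\<lambda>k. unit_coord i k - unit_coord j k) | i j. i \<le> n \<and> j \<le> n \<and> i \<noteq> j}"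

definition model_D :: "nat \<Rightarrow> (nat \<Rightarrow> real) set" where
  "model_D n = {(\<lambda>k. s * unit_coord i k + t * unit_coord j k) | s t i j.
     s \<in> {1, -1} \<and> t \<in> {1, -1} \<and> i < n \<and> j < n \<and> i \<noteq> j}"

definition model_B :: "nat \<Rightarrow> (nat \<Rightarrow> real) set" where
  "model_B n = model_D n \<union> {(\<lambda>k. s * unit_coord i k) | s i. s \<in> {1, -1} \<and> i < n}"

definition model_C :: "nat \<Rightarrow> (nat \<Rightarrow> real) set" where
  "model_C n = model_D n \<union> {(\<lambda>k. 2 * s * unit_coord i k) | s i. s \<in> {1, -1} \<and> i < n}"

text \<open>
  Isomorphism of root systems: a linear map that restricts to a bijection of the
  roots and preserves the Cartan integers. Preservation of the Cartan integers
  makes \<open>T\<close> injective on the span of \<open>\<Psi>\<close>; outside that span \<open>T\<close> is irrelevant.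
\<close>

definition isomorphic_to_model ::
    "'v::euclidean_space dual set \<Rightarrow> nat \<Rightarrow> (nat \<Rightarrow> real) set \<Rightarrow> bool" where
  "isomorphic_to_model \<Psi> N R \<longleftrightarrow>
     (\<exists>T :: 'v dual \<Rightarrow> nat \<Rightarrow> real.
        (\<forall>k. linear (\<lambda>p. T p k)) \<and> bij_betw T \<Psi> R \<and>
        (\<forall>\<alpha>\<in>\<Psi>. \<forall>\<beta>\<in>\<Psi>. blinfun_apply \<alpha> (coroot \<beta>) =
           2 * (\<Sum>k<N. T \<alpha> k * T \<beta> k) / (\<Sum>k<N. (T \<beta> k)\<^sup>2)))"

definition classical_type :: "'v::euclidean_space dual set \<Rightarrow> bool" where
  "classical_type \<Psi> \<longleftrightarrow>
     (\<exists>n\<ge>1. isomorphic_to_model \<Psi> (n + 1) (model_A n)) \<or>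
     (\<exists>n\<ge>2. isomorphic_to_model \<Psi> n (model_B n)) \<or>
     (\<exists>n\<ge>3. isomorphic_to_model \<Psi> n (model_C n)) \<or>
     (\<exists>n\<ge>4. isomorphic_to_model \<Psi> n (model_D n))"


section \<open>M-convex sets\<close>

definition M_convex_cone ::
    "'v::euclidean_space dual set \<Rightarrow> 'v dual set \<Rightarrow> bool" where
  "M_convex_cone \<Phi> K \<longleftrightarrow> (\<exists>\<Phi>'\<subseteq>\<Phi>. K = convex_cone hull \<Phi>')"

definition tangent_cone :: "'v::euclidean_space dual set \<Rightarrow> 'v dual \<Rightarrow> 'v dual set" where
  "tangent_cone P p = closure (convex_cone hull ((\<lambda>q. q - p) ` P))"

definition M_convex_polyhedron ::
    "'v::euclidean_space dual set \<Rightarrow> 'v dual set \<Rightarrow> bool" where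
  "M_convex_polyhedron \<Phi> P \<longleftrightarrow>
     P \<noteq> {} \<and> closed P \<and> convex P \<and> (\<forall>p\<in>P. M_convex_cone \<Phi> (tangent_cone P p))"

definition integral_M_convex_polyhedron ::
    "'v::euclidean_space dual set \<Rightarrow> 'v dual set \<Rightarrow> bool" where
  "integral_M_convex_polyhedron \<Phi> P \<longleftrightarrow>
     M_convex_polyhedron \<Phi> P \<and> P = convex hull (P \<inter> root_lattice \<Phi>)"

definition M_convex_set ::
    "'v::euclidean_space dual set \<Rightarrow> 'v dual set \<Rightarrow> bool" where
  "M_convex_set \<Phi> B \<longleftrightarrow>
     B \<noteq> {} \<and> B \<subseteq> root_lattice \<Phi> \<and>
     (\<exists>P. integral_M_convex_polyhedron \<Phi> P \<and> B = P \<inter> root_lattice \<Phi>)"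


section \<open>M-convex functions\<close>

definition eff_dom :: "'a set \<Rightarrow> ('a \<Rightarrow> ereal) \<Rightarrow> 'a set" where
  "eff_dom S f = {x \<in> S. \<bar>f x\<bar> \<noteq> \<infinity>}"

definition locally_polyhedral :: "'a::real_vector set \<Rightarrow> bool" where
  "locally_polyhedral C \<longleftrightarrow> convex C \<and> (\<forall>Q. polytope Q \<longrightarrow> polytope (C \<inter> Q))"

definition locally_polyhedral_convex_fun ::
    "('v::euclidean_space dual \<Rightarrow> ereal) \<Rightarrow> bool" where
  "locally_polyhedral_convex_fun h \<longleftrightarrow>
     locally_polyhedral {(p, t :: real). h p \<le> ereal t}"

definition proper_fun :: "('v::euclidean_space dual \<Rightarrow> ereal) \<Rightarrow> bool" where
  "proper_fun h \<longleftrightarrow> (\<forall>p. h p \<noteq> -\<infinity>) \<and> eff_dom UNIV h \<noteq> {}"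

definition argmin :: "('a \<Rightarrow> ereal) \<Rightarrow> 'a set" where
  "argmin h = {p. \<forall>q. h p \<le> h q}"

definition argmin_family ::
    "('v::euclidean_space dual \<Rightarrow> ereal) \<Rightarrow> 'v dual set set" where
  "argmin_family h =
     {argmin (\<lambda>p. h p - ereal (blinfun_apply p x)) | x.
        argmin (\<lambda>p. h p - ereal (blinfun_apply p x)) \<noteq> {}}"

definition primal_integral_M_convex_fun ::
    "'v::euclidean_space dual set \<Rightarrow> ('v dual \<Rightarrow> ereal) \<Rightarrow> bool" where
  "primal_integral_M_convex_fun \<Phi> h \<longleftrightarrow>
     proper_fun h \<and> locally_polyhedral_convex_fun h \<and>
     (\<forall>P\<in>argmin_family h. integral_M_convex_polyhedron \<Phi> P)"

text \<open>
  A function on the root lattice is represented by a function on the whole dual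
  space of which only the values on the root lattice matter.
\<close>

definition lattice_dom ::
    "'v::euclidean_space dual set \<Rightarrow> ('v dual \<Rightarrow> ereal) \<Rightarrow> 'v dual set" where
  "lattice_dom \<Phi> g = eff_dom (root_lattice \<Phi>) g"

definition M_convex_fun ::
    "'v::euclidean_space dual set \<Rightarrow> ('v dual \<Rightarrow> ereal) \<Rightarrow> bool" where
  "M_convex_fun \<Phi> g \<longleftrightarrow>
     (\<exists>h. primal_integral_M_convex_fun \<Phi> h \<and> (\<forall>p\<in>root_lattice \<Phi>. g p = h p))"


section \<open>Distance functions and M-sublinear functions\<close>

text \<open>Likewise, only the values of a distance function on \<open>\<Phi>\<close> matter.\<close>

definition distance_fun ::
    "'v::euclidean_space dual set \<Rightarrow> ('v dual \<Rightarrow> ereal) \<Rightarrow> bool" where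
  "distance_fun \<Phi> \<gamma> \<longleftrightarrow> (\<forall>\<alpha>\<in>\<Phi>. \<gamma> \<alpha> \<noteq> -\<infinity>)"

definition valid ::
    "'v::euclidean_space dual set \<Rightarrow> ('v dual \<Rightarrow> ereal) \<Rightarrow> bool" where
  "valid \<Phi> \<gamma> \<longleftrightarrow> {x. \<forall>\<alpha>\<in>\<Phi>. ereal (blinfun_apply \<alpha> x) \<le> \<gamma> \<alpha>} \<noteq> {}"

definition cone_fun ::
    "'v::euclidean_space dual set \<Rightarrow> ('v dual \<Rightarrow> ereal) \<Rightarrow> 'v dual \<Rightarrow> ereal" where
  "cone_fun \<Phi> \<gamma> p = Inf {\<Sum>\<alpha>\<in>eff_dom \<Phi> \<gamma>. ereal (\<mu> \<alpha>) * \<gamma> \<alpha> | \<mu> :: 'v dual \<Rightarrow> real.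
     (\<forall>\<alpha>\<in>eff_dom \<Phi> \<gamma>. \<mu> \<alpha> \<ge> 0) \<and> p = (\<Sum>\<alpha>\<in>eff_dom \<Phi> \<gamma>. \<mu> \<alpha> *\<^sub>R \<alpha>)}"

definition M_sublinear ::
    "'v::euclidean_space dual set \<Rightarrow> ('v dual \<Rightarrow> ereal) \<Rightarrow> bool" where
  "M_sublinear \<Phi> h \<longleftrightarrow> (\<exists>\<gamma>. distance_fun \<Phi> \<gamma> \<and> valid \<Phi> \<gamma> \<and> h = cone_fun \<Phi> \<gamma>)"

definition local_distance ::
    "('v::euclidean_space dual \<Rightarrow> ereal) \<Rightarrow> 'v dual \<Rightarrow> 'v dual \<Rightarrow> ereal" where
  "local_distance g p \<alpha> = g (p + \<alpha>) - g p"

end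

theory Submission
  imports Defs
begin

text \<open>
  Everything is moved to \<open>V\<close> by the Riesz isometry, so that roots become vectors and functionals are
  inner products. A functional whose kernel is spanned by roots takes, up to scaling, only the
  values \<open>0, \<plusminus>1, \<plusminus>2\<close> on the roots; here the classical types enter. Such functionals suffice to
  describe M-convex polyhedra, so there are finitely many facet directions and, for integral
  polyhedra, integral right-hand sides.

  For ``only if'', the cell \<open>argmin (h - x)\<close> that contains the beginning of the segment from \<open>p\<close> to
  \<open>q\<close> is an integral M-convex polyhedron, and the point is that its tangent cone at the lattice
  point \<open>p\<close> is generated by the roots \<open>\<alpha>\<close> for which \<open>p + \<alpha>\<close> is in the cell. This follows from a parity
  argument in coordinates.

  For ``if'', a local minimiser of \<open>g - x\<close> is a global one, and the set \<open>B\<close> of minimisers satisfies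
  \<open>q - p \<in> cone {\<alpha>. p + \<alpha> \<in> B}\<close> for all \<open>p, q \<in> B\<close>. The convex hull of such a set is an integral
  M-convex polyhedron. Linear programming duality allows one to move from cell to cell along
  segments, and integrality makes the cells locally finite, so they cover the hull of \<open>dom g\<close>; the
  affine functions on them fit together to the required extension.
\<close>

text \<open>For "only if" the obstacle is that a root \<alpha> can point into a cell at a lattice
  point \<open>p\<close> although \<open>p + \<alpha>\<close> lies outside. On integral points a
  special functional takes multiples of one quantum \<open>c\<close>, so a step along which it gains
  at most \<open>c\<close> cannot leap over a face. In type A all roots are such steps; in types B,
  C, D a root with two nonzero coordinates may gain \<open>2 c\<close>. Such a root is split into
  two unit coordinate vectors. In type B these are roots, but in types C and D they are not even
  lattice vectors, and a parity count in the minimal face at the shifted point supplies the roots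
  that average to them.

  For "if" the sets of minimisers may be unbounded, so neither closedness of their hulls nor local
  finiteness of the cells is automatic. Closedness comes from an outer description by cones attached
  to the lattice points; local finiteness comes from one finite set of functionals that describes
  all cells with integer right-hand sides and so gives every point a neighbourhood that is uniform
  over all cells.\<close>

section \<open>Finitely generated cones and linear programming\<close>

text \<open>Coefficients are attached to indices, not to vectors: later one root occurs at several
  base points with different costs.\<close>

lemma convex_cone_hull_image_finite:
  fixes f :: "'i \<Rightarrow> 'a::real_vector"
  assumes "finite I"
  shows "convex_cone hull (f ` I) = {\<Sum>i\<in>I. \<mu> i *\<^sub>R f i | \<mu>. \<forall>i\<in>I. \<mu> i \<ge> (0::real)}" (is "_ = ?K")
proof (rule hull_unique)
  show "f ` I \<subseteq> ?K"
  proof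
    fix x assume "x \<in> f ` I"
    then obtain i where i: "i \<in> I" "x = f i" by blast
    have "(\<Sum>j\<in>I. (if j = i then 1 else 0) *\<^sub>R f j) = (\<Sum>j\<in>I. (if j = i then f i else 0))"
      by (rule sum.cong) auto
    also have "\<dots> = f i" using i assms by simp
    finally have "x = (\<Sum>j\<in>I. (if j = i then 1 else 0::real) *\<^sub>R f j)" using i by simp
    then show "x \<in> ?K" by (auto intro!: exI[of _ "\<lambda>j. if j = i then 1 else 0::real"])
  qed
  show "convex_cone ?K"
    unfolding convex_cone_iff
  proof (intro conjI ballI allI impI)
    show "0 \<in> ?K" by (auto intro!: exI[of _ "\<lambda>_. 0"])
  next
    fix x y assume "x \<in> ?K" "y \<in> ?K"
    then obtain \<mu> \<nu> where "x = (\<Sum>i\<in>I. \<mu> i *\<^sub>R f i)" "\<forall>i\<in>I. \<mu> i \<ge> 0"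
      "y = (\<Sum>i\<in>I. \<nu> i *\<^sub>R f i)" "\<forall>i\<in>I. \<nu> i \<ge> 0" by blast
    then show "x + y \<in> ?K"
      by (auto intro!: exI[of _ "\<lambda>i. \<mu> i + \<nu> i"] simp: scaleR_left_distrib sum.distrib)
  next
    fix x and c :: real assume "x \<in> ?K" "0 \<le> c"
    then obtain \<mu> where "x = (\<Sum>i\<in>I. \<mu> i *\<^sub>R f i)" "\<forall>i\<in>I. \<mu> i \<ge> 0" by blast
    with \<open>0 \<le> c\<close> show "c *\<^sub>R x \<in> ?K"
      by (auto intro!: exI[of _ "\<lambda>i. c * \<mu> i"] simp: scaleR_right.sum)
  qed
next
  fix T assume T: "f ` I \<subseteq> T" "convex_cone T"
  show "?K \<subseteq> T"
  proof clarify
    fix \<mu> assume \<mu>: "\<forall>i\<in>I. \<mu> i \<ge> (0::real)"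
    from assms \<mu> T(1) show "(\<Sum>i\<in>I. \<mu> i *\<^sub>R f i) \<in> T"
    proof (induction I rule: finite_induct)
      case empty then show ?case using T(2) by (simp add: convex_cone_contains_0)
    next
      case (insert i I) then show ?case using T(2) by (auto simp: convex_cone_iff)
    qed
  qed
qed

lemma convex_cone_hull_finite:
  fixes S :: "'a::real_vector set"
  assumes "finite S"
  shows "convex_cone hull S = {\<Sum>a\<in>S. \<mu> a *\<^sub>R a | \<mu>. \<forall>a\<in>S. \<mu> a \<ge> (0::real)}"
  using convex_cone_hull_image_finite[OF assms, of id] by simp

lemma convex_cone_hull_mono_mem:
  "x \<in> convex_cone hull S \<Longrightarrow> (\<And>s. s \<in> S \<Longrightarrow> s \<in> convex_cone hull T) \<Longrightarrow> x \<in> convex_cone hull T"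
  by (metis convex_cone_convex_cone_hull hull_minimal subsetD subsetI)

lemma convex_cone_hull_sum:
  assumes "\<And>i. i \<in> I \<Longrightarrow> f i \<in> convex_cone hull S"
  shows "(\<Sum>i\<in>I. f i) \<in> convex_cone hull S"
  using assms
  by (induction I rule: infinite_finite_induct)
     (auto intro: convex_cone_hull_contains_0 convex_cone_hull_add)

lemma inner_le_0_convex_cone_hull:
  fixes w :: "'a::real_inner"
  assumes "\<And>s. s \<in> S \<Longrightarrow> w \<bullet> s \<le> 0" "x \<in> convex_cone hull S"
  shows "w \<bullet> x \<le> 0"
proof -
  have "convex_cone hull S \<subseteq> {x. w \<bullet> x \<le> 0}"
    by (rule hull_minimal) (use assms in \<open>auto simp: convex_cone_halfspace_le\<close>)
  then show ?thesis using assms by blast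
qed

text \<open>Where the vertical line through \<open>m\<close> leaves \<open>G\<close> downwards, some
  defining halfspace with negative last coefficient must be tight; otherwise all of them would
  survive a small decrease of \<open>t\<close>. Its slope is a subgradient. Since \<open>X\<close>
  depends only on the halfspaces, finitely many slopes serve all points of \<open>G\<close>
  simultaneously.\<close>

lemma polyhedron_lower_supports:
  fixes G :: "('a::euclidean_space \<times> real) set"
  assumes "polyhedron G"
  shows "\<exists>X. finite X \<and> (\<forall>m t0 \<delta>. (m, t0) \<in> G \<longrightarrow> \<delta> > 0 \<longrightarrow> (\<forall>t. t0 - \<delta> < t \<and> t < t0 \<longrightarrow> (m, t) \<notin> G) \<longrightarrow>
           (\<exists>x\<in>X. \<forall>y t. (y, t) \<in> G \<longrightarrow> t \<ge> t0 + x \<bullet> (y - m)))"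
proof -
  obtain F where F: "finite F" "G = \<Inter>F" "\<forall>h\<in>F. \<exists>a b. a \<noteq> 0 \<and> h = {x. a \<bullet> x \<le> b}"
    using assms unfolding polyhedron_def by blast
  then obtain a b where ab: "\<And>h. h \<in> F \<Longrightarrow> h = {x. a h \<bullet> x \<le> b h}" by metis
  \<comment> \<open>Solving \<open>fst (a h) \<bullet> y + snd (a h) * t \<le> b h\<close> for
    \<open>t\<close>, with \<open>snd (a h) < 0\<close>, gives this slope.\<close>
  define x where "x h = (-1 / snd (a h)) *\<^sub>R fst (a h)" for h
  have mem: "(y, t) \<in> h \<longleftrightarrow> fst (a h) \<bullet> y + snd (a h) * t \<le> b h" if "h \<in> F" for h y t
  proof -
    have "(y, t) \<in> h \<longleftrightarrow> (y, t) \<in> {x. a h \<bullet> x \<le> b h}" using ab[OF that] by simp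
    then show ?thesis by (simp add: inner_prod_def)
  qed
  show ?thesis
  proof (intro exI[of _ "x ` F"] conjI allI impI)
    show "finite (x ` F)" using F by simp
    fix m t0 and \<delta> :: real
    assume A: "(m, t0) \<in> G" "\<delta> > 0" "\<forall>t. t0 - \<delta> < t \<and> t < t0 \<longrightarrow> (m, t) \<notin> G"
    have "\<exists>h\<in>F. snd (a h) < 0 \<and> fst (a h) \<bullet> m + snd (a h) * t0 = b h"
    proof (rule ccontr)
      assume no: "\<not> ?thesis"
      have "\<forall>h\<in>F. eventually (\<lambda>t. (m, t) \<in> h) (at_left t0)"
      proof
        fix h assume h: "h \<in> F"
        have le: "fst (a h) \<bullet> m + snd (a h) * t0 \<le> b h" using A(1) F(2) h mem by blast
        show "eventually (\<lambda>t. (m, t) \<in> h) (at_left t0)"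
        proof (cases "snd (a h) < 0")
          case True
          then have "fst (a h) \<bullet> m + snd (a h) * t0 < b h" using no h le by fastforce
          moreover have "((\<lambda>t. fst (a h) \<bullet> m + snd (a h) * t) \<longlongrightarrow> fst (a h) \<bullet> m + snd (a h) * t0) (at_left t0)"
            by (intro tendsto_intros)
          ultimately have "eventually (\<lambda>t. fst (a h) \<bullet> m + snd (a h) * t < b h) (at_left t0)"
            using order_tendstoD(2) by blast
          then show ?thesis by eventually_elim (simp add: mem[OF h])
        next
          case False
          have "eventually (\<lambda>t. t < t0) (at_left t0)" by (simp add: eventually_at_filter)
          then show ?thesis
          proof eventually_elim
            case (elim t)
            then have "snd (a h) * t \<le> snd (a h) * t0" using False by (intro mult_left_mono) auto
            then show ?case using le by (simp add: mem[OF h])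
          qed
        qed
      qed
      then have "eventually (\<lambda>t. \<forall>h\<in>F. (m, t) \<in> h) (at_left t0)"
        using F(1) by (simp add: eventually_ball_finite)
      moreover have "eventually (\<lambda>t. t0 - \<delta> < t \<and> t < t0) (at_left t0)"
        using eventually_at_left_real[of "t0 - \<delta>" t0] A(2) by simp
      ultimately have "eventually (\<lambda>t. (\<forall>h\<in>F. (m, t) \<in> h) \<and> t0 - \<delta> < t \<and> t < t0) (at_left t0)"
        by eventually_elim auto
      then obtain t where "\<forall>h\<in>F. (m, t) \<in> h" "t0 - \<delta> < t" "t < t0"
        by (metis (mono_tags, lifting) eventually_happens trivial_limit_at_left_real)
      then show False using A(3) F(2) by blast
    qed
    then obtain h where h: "h \<in> F" "snd (a h) < 0" "fst (a h) \<bullet> m + snd (a h) * t0 = b h" by blast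
    show "\<exists>x\<in>x ` F. \<forall>y t. (y, t) \<in> G \<longrightarrow> t \<ge> t0 + x \<bullet> (y - m)"
    proof (intro bexI[of _ "x h"] allI impI)
      fix y t assume "(y, t) \<in> G"
      then have "fst (a h) \<bullet> y + snd (a h) * t \<le> b h" using F(2) h(1) mem by blast
      then have "snd (a h) * (t - t0) \<le> - (fst (a h) \<bullet> (y - m))"
        using h(3) by (simp add: algebra_simps inner_diff_right)
      then have "t - t0 \<ge> - (fst (a h) \<bullet> (y - m)) / snd (a h)"
        using h(2) by (metis neg_divide_le_eq mult.commute)
      then show "t \<ge> t0 + x h \<bullet> (y - m)" by (simp add: x_def)
    qed (use h in blast)
  qed
qed

text \<open>The generators lifted by their costs, together with the upward ray (index
  \<open>None\<close>), generate this cone, so it is polyhedral. It is the region above the optimal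
  value of a linear program as a function of the right-hand side: closedness yields attained optima,
  supporting slopes yield dual solutions.\<close>

lemma closed_cone_above:
  fixes a :: "'i \<Rightarrow> 'a::euclidean_space" and c :: "'i \<Rightarrow> real"
  assumes "finite I"
  defines "C \<equiv> {(\<Sum>i\<in>I. \<mu> i *\<^sub>R a i, (\<Sum>i\<in>I. \<mu> i * c i) + s) | \<mu> s. (\<forall>i\<in>I. \<mu> i \<ge> (0::real)) \<and> s \<ge> (0::real)}"
  shows "polyhedron C"
proof -
  define f :: "'i option \<Rightarrow> 'a \<times> real" where "f = (\<lambda>j. case j of None \<Rightarrow> (0, 1) | Some i \<Rightarrow> (a i, c i))"
  define J where "J = insert None (Some ` I)"
  have J: "finite J" using assms by (simp add: J_def)
  have sumJ: "(\<Sum>j\<in>J. \<mu> j *\<^sub>R f j) = (\<Sum>i\<in>I. \<mu> (Some i) *\<^sub>R a i, (\<Sum>i\<in>I. \<mu> (Some i) * c i) + \<mu> None)" for \<mu>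
    using assms(1) by (intro prod_eqI) (simp_all add: J_def sum.reindex f_def fst_sum snd_sum o_def add.commute)
  have "convex_cone hull (f ` J) = C"
    unfolding convex_cone_hull_image_finite[OF J] sumJ
  proof safe
    fix \<mu> assume "\<forall>j\<in>J. \<mu> j \<ge> (0::real)"
    then show "(\<Sum>i\<in>I. \<mu> (Some i) *\<^sub>R a i, (\<Sum>i\<in>I. \<mu> (Some i) * c i) + \<mu> None) \<in> C"
      by (auto simp: C_def J_def intro!: exI[of _ "\<lambda>i. \<mu> (Some i)"])
  next
    fix x t assume "(x, t) \<in> C"
    then obtain \<mu> s where \<mu>: "x = (\<Sum>i\<in>I. \<mu> i *\<^sub>R a i)" "t = (\<Sum>i\<in>I. \<mu> i * c i) + s"
      "\<forall>i\<in>I. \<mu> i \<ge> 0" "s \<ge> 0" by (auto simp: C_def)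
    then show "\<exists>\<mu>. (x, t) = (\<Sum>i\<in>I. \<mu> (Some i) *\<^sub>R a i, (\<Sum>i\<in>I. \<mu> (Some i) * c i) + \<mu> None) \<and> (\<forall>j\<in>J. \<mu> j \<ge> (0::real))"
      by (auto simp: J_def intro!: exI[of _ "\<lambda>j. case j of None \<Rightarrow> s | Some i \<Rightarrow> \<mu> i"])
  qed
  then show ?thesis using polyhedron_convex_cone_hull[of "f ` J"] J by simp
qed

text \<open>The lifted cone is closed, so a bound approached up to every \<epsilon> is reached. This
  turns the infimum in \<open>cone_fun\<close> into actual coefficients.\<close>

lemma linear_programming_attained:
  fixes a :: "'i \<Rightarrow> 'a::euclidean_space" and c :: "'i \<Rightarrow> real"
  assumes "finite I"
    and "\<And>\<epsilon>. \<epsilon> > 0 \<Longrightarrow> \<exists>\<mu>. (\<forall>i\<in>I. \<mu> i \<ge> 0) \<and> d = (\<Sum>i\<in>I. \<mu> i *\<^sub>R a i) \<and> (\<Sum>i\<in>I. \<mu> i * c i) \<le> v + \<epsilon>"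
  shows "\<exists>\<mu>. (\<forall>i\<in>I. \<mu> i \<ge> 0) \<and> d = (\<Sum>i\<in>I. \<mu> i *\<^sub>R a i) \<and> (\<Sum>i\<in>I. \<mu> i * c i) \<le> v"
proof -
  define C where "C = {(\<Sum>i\<in>I. \<mu> i *\<^sub>R a i, (\<Sum>i\<in>I. \<mu> i * c i) + s) | \<mu> s. (\<forall>i\<in>I. \<mu> i \<ge> (0::real)) \<and> s \<ge> (0::real)}"
  have mem: "(x, t) \<in> C \<longleftrightarrow> (\<exists>\<mu>. (\<forall>i\<in>I. \<mu> i \<ge> 0) \<and> x = (\<Sum>i\<in>I. \<mu> i *\<^sub>R a i) \<and> (\<Sum>i\<in>I. \<mu> i * c i) \<le> t)" for x t
  proof
    assume "\<exists>\<mu>. (\<forall>i\<in>I. \<mu> i \<ge> 0) \<and> x = (\<Sum>i\<in>I. \<mu> i *\<^sub>R a i) \<and> (\<Sum>i\<in>I. \<mu> i * c i) \<le> t"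
    then obtain \<mu> where "(\<forall>i\<in>I. \<mu> i \<ge> 0)" "x = (\<Sum>i\<in>I. \<mu> i *\<^sub>R a i)" "(\<Sum>i\<in>I. \<mu> i * c i) \<le> t" by blast
    then show "(x, t) \<in> C" unfolding C_def
      by (intro CollectI exI[of _ \<mu>] exI[of _ "t - (\<Sum>i\<in>I. \<mu> i * c i)"]) auto
  qed (auto simp: C_def)
  have cl: "closed C" using closed_cone_above[OF assms(1), of a c] polyhedron_imp_closed unfolding C_def by blast
  have mn: "(d, v + inverse (real (Suc n))) \<in> C" for n
    using assms(2)[of "inverse (real (Suc n))"] mem by simp
  have "(\<lambda>n. (d, v + inverse (real (Suc n)))) \<longlonglongrightarrow> (d, v + 0)"
    by (intro tendsto_intros LIMSEQ_inverse_real_of_nat)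
  from closed_sequentially[OF cl mn this] have "(d, v) \<in> C" by simp
  then show ?thesis using mem by simp
qed

text \<open>Strong duality with complementary slackness. The feasible \<open>x0\<close> bounds the
  value from below, and a slope supporting the lifted cone at its lowest point over \<open>d\<close>
  is an optimal dual solution.\<close>

lemma linear_programming_duality:
  fixes a :: "'i \<Rightarrow> 'a::euclidean_space" and c :: "'i \<Rightarrow> real"
  assumes I: "finite I"
    and primal: "\<And>i. i \<in> I \<Longrightarrow> \<mu> i \<ge> 0" "d = (\<Sum>i\<in>I. \<mu> i *\<^sub>R a i)"
    and dual: "\<And>i. i \<in> I \<Longrightarrow> x0 \<bullet> a i \<le> c i"
  shows "\<exists>x \<nu>. (\<forall>i\<in>I. \<nu> i \<ge> 0 \<and> x \<bullet> a i \<le> c i \<and> (\<nu> i > 0 \<longrightarrow> x \<bullet> a i = c i)) \<and> d = (\<Sum>i\<in>I. \<nu> i *\<^sub>R a i)"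
proof -
  define C where "C = {(\<Sum>i\<in>I. \<mu> i *\<^sub>R a i, (\<Sum>i\<in>I. \<mu> i * c i) + s) | \<mu> s. (\<forall>i\<in>I. \<mu> i \<ge> (0::real)) \<and> s \<ge> (0::real)}"
  have poly: "polyhedron C" using closed_cone_above[OF I] unfolding C_def .
  have memI: "(\<Sum>i\<in>I. \<mu> i *\<^sub>R a i, t) \<in> C" if "\<forall>i\<in>I. \<mu> i \<ge> 0" "(\<Sum>i\<in>I. \<mu> i * c i) \<le> t" for \<mu> t
    unfolding C_def using that by (intro CollectI exI[of _ \<mu>] exI[of _ "t - (\<Sum>i\<in>I. \<mu> i * c i)"]) simp
  define S where "S = {t. (d, t) \<in> C}"
  have "closed S"
  proof -
    have "closed (Pair d -` C)"
      by (intro continuous_closed_vimage polyhedron_imp_closed[OF poly]) (auto intro!: continuous_intros)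
    then show ?thesis by (simp add: S_def vimage_def)
  qed
  moreover have "S \<noteq> {}" using memI[of \<mu> "(\<Sum>i\<in>I. \<mu> i * c i)"] primal by (auto simp: S_def)
  moreover have "bdd_below S"
  proof (rule bdd_belowI[of _ "x0 \<bullet> d"])
    fix t assume "t \<in> S"
    then obtain \<nu> s where \<nu>: "d = (\<Sum>i\<in>I. \<nu> i *\<^sub>R a i)" "t = (\<Sum>i\<in>I. \<nu> i * c i) + s" "\<forall>i\<in>I. \<nu> i \<ge> 0" "s \<ge> 0"
      by (auto simp: S_def C_def)
    have "x0 \<bullet> d = (\<Sum>i\<in>I. \<nu> i * (x0 \<bullet> a i))" by (simp add: \<nu>(1) inner_sum_right)
    also have "\<dots> \<le> (\<Sum>i\<in>I. \<nu> i * c i)" using \<nu>(3) dual by (intro sum_mono mult_left_mono) auto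
    finally show "x0 \<bullet> d \<le> t" using \<nu> by simp
  qed
  ultimately have inf: "Inf S \<in> S" by (metis closed_contains_Inf)
  then obtain \<nu> s where \<nu>: "d = (\<Sum>i\<in>I. \<nu> i *\<^sub>R a i)" "Inf S = (\<Sum>i\<in>I. \<nu> i * c i) + s" "\<forall>i\<in>I. \<nu> i \<ge> 0" "s \<ge> 0"
    by (auto simp: S_def C_def)
  have low: "Inf S \<le> t" if "(d, t) \<in> C" for t
    using that \<open>bdd_below S\<close> by (auto simp: S_def intro: cInf_lower)
  obtain x where x: "\<And>y t. (y, t) \<in> C \<Longrightarrow> t \<ge> Inf S + x \<bullet> (y - d)"
  proof -
    obtain X where X: "\<forall>m t0 \<delta>. (m, t0) \<in> C \<longrightarrow> \<delta> > 0 \<longrightarrow> (\<forall>t. t0 - \<delta> < t \<and> t < t0 \<longrightarrow> (m, t) \<notin> C) \<longrightarrow>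
           (\<exists>x\<in>X. \<forall>y t. (y, t) \<in> C \<longrightarrow> t \<ge> t0 + x \<bullet> (y - m))"
      using polyhedron_lower_supports[OF poly] by blast
    have "(d, Inf S) \<in> C" using inf by (simp add: S_def)
    moreover have "\<forall>t. Inf S - 1 < t \<and> t < Inf S \<longrightarrow> (d, t) \<notin> C" using low by force
    ultimately have "\<exists>x\<in>X. \<forall>y t. (y, t) \<in> C \<longrightarrow> t \<ge> Inf S + x \<bullet> (y - d)"
      using X zero_less_one by blast
    then show ?thesis using that by blast
  qed
  have scale: "(r *\<^sub>R y, r * t) \<in> C" if "(y, t) \<in> C" "r \<ge> 0" for y t r
  proof -
    obtain \<kappa> s' where "y = (\<Sum>i\<in>I. \<kappa> i *\<^sub>R a i)" "t = (\<Sum>i\<in>I. \<kappa> i * c i) + s'" "\<forall>i\<in>I. \<kappa> i \<ge> 0" "s' \<ge> 0"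
      using \<open>(y, t) \<in> C\<close> by (auto simp: C_def)
    then show ?thesis using \<open>r \<ge> 0\<close>
      by (auto simp: C_def scaleR_right.sum sum_distrib_left algebra_simps
               intro!: exI[of _ "\<lambda>i. r * \<kappa> i"] exI[of _ "r * s'"])
  qed
  \<comment> \<open>The region is a cone, so the support at \<open>(d, Inf S)\<close> must pass
    through the origin: compare it with the multiples 0 and 2 of that point.\<close>
  have val: "x \<bullet> d = Inf S"
  proof -
    have "(0, 0) \<in> C" using scale[of _ _ 0] inf by (auto simp: S_def)
    then have "0 \<ge> Inf S - x \<bullet> d" using x by fastforce
    moreover have "2 * Inf S \<ge> Inf S + x \<bullet> (2 *\<^sub>R d - d)"
      using x[OF scale[of d "Inf S" 2]] inf by (simp add: S_def)
    ultimately show ?thesis by (simp add: inner_diff_right)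
  qed
  have feas: "x \<bullet> a i \<le> c i" if "i \<in> I" for i
  proof -
    have "(\<Sum>j\<in>I. (if j = i then 1 else 0) *\<^sub>R a j, c i) \<in> C"
      by (rule memI) (use that I in \<open>auto simp: if_distrib[where f = "\<lambda>r. r * _"] cong: if_cong\<close>)
    moreover have "(\<Sum>j\<in>I. (if j = i then 1 else 0) *\<^sub>R a j) = a i"
      using that I by (simp add: if_distrib[where f = "\<lambda>r. r *\<^sub>R _"] cong: if_cong)
    ultimately show ?thesis using x val by (fastforce simp: inner_diff_right)
  qed
  \<comment> \<open>A sum of nonnegative slacks with total at most 0: this is complementary
    slackness.\<close>
  have "(\<Sum>i\<in>I. \<nu> i * (c i - x \<bullet> a i)) = (\<Sum>i\<in>I. \<nu> i * c i) - x \<bullet> d"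
    by (simp add: \<nu>(1) inner_sum_right right_diff_distrib sum_subtractf)
  also have "\<dots> \<le> 0" using val \<nu> by simp
  finally have "(\<Sum>i\<in>I. \<nu> i * (c i - x \<bullet> a i)) \<le> 0" .
  then have "\<forall>i\<in>I. \<nu> i * (c i - x \<bullet> a i) = 0"
    using sum_nonneg_eq_0_iff[OF I, of "\<lambda>i. \<nu> i * (c i - x \<bullet> a i)"] \<nu>(3) feas
    by (smt (verit) mult_nonneg_nonneg sum_nonneg)
  then have "\<forall>i\<in>I. \<nu> i \<ge> 0 \<and> x \<bullet> a i \<le> c i \<and> (\<nu> i > 0 \<longrightarrow> x \<bullet> a i = c i)"
    using \<nu>(3) feas by force
  then show ?thesis using \<nu>(1) by blast
qed

text \<open>Minimise the total weight: with all costs 1, slackness gives a functional equal to 1 on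
  the support \<open>J\<close> of an optimal solution, and evaluating it at \<open>e\<close> yields
  the total weight. As there are finitely many possible supports, one constant suffices.\<close>

lemma cone_coefficients_bounded:
  fixes S :: "'a::euclidean_space set"
  assumes "finite S"
  shows "\<exists>C\<ge>0. \<forall>T\<subseteq>S. \<forall>e\<in>convex_cone hull T. \<exists>\<mu>. (\<forall>\<alpha>\<in>T. \<mu> \<alpha> \<ge> 0) \<and>
           e = (\<Sum>\<alpha>\<in>T. \<mu> \<alpha> *\<^sub>R \<alpha>) \<and> (\<Sum>\<alpha>\<in>T. \<mu> \<alpha>) \<le> C * norm e"
proof -
  \<comment> \<open>The functional is chosen by \<open>J\<close> alone, not by \<open>e\<close>, so
    that \<open>C\<close> is uniform; a set \<open>J\<close> without such a functional merely
    enlarges \<open>C\<close>.\<close>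
  define x where "x J = (SOME x. \<forall>\<alpha>\<in>J. x \<bullet> \<alpha> = 1)" for J :: "'a set"
  define C where "C = (\<Sum>J\<in>Pow S. norm (x J))"
  show ?thesis
  proof (intro exI[of _ C] conjI allI impI ballI)
    show "C \<ge> 0" by (simp add: C_def sum_nonneg)
    fix T e assume T: "T \<subseteq> S" and e: "e \<in> convex_cone hull T"
    have fin: "finite T" using T assms finite_subset by blast
    obtain \<kappa> where \<kappa>: "\<forall>\<alpha>\<in>T. \<kappa> \<alpha> \<ge> 0" "e = (\<Sum>\<alpha>\<in>T. \<kappa> \<alpha> *\<^sub>R \<alpha>)"
      using e unfolding convex_cone_hull_finite[OF fin] by blast
    obtain u \<nu> where \<nu>: "\<forall>\<alpha>\<in>T. \<nu> \<alpha> \<ge> 0 \<and> u \<bullet> \<alpha> \<le> 1 \<and> (\<nu> \<alpha> > 0 \<longrightarrow> u \<bullet> \<alpha> = 1)" "e = (\<Sum>\<alpha>\<in>T. \<nu> \<alpha> *\<^sub>R \<alpha>)"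
      using linear_programming_duality[OF fin, of \<kappa> e "\<lambda>\<alpha>. \<alpha>" 0 "\<lambda>_. 1"] \<kappa> by auto
    define J where "J = {\<alpha>\<in>T. \<nu> \<alpha> > 0}"
    have "\<exists>x. \<forall>\<alpha>\<in>J. x \<bullet> \<alpha> = 1" using \<nu> J_def by blast
    then have xJ: "\<forall>\<alpha>\<in>J. x J \<bullet> \<alpha> = 1" unfolding x_def by (rule someI_ex)
    have "(\<Sum>\<alpha>\<in>T. \<nu> \<alpha>) = (\<Sum>\<alpha>\<in>T. \<nu> \<alpha> * (x J \<bullet> \<alpha>))"
      using xJ \<nu>(1) by (intro sum.cong) (force simp: J_def)+
    also have "\<dots> = x J \<bullet> e" by (simp add: \<nu>(2) inner_sum_right)
    also have "\<dots> \<le> norm (x J) * norm e" by (rule norm_cauchy_schwarz)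
    also have "\<dots> \<le> C * norm e"
    proof (rule mult_right_mono)
      show "norm (x J) \<le> C" unfolding C_def
        by (rule member_le_sum) (use T assms in \<open>auto simp: J_def\<close>)
    qed simp
    finally show "\<exists>\<mu>. (\<forall>\<alpha>\<in>T. \<mu> \<alpha> \<ge> 0) \<and> e = (\<Sum>\<alpha>\<in>T. \<mu> \<alpha> *\<^sub>R \<alpha>) \<and> (\<Sum>\<alpha>\<in>T. \<mu> \<alpha>) \<le> C * norm e"
      using \<nu> by blast
  qed
qed

section \<open>Root vectors and special functionals\<close>

definition lat :: "'a::euclidean_space set \<Rightarrow> 'a set" where
  "lat R = {\<Sum>\<alpha>\<in>R. of_int (c \<alpha>) *\<^sub>R \<alpha> | c :: 'a \<Rightarrow> int. True}"

text \<open>The roots annihilated by \<open>w\<close> determine \<open>w\<close> up to scaling, so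
  \<open>w\<close> is normal to a hyperplane spanned by roots. This form is convenient for computing
  \<open>w\<close>: any functional with at least the same zeros must be a multiple of it.\<close>

definition special :: "'a::euclidean_space set \<Rightarrow> 'a \<Rightarrow> bool" where
  "special R w \<longleftrightarrow> w \<noteq> 0 \<and>
     (\<forall>w'. (\<forall>\<beta>\<in>R. w \<bullet> \<beta> = 0 \<longrightarrow> w' \<bullet> \<beta> = 0) \<longrightarrow> (\<exists>c. w' = c *\<^sub>R w))"

text \<open>Only differences are prescribed because the \<open>E i\<close> are determined up to a
  common translation. The second conjunct makes the coordinates free and independent of the other
  roots, which stands in for orthogonality of the components.\<close>

definition type_A :: "'a::euclidean_space set \<Rightarrow> 'a set \<Rightarrow> nat \<Rightarrow> (nat \<Rightarrow> 'a) \<Rightarrow> bool" where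
  "type_A R \<Psi> n E \<longleftrightarrow>
     \<Psi> = {E i - E j | i j. i \<le> n \<and> j \<le> n \<and> i \<noteq> j} \<and>
     (\<forall>f::nat \<Rightarrow> real. \<exists>w. (\<forall>\<delta>\<in>R - \<Psi>. w \<bullet> \<delta> = 0) \<and>
        (\<forall>i\<le>n. \<forall>j\<le>n. w \<bullet> (E i - E j) = f i - f j))"

text \<open>The set \<open>K\<close> is \<open>{1}\<close>, \<open>{2}\<close> or empty for the types B, C and D, respectively.\<close>

definition type_BCD :: "'a::euclidean_space set \<Rightarrow> 'a set \<Rightarrow> nat \<Rightarrow> (nat \<Rightarrow> 'a) \<Rightarrow> real set \<Rightarrow> bool" where
  "type_BCD R \<Psi> n E K \<longleftrightarrow>
     2 \<le> n \<and> K \<in> {{}, {1}, {2}} \<and>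
     \<Psi> = {s *\<^sub>R E i + t *\<^sub>R E j | s t i j. s \<in> {1, -1} \<and> t \<in> {1, -1} \<and> i < n \<and> j < n \<and> i \<noteq> j}
       \<union> {(s * k) *\<^sub>R E i | s k i. s \<in> {1, -1} \<and> k \<in> K \<and> i < n} \<and>
     (\<forall>f::nat \<Rightarrow> real. \<exists>w. (\<forall>\<delta>\<in>R - \<Psi>. w \<bullet> \<delta> = 0) \<and> (\<forall>i<n. w \<bullet> E i = f i))"

definition tcone :: "'a::euclidean_space set \<Rightarrow> 'a \<Rightarrow> 'a set" where
  "tcone P p = closure (convex_cone hull ((\<lambda>q. q - p) ` P))"

text \<open>The counterpart in \<open>V\<close> of integral M-convex polyhedra in the dual
  space.\<close>

definition mpoly :: "'a::euclidean_space set \<Rightarrow> 'a set \<Rightarrow> bool" where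
  "mpoly R P \<longleftrightarrow> P \<noteq> {} \<and> closed P \<and> convex P \<and>
     (\<forall>p\<in>P. \<exists>R'\<subseteq>R. tcone P p = convex_cone hull R') \<and> P = convex hull (P \<inter> lat R)"

text \<open>For spanning roots this is a finite set of functionals integral on the lattice; for
  classical types it contains a positive multiple of every special functional.\<close>

definition small_functionals :: "'a::euclidean_space set \<Rightarrow> 'a set" where
  "small_functionals R = {w. \<forall>\<beta>\<in>R. w \<bullet> \<beta> \<in> {0, 1, -1, 2, -2}}"

lemma lat_add: "x \<in> lat R \<Longrightarrow> y \<in> lat R \<Longrightarrow> x + y \<in> lat R"
proof -
  assume "x \<in> lat R" "y \<in> lat R"
  then obtain c d :: "'a \<Rightarrow> int" where "x = (\<Sum>\<alpha>\<in>R. of_int (c \<alpha>) *\<^sub>R \<alpha>)" "y = (\<Sum>\<alpha>\<in>R. of_int (d \<alpha>) *\<^sub>R \<alpha>)"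
    by (auto simp: lat_def)
  then have "x + y = (\<Sum>\<alpha>\<in>R. of_int (c \<alpha> + d \<alpha>) *\<^sub>R \<alpha>)"
    by (simp add: sum.distrib scaleR_left_distrib)
  then show ?thesis unfolding lat_def by (intro CollectI exI[of _ "\<lambda>\<alpha>. c \<alpha> + d \<alpha>"]) simp
qed

lemma lat_uminus: "x \<in> lat R \<Longrightarrow> - x \<in> lat R"
proof -
  assume "x \<in> lat R"
  then obtain c :: "'a \<Rightarrow> int" where "x = (\<Sum>\<alpha>\<in>R. of_int (c \<alpha>) *\<^sub>R \<alpha>)"
    by (auto simp: lat_def)
  then have "- x = (\<Sum>\<alpha>\<in>R. of_int (- c \<alpha>) *\<^sub>R \<alpha>)"
    by (simp add: sum_negf)
  then show ?thesis unfolding lat_def by (intro CollectI exI[of _ "\<lambda>\<alpha>. - c \<alpha>"]) simp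
qed

lemma lat_diff: "x \<in> lat R \<Longrightarrow> y \<in> lat R \<Longrightarrow> x - y \<in> lat R"
  using lat_add[of x R "- y"] lat_uminus by fastforce

lemma lat_root: "finite R \<Longrightarrow> \<alpha> \<in> R \<Longrightarrow> \<alpha> \<in> lat R"
  unfolding lat_def
  by (intro CollectI exI[of _ "\<lambda>\<beta>. if \<beta> = \<alpha> then 1 else 0"])
     (auto simp: if_distrib[where f = of_int] if_distrib[where f = "\<lambda>r. r *\<^sub>R _"] cong: if_cong)

lemma lat_linear_induct [consumes 1, case_names zero add root]:
  assumes "x \<in> lat R" "P 0" "\<And>x y. P x \<Longrightarrow> P y \<Longrightarrow> P (x + y)" "\<And>\<alpha> (k::int). \<alpha> \<in> R \<Longrightarrow> P (of_int k *\<^sub>R \<alpha>)"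
  shows "P x"
proof -
  obtain c :: "'a \<Rightarrow> int" where x: "x = (\<Sum>\<alpha>\<in>R. of_int (c \<alpha>) *\<^sub>R \<alpha>)"
    using assms(1) by (auto simp: lat_def)
  have "P (\<Sum>\<alpha>\<in>A. of_int (c \<alpha>) *\<^sub>R \<alpha>)" if "A \<subseteq> R" for A
    using that by (induction A rule: infinite_finite_induct) (auto intro: assms)
  then show ?thesis using x by simp
qed

lemma small_functional_lat_Ints:
  assumes "w \<in> small_functionals R" "x \<in> lat R"
  shows "w \<bullet> x \<in> \<int>"
  using assms(2)
proof (induction rule: lat_linear_induct)
  case (root \<alpha> k)
  have "w \<bullet> \<alpha> \<in> {0, 1, -1, 2, -2}" using assms(1) root by (simp add: small_functionals_def)
  then have "w \<bullet> \<alpha> \<in> \<int>" by auto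
  then show ?case by simp
qed (auto simp: inner_add_right)

lemma tcone_mem: "q \<in> P \<Longrightarrow> q - p \<in> tcone P p"
  unfolding tcone_def by (meson closure_subset hull_subset image_eqI subsetD)

lemma tcone_inner_le_0:
  assumes "\<And>q. q \<in> P \<Longrightarrow> w \<bullet> q \<le> w \<bullet> p" "x \<in> tcone P p"
  shows "w \<bullet> x \<le> 0"
proof -
  have "tcone P p \<subseteq> {x. w \<bullet> x \<le> 0}"
    unfolding tcone_def
  proof (rule closure_minimal[OF hull_minimal])
    show "(\<lambda>q. q - p) ` P \<subseteq> {x. w \<bullet> x \<le> 0}" using assms(1) by (auto simp: inner_diff_right)
  qed (auto simp: convex_cone_halfspace_le closed_halfspace_le)
  then show ?thesis using assms(2) by blast
qed

lemma inner_attained_convex_hull: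
  assumes "x \<in> convex hull S"
  shows "\<exists>z\<in>S. w \<bullet> x \<le> w \<bullet> z"
proof (rule ccontr)
  assume "\<not> ?thesis"
  then have "S \<subseteq> {z. w \<bullet> z < w \<bullet> x}" by auto
  then have "convex hull S \<subseteq> {z. w \<bullet> z < w \<bullet> x}" by (intro hull_minimal convex_halfspace_lt)
  then show False using assms by auto
qed

section \<open>Separation by special functionals and its consequences for integral polyhedra\<close>

locale root_vectors =
  fixes R :: "'a::euclidean_space set"
  assumes finR: "finite R"
    and negR: "\<alpha> \<in> R \<Longrightarrow> - \<alpha> \<in> R"
    and spanR: "span R = UNIV"
    and compR: "\<alpha> \<in> R \<Longrightarrow> \<exists>\<Psi>\<subseteq>R. \<alpha> \<in> \<Psi> \<and> ((\<exists>n E. type_A R \<Psi> n E) \<or> (\<exists>n E K. type_BCD R \<Psi> n E K))"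
begin

lemma inner_roots_eq_0: "(\<And>\<beta>. \<beta> \<in> R \<Longrightarrow> w \<bullet> \<beta> = 0) \<Longrightarrow> w = 0"
proof -
  assume "\<And>\<beta>. \<beta> \<in> R \<Longrightarrow> w \<bullet> \<beta> = 0"
  then have "span R \<subseteq> {x. w \<bullet> x = 0}" by (intro span_minimal) (auto simp: subspace_hyperplane)
  then have "w \<in> {x. w \<bullet> x = 0}" using spanR by blast
  then show ?thesis by simp
qed

text \<open>Among the separating functionals choose one vanishing on as many roots as possible.
  If it were not special, moving it in a direction that keeps these zeros and its value at
  \<open>y\<close> would create a further zero.\<close>

lemma special_separation:
  assumes "R' \<subseteq> R" "y \<notin> convex_cone hull R'"
  obtains w where "special R w" "\<And>\<alpha>. \<alpha> \<in> R' \<Longrightarrow> w \<bullet> \<alpha> \<le> 0" "w \<bullet> y > 0"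
proof -
  define W where "W = {w. (\<forall>\<alpha>\<in>R'. w \<bullet> \<alpha> \<le> 0) \<and> w \<bullet> y > 0}"
  define N where "N w = card {\<beta>\<in>R. w \<bullet> \<beta> = 0}" for w
  have fin: "finite R'" using assms(1) finR finite_subset by blast
  obtain w1 where w1: "w1 \<in> W"
  proof -
    have cl: "closed (convex_cone hull R')" by (simp add: closed_convex_cone_hull fin)
    obtain a b where "a \<bullet> y < b \<and> (\<forall>x\<in>convex_cone hull R'. b < a \<bullet> x)"
      using separating_hyperplane_closed_point[OF convex_convex_cone_hull cl assms(2)] by (elim exE)
    then have ab: "a \<bullet> y < b" "\<forall>x\<in>convex_cone hull R'. b < a \<bullet> x" by simp_all
    have b0: "b < 0" using ab(2) convex_cone_hull_contains_0 by fastforce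
    have "a \<bullet> \<alpha> \<ge> 0" if "\<alpha> \<in> R'" for \<alpha>
    proof (rule ccontr)
      assume neg: "\<not> a \<bullet> \<alpha> \<ge> 0"
      have "(b / (a \<bullet> \<alpha>)) *\<^sub>R \<alpha> \<in> convex_cone hull R'"
        by (rule convex_cone_hull_mul) (use that neg b0 in \<open>auto intro: hull_inc divide_nonpos_nonpos\<close>)
      then have "b < a \<bullet> ((b / (a \<bullet> \<alpha>)) *\<^sub>R \<alpha>)" using ab(2) by blast
      then show False using neg by simp
    qed
    then have "- a \<in> W" using ab b0 by (auto simp: W_def)
    then show ?thesis by (rule that)
  qed
  have bound: "\<forall>w. w \<in> W \<longrightarrow> N w < Suc (card R)" by (auto simp: N_def finR less_Suc_eq_le intro: card_mono)
  obtain w where w: "w \<in> W" and max: "\<forall>v. v \<in> W \<longrightarrow> N v \<le> N w"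
    using ex_has_greatest_nat[of "\<lambda>w. w \<in> W" w1 N "Suc (card R)", OF w1 bound] by (elim exE conjE)
  have wy: "w \<bullet> y > 0" and wR': "\<And>\<alpha>. \<alpha> \<in> R' \<Longrightarrow> w \<bullet> \<alpha> \<le> 0" using w by (auto simp: W_def)
  have "special R w"
    unfolding special_def
  proof (intro conjI allI impI)
    show "w \<noteq> 0" using wy by auto
    fix w' assume w': "\<forall>\<beta>\<in>R. w \<bullet> \<beta> = 0 \<longrightarrow> w' \<bullet> \<beta> = 0"
    define d where "d = w' - (w' \<bullet> y / (w \<bullet> y)) *\<^sub>R w"
    have dy: "d \<bullet> y = 0" using wy by (simp add: d_def inner_diff_left)
    have d0: "d \<bullet> \<beta> = 0" if "\<beta> \<in> R" "w \<bullet> \<beta> = 0" for \<beta>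
      using that w' by (simp add: d_def inner_diff_left)
    have "d = 0"
    proof (rule ccontr)
      assume "d \<noteq> 0"
      then obtain \<beta> where \<beta>: "\<beta> \<in> R" "d \<bullet> \<beta> \<noteq> 0" using inner_roots_eq_0 by blast
      then have "w \<bullet> \<beta> \<noteq> 0" using d0 by blast
      obtain \<rho>0 where \<rho>0: "\<rho>0 \<in> R" "w \<bullet> \<rho>0 > 0" "d \<bullet> \<rho>0 \<noteq> 0"
      proof (cases "w \<bullet> \<beta> > 0")
        case True then show ?thesis using \<beta> that by blast
      next
        case False
        then show ?thesis using \<beta> \<open>w \<bullet> \<beta> \<noteq> 0\<close> negR[of \<beta>] by (intro that[of "- \<beta>"]) auto
      qed
      obtain e where e: "e \<bullet> y = 0" "\<And>\<beta>. \<beta> \<in> R \<Longrightarrow> w \<bullet> \<beta> = 0 \<Longrightarrow> e \<bullet> \<beta> = 0" "e \<bullet> \<rho>0 < 0"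
      proof (cases "d \<bullet> \<rho>0 < 0")
        case True then show ?thesis using d0 dy that by blast
      next
        case False then show ?thesis using d0 dy \<rho>0(3) by (intro that[of "- d"]) auto
      qed
      define Q where "Q = {\<rho>\<in>R. w \<bullet> \<rho> > 0 \<and> e \<bullet> \<rho> < 0}"
      \<comment> \<open>The first time at which a positive root becomes zero along
        \<open>w + t *\<^sub>R e\<close>; up to then no root that is positive at \<open>w\<close>
        turns negative, so all sign conditions persist.\<close>
      define t where "t = Min ((\<lambda>\<rho>. - (w \<bullet> \<rho>) / (e \<bullet> \<rho>)) ` Q)"
      have Q: "finite Q" "Q \<noteq> {}" using finR \<rho>0 e(3) by (auto simp: Q_def)
      have "t \<in> (\<lambda>\<rho>. - (w \<bullet> \<rho>) / (e \<bullet> \<rho>)) ` Q" unfolding t_def using Q by (intro Min_in) auto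
      then obtain \<rho> where \<rho>: "\<rho> \<in> Q" "t = - (w \<bullet> \<rho>) / (e \<bullet> \<rho>)" by blast
      have t0: "t > 0" using \<rho> by (auto simp: Q_def divide_pos_neg)
      have tmin: "t \<le> - (w \<bullet> \<sigma>) / (e \<bullet> \<sigma>)" if "\<sigma> \<in> Q" for \<sigma>
        unfolding t_def using Q that by (intro Min_le) auto
      define v where "v = w + t *\<^sub>R e"
      have pos: "v \<bullet> \<sigma> \<ge> 0" if "\<sigma> \<in> R" "w \<bullet> \<sigma> > 0" for \<sigma>
      proof (cases "e \<bullet> \<sigma> < 0")
        case True
        then have "t \<le> - (w \<bullet> \<sigma>) / (e \<bullet> \<sigma>)" using that by (intro tmin) (simp add: Q_def)
        then have "t * (e \<bullet> \<sigma>) \<ge> - (w \<bullet> \<sigma>)" using True by (metis neg_le_divide_eq)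
        then show ?thesis by (simp add: v_def inner_add_left)
      next
        case False
        then have "t * (e \<bullet> \<sigma>) \<ge> 0" using t0 by simp
        then show ?thesis using that(2) by (simp add: v_def inner_add_left)
      qed
      have zero: "v \<bullet> \<sigma> = 0" if "\<sigma> \<in> R" "w \<bullet> \<sigma> = 0" for \<sigma>
        using that e(2) by (simp add: v_def inner_add_left)
      have "v \<bullet> \<alpha> \<le> 0" if "\<alpha> \<in> R'" for \<alpha>
      proof (cases "w \<bullet> \<alpha> = 0")
        case True then show ?thesis using zero that assms(1) by fastforce
      next
        case False
        then have "w \<bullet> (- \<alpha>) > 0" using wR'[OF that] by simp
        then have "v \<bullet> (- \<alpha>) \<ge> 0" using pos[of "- \<alpha>"] negR that assms(1) by blast
        then show ?thesis by simp
      qed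
      moreover have "v \<bullet> y > 0" using wy e(1) by (simp add: v_def inner_add_left)
      ultimately have "v \<in> W" by (simp add: W_def)
      then have "N v \<le> N w" using max by blast
      moreover have "N w < N v"
        unfolding N_def
      proof (rule psubset_card_mono)
        show "finite {\<beta> \<in> R. v \<bullet> \<beta> = 0}" using finR by simp
        have "e \<bullet> \<rho> \<noteq> 0" using \<rho>(1) by (auto simp: Q_def)
        then have "v \<bullet> \<rho> = 0" by (simp add: v_def \<rho>(2) inner_diff_left inner_add_left)
        moreover have "\<rho> \<in> R" "w \<bullet> \<rho> \<noteq> 0" using \<rho>(1) by (auto simp: Q_def)
        ultimately have "\<rho> \<in> {\<beta> \<in> R. v \<bullet> \<beta> = 0} - {\<beta> \<in> R. w \<bullet> \<beta> = 0}" by simp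
        then show "{\<beta> \<in> R. w \<bullet> \<beta> = 0} \<subset> {\<beta> \<in> R. v \<bullet> \<beta> = 0}"
          using zero by blast
      qed
      ultimately show False by simp
    qed
    then show "\<exists>c. w' = c *\<^sub>R w" by (auto simp: d_def)
  qed
  then show ?thesis using that wR' wy by blast
qed

text \<open>The indicator of the indices \<open>k\<close> with
  \<open>w \<bullet> E k = w \<bullet> E i0\<close> defines a functional that vanishes on every root
  where \<open>w\<close> does, so it is a multiple of \<open>w\<close>. Differences of an indicator
  take only the values 0, 1 and -1.\<close>

lemma special_type_A:
  assumes "special R w" "\<Psi> \<subseteq> R" "type_A R \<Psi> n E" "\<alpha> \<in> \<Psi>" "w \<bullet> \<alpha> \<noteq> 0"
  obtains c where "c > 0" "\<And>\<beta>. \<beta> \<in> \<Psi> \<Longrightarrow> w \<bullet> \<beta> \<in> {0, c, - c}" "\<And>\<delta>. \<delta> \<in> R - \<Psi> \<Longrightarrow> w \<bullet> \<delta> = 0"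
proof -
  have \<Psi>: "\<Psi> = {E i - E j | i j. i \<le> n \<and> j \<le> n \<and> i \<noteq> j}" using assms(3) by (simp add: type_A_def)
  obtain i0 j0 where ij: "\<alpha> = E i0 - E j0" "i0 \<le> n" "j0 \<le> n" using assms(4) \<Psi> by blast
  define f where "f k = (if w \<bullet> E k = w \<bullet> E i0 then 1 else 0 :: real)" for k
  obtain v where v: "\<forall>\<delta>\<in>R - \<Psi>. v \<bullet> \<delta> = 0" "\<forall>i\<le>n. \<forall>j\<le>n. v \<bullet> (E i - E j) = f i - f j"
    using assms(3) unfolding type_A_def by meson
  have "\<forall>\<beta>\<in>R. w \<bullet> \<beta> = 0 \<longrightarrow> v \<bullet> \<beta> = 0"
  proof (intro ballI impI)
    fix \<beta> assume \<beta>: "\<beta> \<in> R" "w \<bullet> \<beta> = 0"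
    show "v \<bullet> \<beta> = 0"
    proof (cases "\<beta> \<in> \<Psi>")
      case True
      then obtain i j where "\<beta> = E i - E j" "i \<le> n" "j \<le> n" using \<Psi> by blast
      then show ?thesis using v(2) \<beta>(2) by (simp add: f_def inner_diff_right)
    qed (use v \<beta> in blast)
  qed
  then obtain c where c: "v = c *\<^sub>R w" using assms(1) unfolding special_def by blast
  have "f i0 - f j0 = 1" using assms(5) ij by (simp add: f_def inner_diff_right)
  then have v1: "v \<bullet> \<alpha> = 1" using v(2) ij by simp
  then have c0: "c \<noteq> 0" using c by auto
  have wv: "w \<bullet> x = (v \<bullet> x) / c" for x using c c0 by simp
  show ?thesis
  proof (rule that[of "\<bar>1 / c\<bar>"])
    show "\<bar>1 / c\<bar> > 0" using c0 by simp
    show "w \<bullet> \<beta> \<in> {0, \<bar>1 / c\<bar>, - \<bar>1 / c\<bar>}" if \<beta>: "\<beta> \<in> \<Psi>" for \<beta>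
    proof -
      obtain i j where "\<beta> = E i - E j" "i \<le> n" "j \<le> n" using \<Psi> \<beta> by blast
      then have "v \<bullet> \<beta> \<in> {0, 1, -1}" using v(2) by (auto simp: f_def)
      then show ?thesis using wv[of \<beta>] by (auto simp: abs_if)
    qed
    show "w \<bullet> \<delta> = 0" if "\<delta> \<in> R - \<Psi>" for \<delta> using v(1) that wv by simp
  qed
qed

text \<open>Cutting \<open>w\<close> down to the coordinates of the same absolute value as
  \<open>w \<bullet> E i0\<close> preserves its zeros among the roots. Hence the truncation is a
  multiple of \<open>w\<close>, and agreement at \<open>i0\<close> makes it equal to
  \<open>w\<close>: no other nonzero absolute value occurs.\<close>

lemma special_type_BCD:
  assumes "special R w" "\<Psi> \<subseteq> R" "type_BCD R \<Psi> n E K" "i0 < n" "w \<bullet> E i0 \<noteq> 0"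
  shows "\<And>i. i < n \<Longrightarrow> w \<bullet> E i \<in> {0, \<bar>w \<bullet> E i0\<bar>, - \<bar>w \<bullet> E i0\<bar>}" "\<And>\<delta>. \<delta> \<in> R - \<Psi> \<Longrightarrow> w \<bullet> \<delta> = 0"
proof -
  define f where "f k = (if \<bar>w \<bullet> E k\<bar> = \<bar>w \<bullet> E i0\<bar> then w \<bullet> E k else 0 :: real)" for k
  have BCD: "\<Psi> = {s *\<^sub>R E i + t *\<^sub>R E j | s t i j. s \<in> {1, -1} \<and> t \<in> {1, -1} \<and> i < n \<and> j < n \<and> i \<noteq> j}
       \<union> {(s * k) *\<^sub>R E i | s k i. s \<in> {1, -1} \<and> k \<in> K \<and> i < n}" "K \<in> {{}, {1}, {2}}"
    using assms(3) by (auto simp: type_BCD_def)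
  obtain v where v: "\<forall>\<delta>\<in>R - \<Psi>. v \<bullet> \<delta> = 0" "\<forall>i<n. v \<bullet> E i = f i"
    using assms(3) unfolding type_BCD_def by meson
  have "\<forall>\<beta>\<in>R. w \<bullet> \<beta> = 0 \<longrightarrow> v \<bullet> \<beta> = 0"
  proof (intro ballI impI)
    fix \<beta> assume \<beta>: "\<beta> \<in> R" "w \<bullet> \<beta> = 0"
    consider (out) "\<beta> \<notin> \<Psi>"
      | (D) s t i j where "\<beta> = s *\<^sub>R E i + t *\<^sub>R E j" "s \<in> {1, -1}" "t \<in> {1, -1}" "i < n" "j < n"
      | (K) s k i where "\<beta> = (s * k) *\<^sub>R E i" "s \<in> {1, -1}" "k \<in> K" "i < n"
      using BCD(1) by blast
    then show "v \<bullet> \<beta> = 0"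
    proof cases
      case out then show ?thesis using v \<beta> by blast
    next
      case D
      then have "s * (w \<bullet> E i) + t * (w \<bullet> E j) = 0" using \<beta>(2) by (simp add: inner_add_right)
      then have "s * f i + t * f j = 0" using D(2,3) by (auto simp: f_def)
      then show ?thesis using D v(2) by (simp add: inner_add_right)
    next
      case K
      then have "w \<bullet> E i = 0" using \<beta>(2) BCD(2) by auto
      then have "f i = 0" by (simp add: f_def)
      then show ?thesis using K v(2) by simp
    qed
  qed
  then obtain c where c: "v = c *\<^sub>R w" using assms(1) unfolding special_def by blast
  have "v \<bullet> E i0 = w \<bullet> E i0" using v(2) assms(4) by (simp add: f_def)
  then have "v = w" using c assms(5) by simp
  then show "\<And>i. i < n \<Longrightarrow> w \<bullet> E i \<in> {0, \<bar>w \<bullet> E i0\<bar>, - \<bar>w \<bullet> E i0\<bar>}" "\<And>\<delta>. \<delta> \<in> R - \<Psi> \<Longrightarrow> w \<bullet> \<delta> = 0"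
    using v by (auto simp: f_def split: if_splits)
qed

text \<open>The value \<open>2 * c\<close> arises only outside type A, from two coordinates of
  absolute value \<open>c\<close> adding up or from a root \<open>2 *\<^sub>R E i\<close> of type C.
  It is the reason why a tangent root need not be a legal step.\<close>

lemma special_values:
  assumes "special R w"
  obtains c where "c > 0" "\<And>\<beta>. \<beta> \<in> R \<Longrightarrow> w \<bullet> \<beta> \<in> {0, c, - c, 2 * c, - (2 * c)}"
proof -
  have "w \<noteq> 0" using assms by (simp add: special_def)
  then obtain \<alpha> where \<alpha>: "\<alpha> \<in> R" "w \<bullet> \<alpha> \<noteq> 0" using inner_roots_eq_0 by blast
  obtain \<Psi> where "\<Psi> \<subseteq> R \<and> \<alpha> \<in> \<Psi> \<and> ((\<exists>n E. type_A R \<Psi> n E) \<or> (\<exists>n E K. type_BCD R \<Psi> n E K))"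
    using compR[OF \<alpha>(1)] by (elim exE)
  then have \<Psi>: "\<Psi> \<subseteq> R" "\<alpha> \<in> \<Psi>" "(\<exists>n E. type_A R \<Psi> n E) \<or> (\<exists>n E K. type_BCD R \<Psi> n E K)"
    by simp_all
  from \<Psi>(3) show ?thesis
  proof (elim disjE exE)
    fix n E assume "type_A R \<Psi> n E"
    from special_type_A[OF assms \<Psi>(1) this \<Psi>(2) \<alpha>(2)] obtain c where
      "c > 0" "\<And>\<beta>. \<beta> \<in> \<Psi> \<Longrightarrow> w \<bullet> \<beta> \<in> {0, c, - c}" "\<And>\<delta>. \<delta> \<in> R - \<Psi> \<Longrightarrow> w \<bullet> \<delta> = 0" by blast
    then show ?thesis using that[of c] by blast
  next
    fix n E K assume T: "type_BCD R \<Psi> n E K"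
    have BCD: "\<Psi> = {s *\<^sub>R E i + t *\<^sub>R E j | s t i j. s \<in> {1, -1} \<and> t \<in> {1, -1} \<and> i < n \<and> j < n \<and> i \<noteq> j}
         \<union> {(s * k) *\<^sub>R E i | s k i. s \<in> {1, -1} \<and> k \<in> K \<and> i < n}" "K \<in> {{}, {1}, {2}}"
      using T by (auto simp: type_BCD_def)
    have "\<exists>i<n. w \<bullet> E i \<noteq> 0"
    proof (rule ccontr)
      assume "\<not> ?thesis"
      then have "w \<bullet> \<alpha> = 0" using \<Psi>(2) unfolding BCD(1) by (auto simp: inner_add_right inner_diff_right)
      then show False using \<alpha>(2) by blast
    qed
    then obtain i0 where i0: "i0 < n" "w \<bullet> E i0 \<noteq> 0" by blast
    define c where "c = \<bar>w \<bullet> E i0\<bar>"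
    have c: "c > 0" using i0 by (simp add: c_def)
    have wE: "\<And>i. i < n \<Longrightarrow> w \<bullet> E i \<in> {0, c, - c}" and off: "\<And>\<delta>. \<delta> \<in> R - \<Psi> \<Longrightarrow> w \<bullet> \<delta> = 0"
      using special_type_BCD[OF assms \<Psi>(1) T i0] unfolding c_def by blast+
    have "w \<bullet> \<beta> \<in> {0, c, - c, 2 * c, - (2 * c)}" if "\<beta> \<in> \<Psi>" for \<beta>
      using that unfolding BCD(1)
    proof (elim UnE CollectE exE conjE)
      fix s t i j assume *: "\<beta> = s *\<^sub>R E i + t *\<^sub>R E j" "s \<in> {1, -1}" "t \<in> {1, -1}" "i < n" "j < n"
      have "w \<bullet> \<beta> = s * (w \<bullet> E i) + t * (w \<bullet> E j)" by (simp add: * inner_add_right)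
      moreover have "s = 1 \<or> s = -1" "t = 1 \<or> t = -1" using * by auto
      moreover have "w \<bullet> E i = 0 \<or> w \<bullet> E i = c \<or> w \<bullet> E i = - c" "w \<bullet> E j = 0 \<or> w \<bullet> E j = c \<or> w \<bullet> E j = - c"
        using wE[of i] wE[of j] * by auto
      ultimately show ?thesis by (elim disjE) simp_all
    next
      fix s k i assume *: "\<beta> = (s * k) *\<^sub>R E i" "s \<in> {1, -1}" "k \<in> K" "i < n"
      have "w \<bullet> \<beta> = s * k * (w \<bullet> E i)" by (simp add: *)
      moreover have "s = 1 \<or> s = -1" "k = 1 \<or> k = 2" using * BCD(2) by auto
      moreover have "w \<bullet> E i = 0 \<or> w \<bullet> E i = c \<or> w \<bullet> E i = - c" using wE[of i] * by auto
      ultimately show ?thesis by (elim disjE) simp_all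
    qed
    then show ?thesis using that[of c] c off by blast
  qed
qed

lemma special_rescale:
  assumes "special R w"
  obtains c where "c > 0" "c *\<^sub>R w \<in> small_functionals R"
proof -
  obtain c where c: "c > 0" "\<And>\<beta>. \<beta> \<in> R \<Longrightarrow> w \<bullet> \<beta> \<in> {0, c, - c, 2 * c, - (2 * c)}"
    using special_values[OF assms] by blast
  have "(1 / c) *\<^sub>R w \<in> small_functionals R"
    unfolding small_functionals_def
  proof (intro CollectI ballI)
    fix \<beta> assume "\<beta> \<in> R"
    then show "((1 / c) *\<^sub>R w) \<bullet> \<beta> \<in> {0, 1, - 1, 2, - 2}" using c(1) c(2)[of \<beta>] by auto
  qed
  then show ?thesis using that[of "1 / c"] c(1) by simp
qed

lemma finite_small_functionals: "finite (small_functionals R)"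
proof (rule finite_imageD)
  let ?f = "\<lambda>w. \<lambda>\<beta>\<in>R. w \<bullet> \<beta>"
  have "?f ` small_functionals R \<subseteq> (\<Pi>\<^sub>E \<beta>\<in>R. {0, 1, -1, 2, -2})"
    by (auto simp: small_functionals_def)
  then show "finite (?f ` small_functionals R)"
    by (rule finite_subset) (intro finite_PiE finR, auto)
  show "inj_on ?f (small_functionals R)"
  proof (rule inj_onI)
    fix v w assume "?f v = ?f w"
    then have "v \<bullet> \<beta> = w \<bullet> \<beta>" if "\<beta> \<in> R" for \<beta> using that by (metis restrict_apply')
    then have "v - w = 0" by (intro inner_roots_eq_0) (simp add: inner_diff_left)
    then show "v = w" by simp
  qed
qed

text \<open>The vector from the closest point \<open>q\<close> to \<open>y\<close> is not in the
  tangent cone at \<open>q\<close>, which is generated by roots; separating it by a special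
  functional makes \<open>q\<close> a maximiser over \<open>P\<close>. Because \<open>P\<close> is
  the hull of its lattice points, the maximum is also attained at one of them, which makes it
  integral after rescaling.\<close>

lemma mpoly_separation:
  assumes "mpoly R P" "y \<notin> P"
  obtains w z where "special R w" "z \<in> P" "z \<in> lat R" "\<And>q. q \<in> P \<Longrightarrow> w \<bullet> q \<le> w \<bullet> z" "w \<bullet> z < w \<bullet> y"
proof -
  have P: "P \<noteq> {}" "closed P" "convex P" "P = convex hull (P \<inter> lat R)"
    and tan: "\<And>p. p \<in> P \<Longrightarrow> \<exists>R'\<subseteq>R. tcone P p = convex_cone hull R'"
    using assms(1) unfolding mpoly_def by blast+
  define q where "q = closest_point P y"
  have q: "q \<in> P" unfolding q_def using P by (simp add: closest_point_in_set)
  have "(y - q) \<bullet> x \<le> (y - q) \<bullet> q" if "x \<in> P" for x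
    using closest_point_dot[OF P(3,2) that, of y] by (simp add: q_def inner_diff_right)
  then have "y - q \<in> tcone P q \<Longrightarrow> (y - q) \<bullet> (y - q) \<le> 0"
    using tcone_inner_le_0[of P "y - q" q "y - q"] by blast
  moreover have "y - q \<noteq> 0" using q assms(2) by auto
  ultimately have "y - q \<notin> tcone P q" by (metis inner_gt_zero_iff not_le)
  moreover obtain R' where R': "R' \<subseteq> R" "tcone P q = convex_cone hull R'" using tan[OF q] by blast
  ultimately obtain w where w: "special R w" "\<And>\<alpha>. \<alpha> \<in> R' \<Longrightarrow> w \<bullet> \<alpha> \<le> 0" "w \<bullet> (y - q) > 0"
    using special_separation[OF R'(1)] by metis
  have le: "w \<bullet> x \<le> w \<bullet> q" if "x \<in> P" for x
    using inner_le_0_convex_cone_hull[OF w(2), of R' "x - q"] tcone_mem[OF that, of q] R'(2)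
    by (simp add: inner_diff_right)
  obtain z where z: "z \<in> P \<inter> lat R" "w \<bullet> q \<le> w \<bullet> z"
    using inner_attained_convex_hull[of q "P \<inter> lat R" w] q P(4) by blast
  then have "w \<bullet> z = w \<bullet> q" using le[of z] by simp
  then show ?thesis using that[of w z] z w le by (simp add: inner_diff_right)
qed

lemma mpoly_separation_small:
  assumes "mpoly R P" "y \<notin> P"
  obtains w z where "w \<in> small_functionals R" "z \<in> P" "z \<in> lat R" "\<And>q. q \<in> P \<Longrightarrow> w \<bullet> q \<le> w \<bullet> z" "w \<bullet> z < w \<bullet> y"
proof -
  obtain w z where w: "special R w" "z \<in> P" "z \<in> lat R" "\<And>q. q \<in> P \<Longrightarrow> w \<bullet> q \<le> w \<bullet> z" "w \<bullet> z < w \<bullet> y"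
    using mpoly_separation[OF assms] by blast
  obtain c where "c > 0" "c *\<^sub>R w \<in> small_functionals R" using special_rescale[OF w(1)] by blast
  then show ?thesis using that[of "c *\<^sub>R w" z] w by simp
qed

text \<open>Small functionals take integral maxima on integral polyhedra, and an integer that is
  smaller than \<open>w \<bullet> y\<close> is smaller than \<open>w \<bullet> x\<close> for all \<open>x\<close> close to \<open>y\<close>.\<close>

lemma mpoly_near:
  obtains \<epsilon> where "\<epsilon> > 0" "\<And>C x. mpoly R C \<Longrightarrow> x \<in> C \<Longrightarrow> dist x y < \<epsilon> \<Longrightarrow> y \<in> C"
proof -
  have "\<forall>w\<in>small_functionals R. eventually (\<lambda>x. of_int (\<lceil>w \<bullet> y\<rceil> - 1) < w \<bullet> x) (nhds y)"
  proof
    fix w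
    have "((\<lambda>x. w \<bullet> x) \<longlongrightarrow> w \<bullet> y) (nhds y)" by (intro tendsto_intros) (simp add: filterlim_ident)
    moreover have "of_int (\<lceil>w \<bullet> y\<rceil> - 1) < w \<bullet> y" by linarith
    ultimately show "eventually (\<lambda>x. of_int (\<lceil>w \<bullet> y\<rceil> - 1) < w \<bullet> x) (nhds y)"
      using order_tendstoD(1) by blast
  qed
  then have "eventually (\<lambda>x. \<forall>w\<in>small_functionals R. of_int (\<lceil>w \<bullet> y\<rceil> - 1) < w \<bullet> x) (nhds y)"
    using finite_small_functionals by (simp add: eventually_ball_finite)
  then obtain \<epsilon> where \<epsilon>: "\<epsilon> > 0" "\<And>x w. dist x y < \<epsilon> \<Longrightarrow> w \<in> small_functionals R \<Longrightarrow> of_int (\<lceil>w \<bullet> y\<rceil> - 1) < w \<bullet> x"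
    unfolding eventually_nhds_metric by blast
  show ?thesis
  proof (rule that[OF \<epsilon>(1)])
    fix C x assume C: "mpoly R C" "x \<in> C" "dist x y < \<epsilon>"
    show "y \<in> C"
    proof (rule ccontr)
      assume "y \<notin> C"
      then obtain w z where w: "w \<in> small_functionals R" "z \<in> C" "z \<in> lat R" "\<And>q. q \<in> C \<Longrightarrow> w \<bullet> q \<le> w \<bullet> z" "w \<bullet> z < w \<bullet> y"
        using mpoly_separation_small[OF C(1)] by metis
      obtain k where k: "w \<bullet> z = of_int k" using small_functional_lat_Ints[OF w(1,3)] Ints_cases by blast
      have "of_int (\<lceil>w \<bullet> y\<rceil> - 1) < w \<bullet> x" using \<epsilon>(2) C(3) w(1) by blast
      also have "\<dots> \<le> of_int k" using w(4) C(2) k by metis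
      finally have "\<lceil>w \<bullet> y\<rceil> - 1 < k" by simp
      moreover have "k < \<lceil>w \<bullet> y\<rceil>" using w(5) k by (simp add: less_ceiling_iff)
      ultimately show False by simp
    qed
  qed
qed

text \<open>Tangent cones are closures, so a feasible step is not immediate. For small
  \<open>t\<close> no small functional passes the next integer above its value at \<open>p\<close>;
  a functional separating \<open>p + t *\<^sub>R \<alpha>\<close> therefore has its integral maximum
  at \<open>p\<close> and cannot increase along \<alpha>.\<close>

lemma mpoly_feasible_direction:
  assumes "mpoly R C" "p \<in> C" "\<alpha> \<in> tcone C p"
  obtains t where "t > 0" "p + t *\<^sub>R \<alpha> \<in> C"
proof -
  have "\<forall>w\<in>small_functionals R. eventually (\<lambda>t. w \<bullet> (p + t *\<^sub>R \<alpha>) < of_int (\<lfloor>w \<bullet> p\<rfloor> + 1)) (at_right 0)"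
  proof
    fix w
    have "((\<lambda>t. w \<bullet> (p + t *\<^sub>R \<alpha>)) \<longlongrightarrow> w \<bullet> (p + 0 *\<^sub>R \<alpha>)) (at_right 0)" by (intro tendsto_intros)
    moreover have "w \<bullet> (p + 0 *\<^sub>R \<alpha>) < of_int (\<lfloor>w \<bullet> p\<rfloor> + 1)" by simp
    ultimately show "eventually (\<lambda>t. w \<bullet> (p + t *\<^sub>R \<alpha>) < of_int (\<lfloor>w \<bullet> p\<rfloor> + 1)) (at_right 0)"
      using order_tendstoD(2) by blast
  qed
  then have "eventually (\<lambda>t. \<forall>w\<in>small_functionals R. w \<bullet> (p + t *\<^sub>R \<alpha>) < of_int (\<lfloor>w \<bullet> p\<rfloor> + 1)) (at_right 0)"
    using finite_small_functionals by (simp add: eventually_ball_finite)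
  then obtain b where b: "b > 0" "\<And>t. 0 < t \<Longrightarrow> t < b \<Longrightarrow> \<forall>w\<in>small_functionals R. w \<bullet> (p + t *\<^sub>R \<alpha>) < of_int (\<lfloor>w \<bullet> p\<rfloor> + 1)"
    unfolding eventually_at_right_field by blast
  define t where "t = b / 2"
  have t: "t > 0" "\<And>w. w \<in> small_functionals R \<Longrightarrow> w \<bullet> (p + t *\<^sub>R \<alpha>) < of_int (\<lfloor>w \<bullet> p\<rfloor> + 1)"
    using b by (auto simp: t_def)
  have "p + t *\<^sub>R \<alpha> \<in> C"
  proof (rule ccontr)
    assume "p + t *\<^sub>R \<alpha> \<notin> C"
    then obtain w z where w: "w \<in> small_functionals R" "z \<in> C" "z \<in> lat R" "\<And>q. q \<in> C \<Longrightarrow> w \<bullet> q \<le> w \<bullet> z" "w \<bullet> z < w \<bullet> (p + t *\<^sub>R \<alpha>)"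
      using mpoly_separation_small[OF assms(1)] by metis
    obtain k where k: "w \<bullet> z = of_int k" using small_functional_lat_Ints[OF w(1,3)] Ints_cases by blast
    have "of_int k < (of_int (\<lfloor>w \<bullet> p\<rfloor> + 1) :: real)" using t(2)[OF w(1)] w(5) k by linarith
    then have "k \<le> \<lfloor>w \<bullet> p\<rfloor>" by linarith
    then have "w \<bullet> z \<le> w \<bullet> p" using k by (simp add: le_floor_iff)
    then have "w \<bullet> q \<le> w \<bullet> p" if "q \<in> C" for q using w(4)[OF that] by linarith
    then have "w \<bullet> \<alpha> \<le> 0" using tcone_inner_le_0 assms(3) by blast
    then have "t * (w \<bullet> \<alpha>) \<le> 0" using t(1) by (simp add: mult_nonneg_nonpos)
    then have "w \<bullet> (p + t *\<^sub>R \<alpha>) \<le> w \<bullet> p" by (simp add: inner_add_right)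
    then show False using w(5) w(4)[OF assms(2)] by linarith
  qed
  then show ?thesis using that t(1) by blast
qed

end

section \<open>Tangent cones at lattice points\<close>

context root_vectors
begin

text \<open>For an integral M-convex polyhedron the span of this set is the direction space of the
  minimal face of \<open>P\<close> containing \<open>r\<close>.\<close>

definition lineality :: "'a set \<Rightarrow> 'a \<Rightarrow> 'a set" where
  "lineality P r = {\<beta>\<in>R. \<beta> \<in> tcone P r \<and> - \<beta> \<in> tcone P r}"

lemma tcone_scaleR:
  assumes "mpoly R P" "p \<in> P" "x \<in> tcone P p" "c \<ge> 0"
  shows "c *\<^sub>R x \<in> tcone P p"
proof -
  obtain R' where "tcone P p = convex_cone hull R'" using assms(1,2) unfolding mpoly_def by blast
  then show ?thesis using assms(3,4) convex_cone_hull_mul by blast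
qed

lemma span_lineality_inner_0:
  assumes "\<And>q. q \<in> P \<Longrightarrow> w \<bullet> q \<le> w \<bullet> r" "x \<in> span (lineality P r)"
  shows "w \<bullet> x = 0"
proof -
  have "w \<bullet> \<beta> = 0" if "\<beta> \<in> lineality P r" for \<beta>
    using tcone_inner_le_0[of P w r \<beta>] tcone_inner_le_0[of P w r "- \<beta>"] assms(1) that
    by (force simp: lineality_def)
  then have "span (lineality P r) \<subseteq> {x. w \<bullet> x = 0}"
    by (intro span_minimal) (auto simp: subspace_hyperplane)
  then show ?thesis using assms(2) by blast
qed

text \<open>A lattice point \<open>z\<close> carrying positive weight in a convex combination equal
  to \<open>r\<close> lies in the minimal face at \<open>r\<close>: both \<open>z - r\<close> and
  \<open>r - z\<close> are conical combinations of roots, and a root used with positive weight in a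
  sum that cancels to 0 has its negative in the cone.\<close>

lemma lattice_point_in_lineality_span:
  assumes "mpoly R P" "r \<in> P"
  obtains z where "z \<in> P" "z \<in> lat R" "z - r \<in> span (lineality P r)"
proof -
  have "r \<in> convex hull (P \<inter> lat R)" using assms unfolding mpoly_def by blast
  then obtain S u where S: "finite S" "S \<subseteq> P \<inter> lat R" "\<forall>v\<in>S. 0 \<le> u v" "sum u S = 1" "(\<Sum>v\<in>S. u v *\<^sub>R v) = r"
    unfolding convex_hull_explicit by auto
  have "\<exists>v\<in>S. u v \<noteq> 0"
  proof (rule ccontr)
    assume "\<not> ?thesis"
    then have "sum u S = 0" by simp
    then show False using S(4) by simp
  qed
  then obtain z where z: "z \<in> S" "u z > 0" using S(3) by force
  obtain R' where R': "R' \<subseteq> R" "tcone P r = convex_cone hull R'" using assms unfolding mpoly_def by blast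
  have fin: "finite R'" using R'(1) finR finite_subset by blast
  have mem: "v - r \<in> convex_cone hull R'" if "v \<in> S" for v
    using tcone_mem[of v P r] that S(2) R'(2) by blast
  have "(\<Sum>v\<in>S. u v *\<^sub>R (v - r)) = (\<Sum>v\<in>S. u v *\<^sub>R v) - sum u S *\<^sub>R r"
    by (simp add: scaleR_diff_right sum_subtractf scaleR_sum_left)
  also have "\<dots> = 0" using S by simp
  finally have "(\<Sum>v\<in>S. u v *\<^sub>R (v - r)) = 0" .
  then have "u z *\<^sub>R (z - r) + (\<Sum>v\<in>S-{z}. u v *\<^sub>R (v - r)) = 0"
    using z S(1) by (simp add: sum.remove)
  then have "- (u z *\<^sub>R (z - r)) = (\<Sum>v\<in>S-{z}. u v *\<^sub>R (v - r))" by (rule minus_unique)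
  then have neg: "u z *\<^sub>R (- (z - r)) = (\<Sum>v\<in>S-{z}. u v *\<^sub>R (v - r))"
    by (simp only: scaleR_minus_right)
  have "(1 / u z) *\<^sub>R (u z *\<^sub>R (- (z - r))) \<in> convex_cone hull R'"
    unfolding neg
    by (intro convex_cone_hull_mul convex_cone_hull_sum) (use S z mem in auto)
  then have "- (z - r) \<in> convex_cone hull R'" using z(2) by simp
  then obtain \<nu> where \<nu>: "- (z - r) = (\<Sum>\<beta>\<in>R'. \<nu> \<beta> *\<^sub>R \<beta>)" "\<forall>\<beta>\<in>R'. \<nu> \<beta> \<ge> 0"
    unfolding convex_cone_hull_finite[OF fin] by blast
  obtain \<mu> where \<mu>: "z - r = (\<Sum>\<beta>\<in>R'. \<mu> \<beta> *\<^sub>R \<beta>)" "\<forall>\<beta>\<in>R'. \<mu> \<beta> \<ge> 0"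
    using mem[OF z(1)] unfolding convex_cone_hull_finite[OF fin] by blast
  have zero: "(\<Sum>\<beta>\<in>R'. (\<mu> \<beta> + \<nu> \<beta>) *\<^sub>R \<beta>) = 0"
    unfolding scaleR_left_distrib sum.distrib using \<mu>(1) \<nu>(1) by (metis add.right_inverse)
  have lin: "\<beta> \<in> lineality P r" if \<beta>: "\<beta> \<in> R'" "\<mu> \<beta> > 0" for \<beta>
  proof -
    have pos: "\<mu> \<beta> + \<nu> \<beta> > 0" using \<beta> \<nu>(2) by force
    have "(\<mu> \<beta> + \<nu> \<beta>) *\<^sub>R \<beta> + (\<Sum>\<gamma>\<in>R'-{\<beta>}. (\<mu> \<gamma> + \<nu> \<gamma>) *\<^sub>R \<gamma>) = 0"
      using zero \<beta>(1) fin by (simp add: sum.remove)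
    then have "- ((\<mu> \<beta> + \<nu> \<beta>) *\<^sub>R \<beta>) = (\<Sum>\<gamma>\<in>R'-{\<beta>}. (\<mu> \<gamma> + \<nu> \<gamma>) *\<^sub>R \<gamma>)" by (rule minus_unique)
    then have n: "(\<mu> \<beta> + \<nu> \<beta>) *\<^sub>R (- \<beta>) = (\<Sum>\<gamma>\<in>R'-{\<beta>}. (\<mu> \<gamma> + \<nu> \<gamma>) *\<^sub>R \<gamma>)"
      by (simp only: scaleR_minus_right)
    have "(1 / (\<mu> \<beta> + \<nu> \<beta>)) *\<^sub>R ((\<mu> \<beta> + \<nu> \<beta>) *\<^sub>R (- \<beta>)) \<in> convex_cone hull R'"
      unfolding n
      by (intro convex_cone_hull_mul convex_cone_hull_sum) (use pos \<mu>(2) \<nu>(2) in \<open>auto intro: hull_inc\<close>)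
    then have "- \<beta> \<in> convex_cone hull R'" using pos by simp
    then show ?thesis using \<beta>(1) R' by (auto simp: lineality_def intro: hull_inc)
  qed
  have "z - r \<in> span (lineality P r)"
    unfolding \<mu>(1)
  proof (rule span_sum)
    fix \<beta> assume "\<beta> \<in> R'"
    then show "\<mu> \<beta> *\<^sub>R \<beta> \<in> span (lineality P r)"
      using lin[of \<beta>] \<mu>(2) by (cases "\<mu> \<beta> = 0") (force intro: span_scale span_base span_zero)+
  qed
  then show ?thesis using that z(1) S(2) by blast
qed

end

section \<open>Coordinates and parity in a component of type B, C or D\<close>

locale BCD_component = root_vectors R for R :: "'a::euclidean_space set" +
  fixes \<Psi> n E K
  assumes sub: "\<Psi> \<subseteq> R" and BCD: "type_BCD R \<Psi> n E K"
begin

lemma Psi_eq: "\<Psi> = {s *\<^sub>R E i + t *\<^sub>R E j | s t i j. s \<in> {1, -1} \<and> t \<in> {1, -1} \<and> i < n \<and> j < n \<and> i \<noteq> j}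
       \<union> {(s * k) *\<^sub>R E i | s k i. s \<in> {1, -1} \<and> k \<in> K \<and> i < n}"
  and K_cases: "K = {} \<or> K = {1} \<or> K = {2}"
  using BCD by (auto simp: type_BCD_def)

lemma pair_root:
  assumes "s \<in> {1, -1}" "t \<in> {1, -1}" "i < n" "j < n" "i \<noteq> j"
  shows "s *\<^sub>R E i + t *\<^sub>R E j \<in> R"
proof -
  have "s *\<^sub>R E i + t *\<^sub>R E j \<in> \<Psi>"
    unfolding Psi_eq
    by (rule UnI1, rule CollectI, rule exI[of _ s], rule exI[of _ t], rule exI[of _ i], rule exI[of _ j])
       (use assms in simp)
  then show ?thesis using sub by blast
qed

lemma single_root:
  assumes "s \<in> {1, -1}" "k \<in> K" "i < n"
  shows "(s * k) *\<^sub>R E i \<in> R"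
proof -
  have "(s * k) *\<^sub>R E i \<in> \<Psi>"
    unfolding Psi_eq
    by (rule UnI2, rule CollectI, rule exI[of _ s], rule exI[of _ k], rule exI[of _ i])
       (use assms in simp)
  then show ?thesis using sub by blast
qed

lemma root_cases:
  assumes "\<beta> \<in> R"
  obtains (out) "\<beta> \<in> R - \<Psi>"
    | (pair) s t i j where "\<beta> = s *\<^sub>R E i + t *\<^sub>R E j" "s \<in> {1, -1}" "t \<in> {1, -1}" "i < n" "j < n" "i \<noteq> j"
    | (single) s k i where "\<beta> = (s * k) *\<^sub>R E i" "s \<in> {1, -1}" "k \<in> K" "i < n"
proof (cases "\<beta> \<in> \<Psi>")
  case True
  from this[unfolded Psi_eq] show ?thesis
    by (elim UnE CollectE exE conjE) (rule pair single; assumption)+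
qed (use assms out in blast)

text \<open>The coordinate functionals of the component. Being prescribed on all roots they are
  unique, and \<open>functional_expand\<close> writes every functional supported on the component in
  terms of them.\<close>

definition W :: "nat \<Rightarrow> 'a" where
  "W k = (SOME w. (\<forall>\<delta>\<in>R - \<Psi>. w \<bullet> \<delta> = 0) \<and> (\<forall>i<n. w \<bullet> E i = (if i = k then 1 else 0)))"

lemma functional_exists: "\<exists>w. (\<forall>\<delta>\<in>R - \<Psi>. w \<bullet> \<delta> = 0) \<and> (\<forall>i<n. w \<bullet> E i = f i)"
  using BCD unfolding type_BCD_def by meson

lemma W: "\<delta> \<in> R - \<Psi> \<Longrightarrow> W k \<bullet> \<delta> = 0" "i < n \<Longrightarrow> W k \<bullet> E i = (if i = k then 1 else 0)"
  using someI_ex[OF functional_exists[of "\<lambda>i. if i = k then 1 else 0"]] unfolding W_def[symmetric] by blast+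

lemma functional_expand:
  assumes "\<And>\<delta>. \<delta> \<in> R - \<Psi> \<Longrightarrow> w \<bullet> \<delta> = 0"
  shows "w \<bullet> x = (\<Sum>k<n. (w \<bullet> E k) * (W k \<bullet> x))"
proof -
  define v where "v = w - (\<Sum>k<n. (w \<bullet> E k) *\<^sub>R W k)"
  have vE: "v \<bullet> E i = 0" if "i < n" for i
    using that by (simp add: v_def inner_diff_left inner_sum_left W(2) if_distrib cong: if_cong)
  have "v = 0"
  proof (rule inner_roots_eq_0)
    fix \<beta> assume "\<beta> \<in> R"
    then show "v \<bullet> \<beta> = 0"
    proof (cases rule: root_cases)
      case out
      then show ?thesis using assms W(1) by (simp add: v_def inner_diff_left inner_sum_left)
    qed (use vE in \<open>simp_all add: inner_add_right\<close>)
  qed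
  then have "w \<bullet> x = (\<Sum>k<n. (w \<bullet> E k) *\<^sub>R W k) \<bullet> x" by (simp add: v_def)
  then show ?thesis by (simp add: inner_sum_left)
qed

text \<open>Larger than the lattice in types C and D, where the \<open>E i\<close> have integral
  coordinates without being lattice vectors. In \<open>unit_step_in_good_cone\<close> lattice points
  shifted by such vectors serve as test points.\<close>

definition integral_coords :: "'a set" where
  "integral_coords = {x. \<forall>k<n. W k \<bullet> x \<in> \<int>}"

lemma E_integral: "i < n \<Longrightarrow> s \<in> {1, -1} \<Longrightarrow> s *\<^sub>R E i \<in> integral_coords"
  by (auto simp: integral_coords_def W(2))

lemma integral_add: "x \<in> integral_coords \<Longrightarrow> y \<in> integral_coords \<Longrightarrow> x + y \<in> integral_coords"
  by (auto simp: integral_coords_def inner_add_right)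

lemma integral_diff: "x \<in> integral_coords \<Longrightarrow> y \<in> integral_coords \<Longrightarrow> x - y \<in> integral_coords"
  by (auto simp: integral_coords_def inner_diff_right)

lemma root_integral:
  assumes "\<beta> \<in> R" shows "\<beta> \<in> integral_coords"
  using assms
proof (cases rule: root_cases)
  case out then show ?thesis by (simp add: integral_coords_def W)
next
  case pair then show ?thesis using E_integral integral_add by simp
next
  case (single s k i)
  then have "k \<in> \<int>" "s \<in> \<int>" using K_cases by auto
  then show ?thesis using single by (simp add: integral_coords_def W(2))
qed

lemma lat_integral: "x \<in> lat R \<Longrightarrow> x \<in> integral_coords"
proof (induction rule: lat_linear_induct)
  case (root \<alpha> k)
  then show ?case using root_integral[of \<alpha>] by (simp add: integral_coords_def)
qed (auto simp: integral_coords_def inner_add_right)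

text \<open>All coordinates of \<open>w\<close> are 0 or plus or minus one number, the quantum of
  \<open>w\<close>. Integrality in these units excludes integral points strictly between two
  consecutive levels.\<close>

lemma special_multiple:
  assumes "special R w" "i < n" "w \<bullet> E i \<noteq> 0" "x \<in> integral_coords"
  obtains m :: int where "w \<bullet> x = \<bar>w \<bullet> E i\<bar> * of_int m"
proof -
  define c where "c = \<bar>w \<bullet> E i\<bar>"
  have c: "c > 0" using assms(3) by (simp add: c_def)
  note sg = special_type_BCD[OF assms(1) sub BCD assms(2,3), folded c_def]
  have "w \<bullet> x / c = (\<Sum>k<n. (w \<bullet> E k / c) * (W k \<bullet> x))"
  proof -
    have "w \<bullet> x = (\<Sum>k<n. (w \<bullet> E k) * (W k \<bullet> x))" by (rule functional_expand) (rule sg(2))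
    then have "w \<bullet> x / c = (\<Sum>k<n. (w \<bullet> E k) * (W k \<bullet> x)) / c" by (rule arg_cong)
    then show ?thesis by (simp add: sum_divide_distrib)
  qed
  also have "\<dots> \<in> \<int>"
  proof (rule Ints_sum)
    fix k assume "k \<in> {..<n}"
    then have k: "k < n" by simp
    have "w \<bullet> E k / c \<in> {0, 1, - 1}" using sg(1)[OF k] c by auto
    then have "w \<bullet> E k / c \<in> \<int>" by auto
    moreover have "W k \<bullet> x \<in> \<int>" using assms(4) k by (simp add: integral_coords_def)
    ultimately show "(w \<bullet> E k / c) * (W k \<bullet> x) \<in> \<int>" by (rule Ints_mult)
  qed
  finally obtain m where "w \<bullet> x / c = of_int m" by (rule Ints_cases)
  then have "w \<bullet> x = c * of_int m" using c by (simp add: field_simps)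
  then show ?thesis using that c_def by blast
qed

text \<open>Call \<open>k\<close> equivalent to \<open>i\<close> if \<open>E i - E k\<close> or
  \<open>E i + E k\<close> lies in \<open>span U\<close>. The functional is the corresponding sign
  on the class of \<open>i\<close> and 0 elsewhere; roots in \<open>U\<close> join indices only
  within a class, with compatible signs.\<close>

lemma class_functional:
  assumes U: "U \<subseteq> R" and i: "i < n" "E i \<notin> span U"
  obtains v where "\<And>\<delta>. \<delta> \<in> R - \<Psi> \<Longrightarrow> v \<bullet> \<delta> = 0" "\<And>x. x \<in> span U \<Longrightarrow> v \<bullet> x = 0"
    "v \<bullet> E i = 1" "\<And>k. k < n \<Longrightarrow> v \<bullet> E k \<in> {0, 1, -1}"
    "\<And>k. k < n \<Longrightarrow> v \<bullet> E k \<noteq> 0 \<Longrightarrow> E i - (v \<bullet> E k) *\<^sub>R E k \<in> span U"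
proof -
  define f where "f k = (if E i - E k \<in> span U then 1 else if E i + E k \<in> span U then -1 else 0 :: real)" for k
  obtain v where v: "\<forall>\<delta>\<in>R - \<Psi>. v \<bullet> \<delta> = 0" "\<forall>k<n. v \<bullet> E k = f k" using functional_exists by blast
  have fi: "f i = 1" by (simp add: f_def span_zero)
  have u1: "E i - f k *\<^sub>R E k \<in> span U" if "f k \<noteq> 0" for k
    using that by (auto simp: f_def split: if_splits)
  have u2: "f k = \<epsilon>" if "\<epsilon> \<in> {1, -1}" "E i - \<epsilon> *\<^sub>R E k \<in> span U" for k \<epsilon>
  proof -
    \<comment> \<open>Both signs at once would put \<open>E i\<close>, half the sum of the two
      vectors, into \<open>span U\<close>.\<close>
    have "\<not> (E i - E k \<in> span U \<and> E i + E k \<in> span U)"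
    proof
      assume "E i - E k \<in> span U \<and> E i + E k \<in> span U"
      then have "(E i - E k) + (E i + E k) \<in> span U" by (intro span_add[of "E i - E k" U "E i + E k"]) auto
      then have "(1/2) *\<^sub>R ((E i - E k) + (E i + E k)) \<in> span U" by (rule span_scale)
      moreover have "(1/2) *\<^sub>R ((E i - E k) + (E i + E k)) = E i" by (simp add: algebra_simps flip: scaleR_2)
      ultimately show False using i(2) by simp
    qed
    then show ?thesis using that by (auto simp: f_def)
  qed
  have fvals: "f k \<in> {0, 1, -1}" for k by (simp add: f_def)
  \<comment> \<open>A pair root in the span carries membership in the class from \<open>b\<close> to
    \<open>a\<close> and fixes the sign.\<close>
  have pairf: "f a = - (s * t) * f b"
    if st: "s \<in> {1, -1}" "t \<in> {1, -1}" and mem: "s *\<^sub>R E a + t *\<^sub>R E b \<in> span U" and fb: "f b \<noteq> 0" for s t a b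
  proof (rule u2)
    show "- (s * t) * f b \<in> {1, -1}" using st fvals[of b] fb by auto
    have "(E i - f b *\<^sub>R E b) + (t * f b) *\<^sub>R (s *\<^sub>R E a + t *\<^sub>R E b) \<in> span U"
      by (rule span_add[OF u1[OF fb] span_scale[OF mem]])
    moreover have "(E i - f b *\<^sub>R E b) + (t * f b) *\<^sub>R (s *\<^sub>R E a + t *\<^sub>R E b) = E i - (- (s * t) * f b) *\<^sub>R E a"
      using st by (auto simp: algebra_simps)
    ultimately show "E i - (- (s * t) * f b) *\<^sub>R E a \<in> span U" by simp
  qed
  have "v \<bullet> \<beta> = 0" if \<beta>: "\<beta> \<in> U" for \<beta>
  proof -
    have "\<beta> \<in> R" "\<beta> \<in> span U" using \<beta> U span_base by auto
    from this(1) show ?thesis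
    proof (cases rule: root_cases)
      case out then show ?thesis using v by blast
    next
      case (pair s t a b)
      have "s * f a + t * f b = 0"
      proof (cases "f b = 0")
        case False
        then have "f a = - (s * t) * f b" using pairf pair \<open>\<beta> \<in> span U\<close> by blast
        then show ?thesis using pair(2,3) by auto
      next
        case True
        have "f a = 0"
        proof (rule ccontr)
          assume "f a \<noteq> 0"
          then have "f b = - (t * s) * f a" using pairf[of t s b a] pair \<open>\<beta> \<in> span U\<close> by (simp add: add.commute)
          then show False using True \<open>f a \<noteq> 0\<close> pair(2,3) by auto
        qed
        then show ?thesis using True by simp
      qed
      then show ?thesis using v(2) pair by (simp add: inner_add_right)
    next
      case (single s k a)
      have "s * k \<noteq> 0" using single K_cases by auto
      then have Ea: "E a \<in> span U"
        using span_scale[OF \<open>\<beta> \<in> span U\<close>, of "1 / (s * k)"] single(1) by simp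
      have "f a = 0"
      proof (rule ccontr)
        assume "f a \<noteq> 0"
        then have "(E i - f a *\<^sub>R E a) + f a *\<^sub>R E a \<in> span U" by (intro span_add[OF u1 span_scale[OF Ea]])
        then show False using i(2) by simp
      qed
      then show ?thesis using v(2) single by simp
    qed
  qed
  then have "span U \<subseteq> {x. v \<bullet> x = 0}" by (intro span_minimal) (auto simp: subspace_hyperplane)
  then have sp: "\<And>x. x \<in> span U \<Longrightarrow> v \<bullet> x = 0" by blast
  show ?thesis
    by (rule that[of v]) (use v sp fi i fvals u1 in auto)
qed

text \<open>It suffices to find a functional vanishing on \<open>span U\<close> with all coordinates
  1 or -1, because signs do not matter modulo 2. Take one with as many nonzero coordinates as
  possible; a remaining zero could be filled by adding a class functional.\<close>

lemma even_coordinate_sum: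
  assumes U: "U \<subseteq> R" and no: "\<And>k. k < n \<Longrightarrow> E k \<notin> span U"
    and x: "x \<in> span U" and m: "\<And>k. k < n \<Longrightarrow> W k \<bullet> x = of_int (m k)"
  shows "even (\<Sum>k<n. m k)"
proof -
  define V where "V = {v. (\<forall>\<delta>\<in>R - \<Psi>. v \<bullet> \<delta> = 0) \<and> (\<forall>x\<in>span U. v \<bullet> x = 0) \<and> (\<forall>k<n. v \<bullet> E k \<in> {0, 1, -1})}"
  define N where "N v = card {k. k < n \<and> v \<bullet> E k \<noteq> 0}" for v
  have V0: "0 \<in> V" by (simp add: V_def)
  have bound: "\<forall>v. v \<in> V \<longrightarrow> N v < Suc n"
  proof (intro allI impI)
    fix v
    have "N v \<le> card {..<n}" unfolding N_def by (intro card_mono) auto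
    then show "N v < Suc n" by simp
  qed
  obtain v where v: "v \<in> V" and max: "\<forall>u. u \<in> V \<longrightarrow> N u \<le> N v"
    using ex_has_greatest_nat[of "\<lambda>v. v \<in> V" 0 N "Suc n", OF V0 bound] by (elim exE conjE)
  have full: "v \<bullet> E k \<in> {1, -1}" if k: "k < n" for k
  proof (rule ccontr)
    assume "v \<bullet> E k \<notin> {1, -1}"
    then have vk: "v \<bullet> E k = 0" using v k by (auto simp: V_def)
    obtain u where u: "\<And>\<delta>. \<delta> \<in> R - \<Psi> \<Longrightarrow> u \<bullet> \<delta> = 0" "\<And>x. x \<in> span U \<Longrightarrow> u \<bullet> x = 0"
      "u \<bullet> E k = 1" "\<And>j. j < n \<Longrightarrow> u \<bullet> E j \<in> {0, 1, -1}"
      "\<And>j. j < n \<Longrightarrow> u \<bullet> E j \<noteq> 0 \<Longrightarrow> E k - (u \<bullet> E j) *\<^sub>R E j \<in> span U"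
      using class_functional[OF U k no[OF k]] by metis
    \<comment> \<open>\<open>v\<close> vanishes at \<open>E k\<close> and on \<open>span U\<close>,
      hence on the whole class of \<open>k\<close>; so \<open>u\<close> and \<open>v\<close> have
      disjoint supports and the coordinates of \<open>v + u\<close> are again 0, 1 or -1.\<close>
    have disj: "v \<bullet> E j = 0" if j: "j < n" "u \<bullet> E j \<noteq> 0" for j
    proof -
      have "v \<bullet> (E k - (u \<bullet> E j) *\<^sub>R E j) = 0" using u(5)[OF j] v by (auto simp: V_def)
      then show ?thesis using j(2) vk by (simp add: inner_diff_right)
    qed
    have "v + u \<in> V"
      unfolding V_def
    proof (intro CollectI conjI ballI allI impI)
      fix j assume "j < n"
      then show "(v + u) \<bullet> E j \<in> {0, 1, -1}"
        using disj[of j] u(4)[of j] v by (cases "u \<bullet> E j = 0") (auto simp: V_def inner_add_left)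
    qed (use u v in \<open>auto simp: V_def inner_add_left\<close>)
    moreover have "N v < N (v + u)"
      unfolding N_def
    proof (rule psubset_card_mono)
      have "{j. j < n \<and> v \<bullet> E j \<noteq> 0} \<subseteq> {j. j < n \<and> (v + u) \<bullet> E j \<noteq> 0}"
        using disj by (force simp: inner_add_left)
      moreover have "k \<in> {j. j < n \<and> (v + u) \<bullet> E j \<noteq> 0} - {j. j < n \<and> v \<bullet> E j \<noteq> 0}"
        using k vk u(3) by (simp add: inner_add_left)
      ultimately show "{j. j < n \<and> v \<bullet> E j \<noteq> 0} \<subset> {j. j < n \<and> (v + u) \<bullet> E j \<noteq> 0}" by blast
    qed simp
    ultimately show False using max by (simp add: leD)
  qed
  define \<epsilon> where "\<epsilon> k = (if v \<bullet> E k = 1 then 1 else -1 :: int)" for k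
  have \<epsilon>: "v \<bullet> E k = of_int (\<epsilon> k)" if "k < n" for k using full[OF that] by (auto simp: \<epsilon>_def)
  have off: "\<And>\<delta>. \<delta> \<in> R - \<Psi> \<Longrightarrow> v \<bullet> \<delta> = 0" using v unfolding V_def by blast
  have "v \<bullet> x = 0" using v x unfolding V_def by blast
  then have "(\<Sum>k<n. (v \<bullet> E k) * (W k \<bullet> x)) = 0" using functional_expand[OF off, of x] by simp
  moreover have "(\<Sum>k<n. (v \<bullet> E k) * (W k \<bullet> x)) = (\<Sum>k<n. of_int (\<epsilon> k * m k))"
    by (intro sum.cong) (auto simp: \<epsilon> m)
  ultimately have "(of_int (\<Sum>k<n. \<epsilon> k * m k) :: real) = 0" by simp
  then have "(\<Sum>k<n. \<epsilon> k * m k) = 0" by (simp only: of_int_eq_0_iff)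
  moreover have "even ((\<Sum>k<n. m k) - (\<Sum>k<n. \<epsilon> k * m k))"
    unfolding sum_subtractf[symmetric] by (intro dvd_sum) (auto simp: \<epsilon>_def)
  ultimately show ?thesis by simp
qed

text \<open>In types C and D every root of the component has coordinate sum 0, 2 or -2, and all
  other roots have sum 0. Excluding \<open>K = {1}\<close> excludes the short roots of type B, whose
  sum is odd.\<close>

lemma lat_even_coordinate_sum:
  assumes "K \<noteq> {1}" "x \<in> lat R"
  obtains m :: int where "(\<Sum>k<n. W k \<bullet> x) = 2 * of_int m"
proof -
  define S where "S = (\<Sum>k<n. W k)"
  have SE: "S \<bullet> E i = 1" if "i < n" for i
    using that by (simp add: S_def inner_sum_left W(2))
  have off: "S \<bullet> \<delta> = 0" if "\<delta> \<in> R - \<Psi>" for \<delta>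
    using that by (simp add: S_def inner_sum_left W(1))
  have "S \<bullet> x / 2 \<in> \<int>"
    using assms(2)
  proof (induction rule: lat_linear_induct)
    case (root \<alpha> k)
    have "S \<bullet> \<alpha> / 2 \<in> \<int>"
      using root
    proof (cases rule: root_cases)
      case out then show ?thesis using off by simp
    next
      case (pair s t i j)
      then have "S \<bullet> \<alpha> / 2 \<in> {1, 0, -1}" using SE by (auto simp: inner_add_right)
      then show ?thesis by auto
    next
      case (single s k i)
      then have "S \<bullet> \<alpha> / 2 \<in> {1, -1}" using SE K_cases assms(1) by auto
      then show ?thesis by auto
    qed
    then have "of_int k * (S \<bullet> \<alpha> / 2) \<in> \<int>" by (intro Ints_mult Ints_of_int)
    then show ?case by (simp only: inner_scaleR_right times_divide_eq_right)
  qed (auto simp: inner_add_right add_divide_distrib)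
  then obtain m where "S \<bullet> x / 2 = of_int m" by (rule Ints_cases)
  then show ?thesis using that[of m] by (simp add: S_def inner_sum_left)
qed

text \<open>A separating special functional gains at most one quantum along the unit vector, so its
  excess at a lattice point over \<open>p\<close>, a nonnegative multiple of the quantum that is
  strictly smaller, is 0. Then \<open>p\<close> is a maximiser and the direction could not be
  tangent. The point reached need not be a lattice point.\<close>

lemma unit_step_mem:
  assumes P: "mpoly R P" "p \<in> P" "p \<in> lat R" and i: "i < n" and s: "s \<in> {1, -1}"
    and F: "s *\<^sub>R E i \<in> tcone P p"
  shows "p + s *\<^sub>R E i \<in> P"
proof (rule ccontr)
  assume "p + s *\<^sub>R E i \<notin> P"
  then obtain w z where w: "special R w" "z \<in> P" "z \<in> lat R" "\<And>q. q \<in> P \<Longrightarrow> w \<bullet> q \<le> w \<bullet> z"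
    "w \<bullet> z < w \<bullet> (p + s *\<^sub>R E i)" using mpoly_separation[OF P(1)] by metis
  have lt: "w \<bullet> (z - p) < s * (w \<bullet> E i)" using w(5) by (simp add: inner_add_right inner_diff_right)
  have ge: "w \<bullet> (z - p) \<ge> 0" using w(4)[OF P(2)] by (simp add: inner_diff_right)
  have nz: "w \<bullet> E i \<noteq> 0" using lt ge by auto
  obtain m where m: "w \<bullet> (z - p) = \<bar>w \<bullet> E i\<bar> * of_int m"
    using special_multiple[OF w(1) i nz lat_integral[OF lat_diff[OF w(3) P(3)]]] .
  have "s * (w \<bullet> E i) \<le> \<bar>w \<bullet> E i\<bar>" using s by auto
  then have "\<bar>w \<bullet> E i\<bar> * of_int m < \<bar>w \<bullet> E i\<bar> * 1" "0 \<le> \<bar>w \<bullet> E i\<bar> * of_int m" using lt ge m by linarith+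
  then have "m = 0" using nz by (auto simp: zero_le_mult_iff)
  then have "w \<bullet> z = w \<bullet> p" using m by (simp add: inner_diff_right)
  then have "w \<bullet> (s *\<^sub>R E i) \<le> 0" using tcone_inner_le_0[of P w p "s *\<^sub>R E i"] w(4) F by simp
  then show False using lt ge by simp
qed

text \<open>For types C and D lattice points have even coordinate sum, but \<open>r = p + s E\<^sub>i\<close> has not. Since the
  minimal face of \<open>P\<close> at \<open>r\<close> contains a lattice point, its span contains some \<open>E\<^sub>j\<close>, and then the
  lattice points \<open>r + E\<^sub>j\<close> and \<open>r - E\<^sub>j\<close> belong to \<open>P\<close>.\<close>

lemma unit_step_in_good_cone:
  assumes P: "mpoly R P" "p \<in> P" "p \<in> lat R" and i: "i < n" and s: "s \<in> {1, -1}"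
    and F: "s *\<^sub>R E i \<in> tcone P p"
  shows "s *\<^sub>R E i \<in> convex_cone hull {\<beta>\<in>R. p + \<beta> \<in> P}"
proof (cases "K = {1}")
  case True
  then have "s *\<^sub>R E i \<in> R" using single_root[OF s, of 1 i] i by simp
  then show ?thesis using unit_step_mem[OF assms] by (intro hull_inc) simp
next
  case False
  define r where "r = p + s *\<^sub>R E i"
  have r: "r \<in> P" unfolding r_def by (rule unit_step_mem[OF assms])
  define U where "U = lineality P r"
  have UR: "U \<subseteq> R" by (auto simp: U_def lineality_def)
  obtain z where z: "z \<in> P" "z \<in> lat R" "z - r \<in> span U"
    using lattice_point_in_lineality_span[OF P(1) r] unfolding U_def by blast
  have zr: "z - r = (z - p) - s *\<^sub>R E i" by (simp add: r_def)
  obtain j where j: "j < n" "E j \<in> span U"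
  proof -
    have "\<exists>j<n. E j \<in> span U"
    proof (rule ccontr)
      assume no: "\<not> ?thesis"
      have "z - r \<in> integral_coords"
        unfolding zr by (intro integral_diff E_integral i s lat_integral lat_diff z P)
      then have "\<forall>k. \<exists>m. k < n \<longrightarrow> W k \<bullet> (z - r) = of_int m" by (auto simp: integral_coords_def elim: Ints_cases)
      then obtain m where m: "\<And>k. k < n \<Longrightarrow> W k \<bullet> (z - r) = of_int (m k)" by metis
      have ev: "even (\<Sum>k<n. m k)" using even_coordinate_sum[OF UR _ z(3) m] no by blast
      obtain l where l: "(\<Sum>k<n. W k \<bullet> (z - p)) = 2 * of_int l"
        using lat_even_coordinate_sum[OF False lat_diff[OF z(2) P(3)]] by blast
      have "(of_int (\<Sum>k<n. m k) :: real) = (\<Sum>k<n. W k \<bullet> (z - r))" by (simp add: m)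
      also have "\<dots> = (\<Sum>k<n. W k \<bullet> (z - p)) - (\<Sum>k<n. s * (W k \<bullet> E i))"
        unfolding zr by (simp add: inner_diff_right sum_subtractf)
      also have "(\<Sum>k<n. s * (W k \<bullet> E i)) = s" using i by (simp add: W(2) if_distrib cong: if_cong)
      finally have eq: "(of_int (\<Sum>k<n. m k) :: real) = 2 * of_int l - s" using l by simp
      have "s = of_int (if s = 1 then 1 else -1)" using s by auto
      then have "(of_int (\<Sum>k<n. m k) :: real) = of_int (2 * l - (if s = 1 then 1 else -1))" using eq by simp
      then have "(\<Sum>k<n. m k) = 2 * l - (if s = 1 then 1 else -1)" by (simp only: of_int_eq_iff)
      then show False using ev by (auto split: if_splits)
    qed
    then show ?thesis using that by blast
  qed
  \<comment> \<open>The quantum argument of \<open>unit_step_mem\<close>, now based at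
    \<open>r\<close>; membership in the span of the minimal face replaces tangency.\<close>
  have step: "r + \<sigma> *\<^sub>R E j \<in> P" if j: "j < n" "E j \<in> span U" and \<sigma>: "\<sigma> \<in> {1, -1}" for j \<sigma>
  proof (rule ccontr)
    assume "r + \<sigma> *\<^sub>R E j \<notin> P"
    then obtain w z' where w: "special R w" "z' \<in> P" "z' \<in> lat R" "\<And>q. q \<in> P \<Longrightarrow> w \<bullet> q \<le> w \<bullet> z'"
      "w \<bullet> z' < w \<bullet> (r + \<sigma> *\<^sub>R E j)" using mpoly_separation[OF P(1)] by metis
    have lt: "w \<bullet> (z' - r) < \<sigma> * (w \<bullet> E j)" using w(5) by (simp add: inner_add_right inner_diff_right)
    have ge: "w \<bullet> (z' - r) \<ge> 0" using w(4)[OF r] by (simp add: inner_diff_right)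
    have nz: "w \<bullet> E j \<noteq> 0" using lt ge by auto
    have "z' - r = (z' - p) - s *\<^sub>R E i" by (simp add: r_def)
    then have "z' - r \<in> integral_coords" by (simp only:) (intro integral_diff E_integral i s lat_integral lat_diff w P)
    then obtain m where m: "w \<bullet> (z' - r) = \<bar>w \<bullet> E j\<bar> * of_int m"
      using special_multiple[OF w(1) j(1) nz] by metis
    have "\<sigma> * (w \<bullet> E j) \<le> \<bar>w \<bullet> E j\<bar>" using \<sigma> by auto
    then have "\<bar>w \<bullet> E j\<bar> * of_int m < \<bar>w \<bullet> E j\<bar> * 1" "0 \<le> \<bar>w \<bullet> E j\<bar> * of_int m" using lt ge m by linarith+
    then have "m = 0" using nz by (auto simp: zero_le_mult_iff)
    then have "w \<bullet> z' = w \<bullet> r" using m by (simp add: inner_diff_right)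
    then have "w \<bullet> E j = 0" using span_lineality_inner_0[of P w r "E j"] w(4) j(2) by (simp add: U_def)
    then show False using nz by simp
  qed
  \<comment> \<open>The legal steps \<open>s *\<^sub>R E i + E j\<close> and
    \<open>s *\<^sub>R E i - E j\<close> need an index other than \<open>i\<close>. If only
    \<open>E i\<close> is known to be in the span, a root of \<open>U\<close> with nonzero
    \<open>i\<close>-th coordinate either involves a second index, whose vector is then in the span
    as well, or is the long root of type C.\<close>
  have "(\<exists>j<n. j \<noteq> i \<and> E j \<in> span U) \<or> (2 \<in> K \<and> E i \<in> span U)"
  proof (cases "j = i")
    case True
    have "\<exists>\<beta>\<in>U. W i \<bullet> \<beta> \<noteq> 0"
    proof (rule ccontr)
      assume "\<not> ?thesis"
      then have "span U \<subseteq> {x. W i \<bullet> x = 0}" by (intro span_minimal) (auto simp: subspace_hyperplane)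
      then show False using j True by (auto simp: W(2))
    qed
    then obtain \<beta> where \<beta>: "\<beta> \<in> U" "W i \<bullet> \<beta> \<noteq> 0" by blast
    have "\<beta> \<in> R" using \<beta> UR by blast
    then show ?thesis
    proof (cases rule: root_cases)
      case out then show ?thesis using \<beta>(2) W(1) by blast
    next
      case (single s' k a)
      then show ?thesis using K_cases False j True by auto
    next
      case (pair s' t a b)
      have "i = a \<or> i = b" using \<beta>(2) pair by (auto simp: W(2) inner_add_right split: if_splits)
      then show ?thesis
      proof
        assume a: "i = a"
        have "t *\<^sub>R (\<beta> - s' *\<^sub>R E i) \<in> span U"
          using \<beta>(1) j(2) True by (intro span_scale span_diff) (auto intro: span_base)
        moreover have "t *\<^sub>R (\<beta> - s' *\<^sub>R E i) = E b" using pair a by auto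
        ultimately show ?thesis using pair a by auto
      next
        assume b: "i = b"
        have "s' *\<^sub>R (\<beta> - t *\<^sub>R E i) \<in> span U"
          using \<beta>(1) j(2) True by (intro span_scale span_diff) (auto intro: span_base)
        moreover have "s' *\<^sub>R (\<beta> - t *\<^sub>R E i) = E a" using pair b by auto
        ultimately show ?thesis using pair b by auto
      qed
    qed
  qed (use j in blast)
  then show ?thesis
  proof (elim disjE exE conjE)
    fix j assume j: "j < n" "j \<noteq> i" "E j \<in> span U"
    have good: "s *\<^sub>R E i + \<sigma> *\<^sub>R E j \<in> convex_cone hull {\<beta>\<in>R. p + \<beta> \<in> P}" if "\<sigma> \<in> {1, -1}" for \<sigma>
      using step[OF j(1,3) that] pair_root[OF s that i j(1)] j(2)
      by (intro hull_inc) (simp add: r_def add.assoc)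
    have "(1/2) *\<^sub>R ((s *\<^sub>R E i + 1 *\<^sub>R E j) + (s *\<^sub>R E i + (-1) *\<^sub>R E j)) \<in> convex_cone hull {\<beta>\<in>R. p + \<beta> \<in> P}"
      by (rule convex_cone_hull_mul[OF convex_cone_hull_add[OF good good]]) auto
    moreover have "(1/2) *\<^sub>R ((s *\<^sub>R E i + 1 *\<^sub>R E j) + (s *\<^sub>R E i + (-1) *\<^sub>R E j)) = s *\<^sub>R E i"
      by (simp add: algebra_simps flip: scaleR_2)
    ultimately show ?thesis by simp
  next
    assume K: "2 \<in> K" "E i \<in> span U"
    have "p + (s * 2) *\<^sub>R E i = r + s *\<^sub>R E i" unfolding r_def mult_2_right scaleR_left_distrib by simp
    then have "(s * 2) *\<^sub>R E i \<in> {\<beta>\<in>R. p + \<beta> \<in> P}" using single_root[OF s K(1) i] step[OF i K(2) s] by simp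
    then have "(1/2) *\<^sub>R ((s * 2) *\<^sub>R E i) \<in> convex_cone hull {\<beta>\<in>R. p + \<beta> \<in> P}"
      by (intro convex_cone_hull_mul hull_inc) auto
    then show ?thesis by simp
  qed
qed

text \<open>The midpoint \<open>r = p + \<alpha>/2\<close> of the bad step \<open>\<alpha> = s E\<^sub>i + t E\<^sub>j\<close> still lies in \<open>P\<close>. As the minimal face at
  \<open>r\<close> contains a lattice point, parity forces \<open>s E\<^sub>i - t E\<^sub>j\<close> into its span. A functional separating
  \<open>s E\<^sub>i\<close> from the tangent cone vanishes on \<open>\<alpha>\<close>, hence is maximal at \<open>r\<close> and vanishes on that span,
  a contradiction.\<close>

lemma bad_pair_splits:
  assumes P: "mpoly R P" "p \<in> P" "p \<in> lat R" and ij: "i < n" "j < n" "i \<noteq> j"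
    and st: "s \<in> {1, -1}" "t \<in> {1, -1}"
    and \<alpha>: "s *\<^sub>R E i + t *\<^sub>R E j \<in> tcone P p" and bad: "p + (s *\<^sub>R E i + t *\<^sub>R E j) \<notin> P"
  shows "s *\<^sub>R E i \<in> tcone P p"
proof (rule ccontr)
  assume notin: "s *\<^sub>R E i \<notin> tcone P p"
  define \<alpha> where "\<alpha> = s *\<^sub>R E i + t *\<^sub>R E j"
  have vals: "\<exists>c>0. (\<forall>k<n. w \<bullet> E k \<in> {0, c, -c}) \<and> (\<forall>x\<in>integral_coords. \<exists>m::int. w \<bullet> x = c * of_int m)"
    if "special R w" "k < n" "w \<bullet> E k \<noteq> 0" for w k
  proof (intro exI[of _ "\<bar>w \<bullet> E k\<bar>"] conjI ballI allI impI)
    show "\<bar>w \<bullet> E k\<bar> > 0" using that(3) by simp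
    show "w \<bullet> E l \<in> {0, \<bar>w \<bullet> E k\<bar>, - \<bar>w \<bullet> E k\<bar>}" if "l < n" for l
      using special_type_BCD(1)[OF \<open>special R w\<close> sub BCD \<open>k < n\<close> \<open>w \<bullet> E k \<noteq> 0\<close> that] .
    show "\<exists>m::int. w \<bullet> x = \<bar>w \<bullet> E k\<bar> * of_int m" if "x \<in> integral_coords" for x
      using special_multiple[OF \<open>special R w\<close> \<open>k < n\<close> \<open>w \<bullet> E k \<noteq> 0\<close> that] by blast
  qed
  have intdiff: "z - p \<in> integral_coords" if "z \<in> lat R" for z using lat_integral lat_diff that P(3) by blast
  obtain w z0 where w: "special R w" "z0 \<in> P" "z0 \<in> lat R" "\<And>q. q \<in> P \<Longrightarrow> w \<bullet> q \<le> w \<bullet> z0"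
    "w \<bullet> z0 < w \<bullet> (p + \<alpha>)" using mpoly_separation[OF P(1) bad] unfolding \<alpha>_def by metis
  have lt: "w \<bullet> (z0 - p) < w \<bullet> \<alpha>" using w(5) by (simp add: inner_add_right inner_diff_right)
  have ge: "w \<bullet> (z0 - p) \<ge> 0" using w(4)[OF P(2)] by (simp add: inner_diff_right)
  have w\<alpha>: "w \<bullet> \<alpha> = s * (w \<bullet> E i) + t * (w \<bullet> E j)" for w by (simp add: \<alpha>_def inner_add_right)
  have "w \<bullet> E i \<noteq> 0 \<or> w \<bullet> E j \<noteq> 0" using lt ge w\<alpha>[of w] by auto
  then obtain c where c: "c > 0" "\<And>k. k < n \<Longrightarrow> w \<bullet> E k \<in> {0, c, -c}" "\<And>x. x \<in> integral_coords \<Longrightarrow> \<exists>m::int. w \<bullet> x = c * of_int m"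
    using vals[OF w(1)] ij by metis
  obtain m where m: "w \<bullet> (z0 - p) = c * of_int m" using c(3)[OF intdiff[OF w(3)]] by blast
  have "m \<ge> 0" using ge m c(1) by (simp add: zero_le_mult_iff)
  have "m \<noteq> 0"
  proof
    assume "m = 0"
    then have "w \<bullet> z0 = w \<bullet> p" using m by (simp add: inner_diff_right)
    then have "w \<bullet> \<alpha> \<le> 0" using tcone_inner_le_0[of P w p \<alpha>] w(4) \<alpha> by (simp add: \<alpha>_def)
    then show False using lt ge by simp
  qed
  then have "of_int m \<ge> (1::real)" using \<open>m \<ge> 0\<close> by linarith
  then have "c * of_int m \<ge> c * 1" using c(1) by (intro mult_left_mono) auto
  then have "w \<bullet> \<alpha> > c" using lt m by simp
  then have wi: "s * (w \<bullet> E i) = c" "t * (w \<bullet> E j) = c"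
    using c(2)[OF ij(1)] c(2)[OF ij(2)] st c(1) by (auto simp: w\<alpha>)
  then have w2: "w \<bullet> \<alpha> = 2 * c" by (simp add: w\<alpha>)
  have "c * of_int m < c * 2" using lt m w2 by simp
  then have "m < 2" using c(1) by simp
  \<comment> \<open>The excess of the best lattice point over \<open>p\<close> is a multiple of the
    quantum strictly between 0 and the gain \<open>2 * c\<close> along \<alpha>, so exactly one
    quantum. The midpoint \<open>r\<close> therefore lies on the face where \<open>w\<close> is
    maximal.\<close>
  then have m1: "m = 1" using \<open>m \<ge> 0\<close> \<open>m \<noteq> 0\<close> by simp
  define r where "r = p + (1/2) *\<^sub>R \<alpha>"
  have r: "r \<in> P"
  proof (rule ccontr)
    assume "r \<notin> P"
    then obtain w' z' where w': "special R w'" "z' \<in> P" "z' \<in> lat R" "\<And>q. q \<in> P \<Longrightarrow> w' \<bullet> q \<le> w' \<bullet> z'"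
      "w' \<bullet> z' < w' \<bullet> r" using mpoly_separation[OF P(1)] by metis
    have lt': "w' \<bullet> (z' - p) < w' \<bullet> \<alpha> / 2" using w'(5) by (simp add: r_def inner_add_right inner_diff_right)
    have ge': "w' \<bullet> (z' - p) \<ge> 0" using w'(4)[OF P(2)] by (simp add: inner_diff_right)
    have "w' \<bullet> E i \<noteq> 0 \<or> w' \<bullet> E j \<noteq> 0" using lt' ge' w\<alpha>[of w'] by auto
    then obtain c' where c': "c' > 0" "\<And>k. k < n \<Longrightarrow> w' \<bullet> E k \<in> {0, c', -c'}" "\<And>x. x \<in> integral_coords \<Longrightarrow> \<exists>m::int. w' \<bullet> x = c' * of_int m"
      using vals[OF w'(1)] ij by metis
    obtain m' where m': "w' \<bullet> (z' - p) = c' * of_int m'" using c'(3)[OF intdiff[OF w'(3)]] by blast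
    have "w' \<bullet> \<alpha> / 2 \<le> c'" using c'(2)[OF ij(1)] c'(2)[OF ij(2)] st c'(1) by (auto simp: w\<alpha>)
    then have "c' * of_int m' < c' * 1" "0 \<le> c' * of_int m'" using lt' ge' m' by linarith+
    then have "m' = 0" using c'(1) by (auto simp: zero_le_mult_iff)
    then have "w' \<bullet> z' = w' \<bullet> p" using m' by (simp add: inner_diff_right)
    then have "w' \<bullet> \<alpha> \<le> 0" using tcone_inner_le_0[of P w' p \<alpha>] w'(4) \<alpha> by (simp add: \<alpha>_def)
    then show False using lt' ge' by simp
  qed
  define U where "U = lineality P r"
  have UR: "U \<subseteq> R" by (auto simp: U_def lineality_def)
  have "w \<bullet> r = w \<bullet> z0" using m m1 w2 by (simp add: r_def inner_add_right inner_diff_right)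
  then have wU: "w \<bullet> x = 0" if "x \<in> span U" for x
    using span_lineality_inner_0[of P w r x] w(4) that by (simp add: U_def)
  have EiU: "E i \<notin> span U" using wU wi c(1) by force
  obtain z where z: "z \<in> P" "z \<in> lat R" "z - r \<in> span U"
    using lattice_point_in_lineality_span[OF P(1) r] unfolding U_def by blast
  obtain v where v: "\<And>\<delta>. \<delta> \<in> R - \<Psi> \<Longrightarrow> v \<bullet> \<delta> = 0" "\<And>x. x \<in> span U \<Longrightarrow> v \<bullet> x = 0"
    "v \<bullet> E i = 1" "\<And>k. k < n \<Longrightarrow> v \<bullet> E k \<in> {0, 1, -1}"
    "\<And>k. k < n \<Longrightarrow> v \<bullet> E k \<noteq> 0 \<Longrightarrow> E i - (v \<bullet> E k) *\<^sub>R E k \<in> span U"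
    using class_functional[OF UR ij(1) EiU] by metis
  have "v \<bullet> (z - p) = (\<Sum>k<n. (v \<bullet> E k) * (W k \<bullet> (z - p)))"
    by (rule functional_expand) (rule v(1))
  also have "\<dots> \<in> \<int>"
  proof (rule Ints_sum)
    fix k assume "k \<in> {..<n}"
    then have k: "k < n" by simp
    have "v \<bullet> E k \<in> \<int>" using v(4)[OF k] by auto
    moreover have "W k \<bullet> (z - p) \<in> \<int>" using intdiff[OF z(2)] k by (simp add: integral_coords_def)
    ultimately show "(v \<bullet> E k) * (W k \<bullet> (z - p)) \<in> \<int>" by (rule Ints_mult)
  qed
  finally obtain l :: int where l: "v \<bullet> (z - p) = of_int l" by (rule Ints_cases)
  have "v \<bullet> (z - r) = 0" using v(2) z(3) by blast
  \<comment> \<open>Twice an integer cannot be \<open>s\<close> alone, so \<open>j\<close> belongs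
    to the class of \<open>i\<close>.\<close>
  then have "2 * of_int l = s + t * (v \<bullet> E j)" using l v(3) w\<alpha>[of v] by (simp add: r_def inner_diff_right inner_add_right)
  then have vj: "v \<bullet> E j \<noteq> 0"
  proof -
    assume eq: "2 * of_int l = s + t * (v \<bullet> E j)"
    show ?thesis
    proof
      assume "v \<bullet> E j = 0"
      then have "of_int (2 * l) = s" using eq by simp
      moreover have "s = of_int (if s = 1 then 1 else -1)" using st by auto
      ultimately have "2 * l = (if s = 1 then 1 else -1)" by (metis of_int_eq_iff)
      then show False by (auto split: if_splits) presburger+
    qed
  qed
  define \<epsilon> where "\<epsilon> = v \<bullet> E j"
  have \<epsilon>: "E i - \<epsilon> *\<^sub>R E j \<in> span U" "\<epsilon> \<in> {1, -1}" using v(5)[OF ij(2) vj] v(4)[OF ij(2)] vj by (auto simp: \<epsilon>_def)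
  have "s * (w \<bullet> (E i - \<epsilon> *\<^sub>R E j)) = 0" using wU[OF \<epsilon>(1)] by simp
  \<comment> \<open>\<open>w\<close> vanishes on the span of the face and has
    \<open>s * (w \<bullet> E i) = t * (w \<bullet> E j)\<close>, which selects the sign.\<close>
  then have "\<epsilon> = s * t" using wi c(1) \<epsilon>(2) st by (auto simp: inner_diff_right)
  then have "s *\<^sub>R (E i - \<epsilon> *\<^sub>R E j) = s *\<^sub>R E i - t *\<^sub>R E j" using st by auto
  then have diffU: "s *\<^sub>R E i - t *\<^sub>R E j \<in> span U" using span_scale[OF \<epsilon>(1), of s] by simp
  obtain R' where R': "R' \<subseteq> R" "tcone P p = convex_cone hull R'" using P unfolding mpoly_def by blast
  obtain u where u: "special R u" "\<And>\<beta>. \<beta> \<in> R' \<Longrightarrow> u \<bullet> \<beta> \<le> 0" "u \<bullet> (s *\<^sub>R E i) > 0"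
    using special_separation[OF R'(1)] notin R'(2) by metis
  have u\<alpha>: "u \<bullet> \<alpha> \<le> 0" using inner_le_0_convex_cone_hull[OF u(2), of R' \<alpha>] \<alpha> R'(2) by (simp add: \<alpha>_def)
  have "u \<bullet> E i \<noteq> 0" using u(3) by auto
  from vals[OF u(1) ij(1) this]
  obtain d where "d > 0 \<and> (\<forall>k<n. u \<bullet> E k \<in> {0, d, -d}) \<and> (\<forall>x\<in>integral_coords. \<exists>m::int. u \<bullet> x = d * of_int m)"
    by (elim exE)
  then have d: "d > 0" "\<And>k. k < n \<Longrightarrow> u \<bullet> E k \<in> {0, d, -d}" by simp_all
  have ui: "s * (u \<bullet> E i) = d" using u(3) d(1) d(2)[OF ij(1)] st by auto
  \<comment> \<open>Tangency of \<alpha> allows at most 0 in total, and the second coordinate can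
    compensate at most \<open>d\<close>; so the compensation is exact.\<close>
  then have uj: "t * (u \<bullet> E j) = - d" using u\<alpha> d(1) d(2)[OF ij(2)] st w\<alpha>[of u] by auto
  then have ur: "u \<bullet> r = u \<bullet> p" using ui w\<alpha>[of u] by (simp add: r_def inner_add_right)
  have "u \<bullet> q \<le> u \<bullet> r" if "q \<in> P" for q
    unfolding ur
    using inner_le_0_convex_cone_hull[OF u(2), of R' "q - p"] tcone_mem[OF that, of p] R'(2) by (simp add: inner_diff_right)
  from span_lineality_inner_0[OF this diffU[unfolded U_def]]
  have "u \<bullet> (s *\<^sub>R E i - t *\<^sub>R E j) = 0" .
  then have "s * (u \<bullet> E i) - t * (u \<bullet> E j) = 0" unfolding inner_diff_right inner_scaleR_right .
  then show False using ui uj d(1) by linarith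
qed

text \<open>A legal root generates itself; a pair root that leaves \<open>P\<close> is replaced by
  its two unit steps, which are tangent and hence generated by legal steps.\<close>

lemma root_in_good_cone:
  assumes P: "mpoly R P" "p \<in> P" "p \<in> lat R" and \<alpha>: "\<alpha> \<in> \<Psi>" "\<alpha> \<in> tcone P p"
  shows "\<alpha> \<in> convex_cone hull {\<beta>\<in>R. p + \<beta> \<in> P}"
proof -
  have "\<alpha> \<in> R" using \<alpha>(1) sub by blast
  then show ?thesis
  proof (cases rule: root_cases)
    case out then show ?thesis using \<alpha> by blast
  next
    case (single s k i)
    have k: "k > 0" using single K_cases by auto
    have "(1/k) *\<^sub>R \<alpha> \<in> tcone P p" using tcone_scaleR[OF P(1,2) \<alpha>(2)] k by simp
    then have "s *\<^sub>R E i \<in> tcone P p" using single k by simp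
    then have "k *\<^sub>R (s *\<^sub>R E i) \<in> convex_cone hull {\<beta>\<in>R. p + \<beta> \<in> P}"
      using unit_step_in_good_cone[OF P single(4,2)] k by (simp only: convex_cone_hull_mul less_imp_le)
    then show ?thesis using single by (simp add: mult.commute)
  next
    case (pair s t i j)
    show ?thesis
    proof (cases "p + \<alpha> \<in> P")
      case True then show ?thesis using \<open>\<alpha> \<in> R\<close> by (intro hull_inc) simp
    next
      case False
      have "s *\<^sub>R E i \<in> tcone P p"
        by (rule bad_pair_splits[OF P pair(4,5,6,2,3)]) (use \<alpha> pair False in auto)
      moreover have "t *\<^sub>R E j \<in> tcone P p"
        by (rule bad_pair_splits[OF P pair(5,4) _ pair(3,2)]) (use \<alpha> pair False in \<open>auto simp: add.commute\<close>)
      ultimately show ?thesis unfolding pair(1)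
        using unit_step_in_good_cone[OF P pair(4,2)] unit_step_in_good_cone[OF P pair(5,3)]
        by (intro convex_cone_hull_add)
    qed
  qed
qed

end

section \<open>Type A, and generation of tangent cones at lattice points by legal steps\<close>

context root_vectors
begin

text \<open>Special functionals have only the values 0, c and -c on a type A component, so a root
  gains at most one quantum and the argument of \<open>unit_step_mem\<close> applies to the root
  itself.\<close>

lemma type_A_root_good:
  assumes P: "mpoly R P" "p \<in> P" "p \<in> lat R" and \<Psi>: "\<Psi> \<subseteq> R" "type_A R \<Psi> n E"
    and \<alpha>: "\<alpha> \<in> \<Psi>" "\<alpha> \<in> tcone P p"
  shows "p + \<alpha> \<in> P"
proof (rule ccontr)
  assume "p + \<alpha> \<notin> P"
  then obtain w z where w: "special R w" "z \<in> P" "z \<in> lat R" "\<And>q. q \<in> P \<Longrightarrow> w \<bullet> q \<le> w \<bullet> z"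
    "w \<bullet> z < w \<bullet> (p + \<alpha>)" using mpoly_separation[OF P(1)] by metis
  have lt: "w \<bullet> (z - p) < w \<bullet> \<alpha>" using w(5) by (simp add: inner_add_right inner_diff_right)
  have ge: "w \<bullet> (z - p) \<ge> 0" using w(4)[OF P(2)] by (simp add: inner_diff_right)
  have nz: "w \<bullet> \<alpha> \<noteq> 0" using lt ge by auto
  obtain c where c: "c > 0" "\<And>\<beta>. \<beta> \<in> \<Psi> \<Longrightarrow> w \<bullet> \<beta> \<in> {0, c, - c}" "\<And>\<delta>. \<delta> \<in> R - \<Psi> \<Longrightarrow> w \<bullet> \<delta> = 0"
    using special_type_A[OF w(1) \<Psi> \<alpha>(1) nz] by blast
  have "w \<bullet> x / c \<in> \<int>" if "x \<in> lat R" for x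
    using that
  proof (induction rule: lat_linear_induct)
    case (root \<beta> k)
    have "w \<bullet> \<beta> / c \<in> {0, 1, -1}" using c root by (cases "\<beta> \<in> \<Psi>") force+
    then have "w \<bullet> \<beta> / c \<in> \<int>" by auto
    then have "of_int k * (w \<bullet> \<beta> / c) \<in> \<int>" by (intro Ints_mult Ints_of_int)
    then show ?case by (simp only: inner_scaleR_right times_divide_eq_right)
  qed (auto simp: inner_add_right add_divide_distrib)
  from this[OF lat_diff[OF w(3) P(3)]] obtain m where "w \<bullet> (z - p) / c = of_int m" by (rule Ints_cases)
  then have m: "w \<bullet> (z - p) = c * of_int m" using c(1) by (simp add: field_simps)
  have "w \<bullet> \<alpha> \<le> c" using c(1) c(2)[OF \<alpha>(1)] by auto
  then have "c * of_int m < c * 1" "0 \<le> c * of_int m" using lt ge m by linarith+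
  then have "m = 0" using c(1) by (auto simp: zero_le_mult_iff)
  then have "w \<bullet> z = w \<bullet> p" using m by (simp add: inner_diff_right)
  then have "w \<bullet> \<alpha> \<le> 0" using tcone_inner_le_0[of P w p \<alpha>] w(4) \<alpha>(2) by simp
  then show False using lt ge by simp
qed

theorem tcone_lattice_point:
  assumes P: "mpoly R P" "p \<in> P" "p \<in> lat R" and x: "x \<in> tcone P p"
  shows "x \<in> convex_cone hull {\<beta>\<in>R. p + \<beta> \<in> P}"
proof -
  obtain R' where R': "R' \<subseteq> R" "tcone P p = convex_cone hull R'" using P unfolding mpoly_def by blast
  show ?thesis
  proof (rule convex_cone_hull_mono_mem)
    show "x \<in> convex_cone hull R'" using x R'(2) by simp
    fix \<alpha> assume \<alpha>: "\<alpha> \<in> R'"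
    then have \<alpha>R: "\<alpha> \<in> R" and \<alpha>t: "\<alpha> \<in> tcone P p" using R' by (auto intro: hull_inc)
    obtain \<Psi> where "\<Psi> \<subseteq> R \<and> \<alpha> \<in> \<Psi> \<and> ((\<exists>n E. type_A R \<Psi> n E) \<or> (\<exists>n E K. type_BCD R \<Psi> n E K))"
      using compR[OF \<alpha>R] by (elim exE)
    then have \<Psi>: "\<Psi> \<subseteq> R" "\<alpha> \<in> \<Psi>" "(\<exists>n E. type_A R \<Psi> n E) \<or> (\<exists>n E K. type_BCD R \<Psi> n E K)"
      by simp_all
    from \<Psi>(3) show "\<alpha> \<in> convex_cone hull {\<beta>\<in>R. p + \<beta> \<in> P}"
    proof (elim disjE exE)
      fix n E assume "type_A R \<Psi> n E"
      from type_A_root_good[OF P \<Psi>(1) this \<Psi>(2) \<alpha>t] show ?thesis using \<alpha>R by (intro hull_inc) simp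
    next
      fix n E K assume "type_BCD R \<Psi> n E K"
      then interpret BCD_component R \<Psi> n E K using \<Psi>(1) by unfold_locales
      show ?thesis using root_in_good_cone[OF P \<Psi>(2) \<alpha>t] .
    qed
  qed
qed

end

section \<open>From the local conditions to the convex extension\<close>

definition steps :: "'a::euclidean_space set \<Rightarrow> 'a set \<Rightarrow> 'a \<Rightarrow> 'a set" where
  "steps R B p = {\<alpha>\<in>R. p + \<alpha> \<in> B}"

text \<open>The part of M-convexity that \<open>dom g\<close> and all sets of minimisers inherit
  directly from the growth condition; \<open>mpoly_convex_hull\<close> recovers the polyhedron from
  it.\<close>

definition step_connected :: "'a::euclidean_space set \<Rightarrow> 'a set \<Rightarrow> bool" where
  "step_connected R B \<longleftrightarrow> B \<noteq> {} \<and> B \<subseteq> lat R \<and>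
     (\<forall>p\<in>B. \<forall>q\<in>B. q - p \<in> convex_cone hull (steps R B p))"

definition argmin_on :: "'a::euclidean_space set \<Rightarrow> ('a \<Rightarrow> real) \<Rightarrow> 'a \<Rightarrow> 'a set" where
  "argmin_on P H x = {p\<in>P. \<forall>q\<in>P. H p - x \<bullet> p \<le> H q - x \<bullet> q}"

text \<open>Here \<open>(P, H)\<close> stands for the function that is \<open>H\<close> on \<open>P\<close> and \<open>+\<infinity>\<close> elsewhere.\<close>

definition mfun :: "'a::euclidean_space set \<Rightarrow> 'a set \<Rightarrow> ('a \<Rightarrow> real) \<Rightarrow> bool" where
  "mfun R P H \<longleftrightarrow> P \<noteq> {} \<and> locally_polyhedral {(y, t). y \<in> P \<and> H y \<le> t} \<and>
     (\<forall>x. argmin_on P H x \<noteq> {} \<longrightarrow> mpoly R (argmin_on P H x))"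

lemma convex_cone_hull_face:
  fixes w :: "'a::real_inner"
  assumes "finite S" "\<And>\<alpha>. \<alpha> \<in> S \<Longrightarrow> w \<bullet> \<alpha> \<le> 0" "x \<in> convex_cone hull S" "w \<bullet> x = 0"
  shows "x \<in> convex_cone hull {\<alpha>\<in>S. w \<bullet> \<alpha> = 0}"
proof -
  obtain \<mu> where \<mu>: "x = (\<Sum>\<alpha>\<in>S. \<mu> \<alpha> *\<^sub>R \<alpha>)" "\<forall>\<alpha>\<in>S. \<mu> \<alpha> \<ge> 0"
    using assms(3) unfolding convex_cone_hull_finite[OF assms(1)] by blast
  have "(\<Sum>\<alpha>\<in>S. - (\<mu> \<alpha> * (w \<bullet> \<alpha>))) = 0"
    using assms(4) by (simp add: \<mu>(1) inner_sum_right sum_negf)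
  then have zero: "\<forall>\<alpha>\<in>S. - (\<mu> \<alpha> * (w \<bullet> \<alpha>)) = 0"
    using sum_nonneg_eq_0_iff[OF assms(1), of "\<lambda>\<alpha>. - (\<mu> \<alpha> * (w \<bullet> \<alpha>))"] \<mu>(2) assms(2)
    by (simp add: mult_nonneg_nonpos)
  show ?thesis
    unfolding \<mu>(1)
  proof (rule convex_cone_hull_sum)
    fix \<alpha> assume \<alpha>: "\<alpha> \<in> S"
    show "\<mu> \<alpha> *\<^sub>R \<alpha> \<in> convex_cone hull {\<alpha>\<in>S. w \<bullet> \<alpha> = 0}"
    proof (cases "\<mu> \<alpha> = 0")
      case False
      then have "w \<bullet> \<alpha> = 0" using zero \<alpha> by auto
      then show ?thesis using \<alpha> \<mu>(2) by (intro convex_cone_hull_mul hull_inc) auto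
    qed (simp add: convex_cone_hull_contains_0)
  qed
qed

lemma convex_hull_positive:
  assumes "x \<in> convex hull B"
  obtains S u where "finite S" "S \<subseteq> B" "S \<noteq> {}" "\<And>v. v \<in> S \<Longrightarrow> u v > (0::real)" "sum u S = 1" "(\<Sum>v\<in>S. u v *\<^sub>R v) = x"
proof -
  obtain S u where S: "finite S" "S \<subseteq> B" "\<forall>v\<in>S. 0 \<le> u v" "sum u S = (1::real)" "(\<Sum>v\<in>S. u v *\<^sub>R v) = x"
    using assms unfolding convex_hull_explicit by auto
  define S' where "S' = {v\<in>S. u v > 0}"
  have "sum u S' = sum u S" "(\<Sum>v\<in>S'. u v *\<^sub>R v) = (\<Sum>v\<in>S. u v *\<^sub>R v)"
    unfolding S'_def using S(1,3) by (intro sum.mono_neutral_left; force)+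
  then have sums: "sum u S' = 1" "(\<Sum>v\<in>S'. u v *\<^sub>R v) = x" using S(4,5) by simp_all
  show ?thesis
  proof (rule that[of S' u])
    show "S' \<noteq> {}" using sums(1) by auto
  qed (use S(1,2) sums in \<open>auto simp: S'_def\<close>)
qed

text \<open>Several steps from \<open>v\<close> are taken simultaneously, and the weight left over
  rests at \<open>v\<close>. Steps of weight 0 may lead outside \<open>C\<close>, which is why
  \<open>g\<close> in the proof sends them back to \<open>v\<close>.\<close>

lemma convex_steps:
  assumes "convex C" "v \<in> C" "finite A" "\<And>a. a \<in> A \<Longrightarrow> t a \<ge> 0" "\<And>a. a \<in> A \<Longrightarrow> t a > 0 \<Longrightarrow> v + f a \<in> C" "sum t A \<le> (1::real)"
  shows "v + (\<Sum>a\<in>A. t a *\<^sub>R f a) \<in> C"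
proof (cases "sum t A = 0")
  case True
  then have "\<forall>a\<in>A. t a = 0" using sum_nonneg_eq_0_iff[OF assms(3)] assms(4) by blast
  then show ?thesis using assms(2) by simp
next
  case False
  define T where "T = sum t A"
  have T: "T > 0" using False assms(4) by (simp add: T_def sum_nonneg order_less_le)
  define g where "g a = (if t a > 0 then v + f a else v)" for a
  have "(\<Sum>a\<in>A. (t a / T) *\<^sub>R g a) \<in> C"
  proof (rule convex_sum[OF assms(3,1)])
    show "(\<Sum>a\<in>A. t a / T) = 1" using T by (simp add: T_def flip: sum_divide_distrib)
  qed (use assms T in \<open>auto simp: g_def\<close>)
  then have "(1 - T) *\<^sub>R v + T *\<^sub>R (\<Sum>a\<in>A. (t a / T) *\<^sub>R g a) \<in> C"
    using assms(1,2,6) T by (intro convexD) (auto simp: T_def)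
  also have "T *\<^sub>R (\<Sum>a\<in>A. (t a / T) *\<^sub>R g a) = (\<Sum>a\<in>A. t a *\<^sub>R g a)"
    using T by (simp add: scaleR_sum_right)
  also have "(\<Sum>a\<in>A. t a *\<^sub>R g a) = (\<Sum>a\<in>A. t a *\<^sub>R v + t a *\<^sub>R f a)"
  proof (rule sum.cong)
    fix a assume "a \<in> A"
    then have "t a = 0 \<or> t a > 0" using assms(4) by force
    then show "t a *\<^sub>R g a = t a *\<^sub>R v + t a *\<^sub>R f a" by (auto simp: g_def scaleR_right_distrib)
  qed simp
  also have "\<dots> = T *\<^sub>R v + (\<Sum>a\<in>A. t a *\<^sub>R f a)"
    by (simp add: sum.distrib T_def scaleR_sum_left)
  finally show ?thesis by (simp add: algebra_simps)
qed

section \<open>Convex hulls of step-connected sets\<close>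

context root_vectors
begin

lemma finite_steps: "finite (steps R B p)" using finR by (simp add: steps_def)

lemma steps_subset: "steps R B p \<subseteq> R" by (auto simp: steps_def)

lemma small_functionals_separate:
  assumes "\<And>w. w \<in> small_functionals R \<Longrightarrow> w \<bullet> x = 0"
  shows "x = 0"
proof (rule ccontr)
  assume "x \<noteq> 0"
  then have "x \<notin> convex_cone hull {}" by simp
  then obtain w where w: "special R w" "w \<bullet> x > 0" using special_separation[of "{}" x] by blast
  obtain c where "c > 0" "c *\<^sub>R w \<in> small_functionals R" using special_rescale[OF w(1)] by blast
  then show False using assms[of "c *\<^sub>R w"] w(2) by simp
qed

text \<open>Lattice points are separated by the finitely many small functionals, whose values on
  them are integers and stay bounded on the ball.\<close>

lemma finite_lat_ball: "finite {p \<in> lat R. dist p c \<le> \<rho>}" (is "finite ?B")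
proof (rule finite_imageD)
  let ?f = "\<lambda>p. \<lambda>w\<in>small_functionals R. \<lfloor>w \<bullet> p\<rfloor>"
  define M where "M w = norm w * \<rho>" for w :: 'a
  have "?f ` ?B \<subseteq> (\<Pi>\<^sub>E w\<in>small_functionals R. {\<lfloor>w \<bullet> c - M w\<rfloor>..\<lfloor>w \<bullet> c + M w\<rfloor>})"
  proof (clarsimp simp del: mem_simps(1) simp: PiE_iff)
    fix p w assume "dist p c \<le> \<rho>"
    have "\<bar>w \<bullet> (p - c)\<bar> \<le> norm w * norm (p - c)" by (rule Cauchy_Schwarz_ineq2)
    also have "\<dots> \<le> M w" unfolding M_def using \<open>dist p c \<le> \<rho>\<close> by (intro mult_left_mono) (auto simp: dist_norm)
    finally have "w \<bullet> c - M w \<le> w \<bullet> p" "w \<bullet> p \<le> w \<bullet> c + M w" by (auto simp: inner_diff_right)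
    then show "\<lfloor>w \<bullet> c - M w\<rfloor> \<le> \<lfloor>w \<bullet> p\<rfloor> \<and> \<lfloor>w \<bullet> p\<rfloor> \<le> \<lfloor>w \<bullet> c + M w\<rfloor>" by (auto intro: floor_mono)
  qed
  then show "finite (?f ` ?B)"
    by (rule finite_subset) (intro finite_PiE finite_small_functionals, auto)
  show "inj_on ?f ?B"
  proof (rule inj_onI)
    fix p q assume pq: "p \<in> ?B" "q \<in> ?B" "?f p = ?f q"
    have "w \<bullet> (p - q) = 0" if "w \<in> small_functionals R" for w
    proof -
      have "\<lfloor>w \<bullet> p\<rfloor> = \<lfloor>w \<bullet> q\<rfloor>" using pq(3) that by (metis restrict_apply')
      moreover have "w \<bullet> p \<in> \<int>" "w \<bullet> q \<in> \<int>" using pq that small_functional_lat_Ints by auto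
      ultimately have "w \<bullet> p = w \<bullet> q" by (metis floor_of_int Ints_cases)
      then show ?thesis by (simp add: inner_diff_right)
    qed
    then have "p - q = 0" by (rule small_functionals_separate)
    then show "p = q" by simp
  qed
qed

lemma nearest_lattice_point:
  assumes "B \<noteq> {}" "B \<subseteq> lat R"
  obtains p where "p \<in> B" "\<And>q. q \<in> B \<Longrightarrow> dist p c \<le> dist q c"
proof -
  obtain p0 where p0: "p0 \<in> B" using assms by blast
  define F where "F = {p\<in>B. dist p c \<le> dist p0 c}"
  have F: "finite F" "F \<noteq> {}"
    using finite_subset[OF _ finite_lat_ball[of c "dist p0 c"], of F] assms(2) p0 by (auto simp: F_def)
  obtain p where p: "p \<in> F" "\<And>q. q \<in> F \<Longrightarrow> dist p c \<le> dist q c"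
    using arg_min_if_finite(1)[OF F, of "\<lambda>p. dist p c"] arg_min_least[OF F, of _ "\<lambda>p. dist p c"] by blast
  show ?thesis
  proof (rule that[of p])
    show "dist p c \<le> dist q c" if "q \<in> B" for q
      using p(2)[of q] p(1) that by (cases "q \<in> F") (auto simp: F_def)
  qed (use p in \<open>auto simp: F_def\<close>)
qed

text \<open>The outer description of the hull, an intersection of translated finitely generated
  cones: closed and convex by construction. That it adds nothing to \<open>convex hull B\<close> is
  the hard inclusion.\<close>

definition step_hull :: "'a set \<Rightarrow> 'a set" where
  "step_hull B = {y. \<forall>p\<in>B. y - p \<in> convex_cone hull (steps R B p)}"

text \<open>Otherwise let \<open>q\<close> be the point of the closure nearest to \<open>y\<close> and \<open>\<theta> = y - q\<close>.
  A point \<open>p\<close> of \<open>B\<close> nearest to \<open>y + T \<theta>\<close> has no improving step; summing these inequalities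
  along \<open>y - p\<close> bounds \<open>T\<close>.\<close>

lemma step_hull_subset_closure:
  assumes B: "step_connected R B"
  shows "step_hull B \<subseteq> closure (convex hull B)"
proof (rule ccontr)
  assume "\<not> ?thesis"
  then obtain y where y: "y \<in> step_hull B" "y \<notin> closure (convex hull B)" by blast
  define Q where "Q = closure (convex hull B)"
  have Q: "closed Q" "convex Q" "Q \<noteq> {}" "B \<subseteq> Q"
    using B closure_subset[of "convex hull B"] hull_subset[of B convex]
    by (auto simp: Q_def step_connected_def)
  define q where "q = closest_point Q y"
  define \<theta> where "\<theta> = y - q"
  have q: "q \<in> Q" unfolding q_def using Q by (simp add: closest_point_in_set)
  then have \<theta>0: "\<theta> \<noteq> 0" using y(2) by (auto simp: \<theta>_def Q_def)
  have sep: "\<theta> \<bullet> (y - p) \<ge> \<theta> \<bullet> \<theta>" if "p \<in> B" for p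
  proof -
    have "(y - q) \<bullet> (p - q) \<le> 0"
      using closest_point_dot[OF Q(2,1), of p y] that Q(4) by (auto simp: q_def)
    then show ?thesis by (simp add: \<theta>_def algebra_simps)
  qed
  \<comment> \<open>Bounds the total weight of the steps from \<open>p\<close> to \<open>y\<close>
    by a multiple of their distance. The constant must not depend on \<open>p\<close>, which moves
    with \<open>T\<close>.\<close>
  obtain C where C: "C \<ge> 0" "\<forall>T\<subseteq>R. \<forall>e\<in>convex_cone hull T. \<exists>\<mu>. (\<forall>\<alpha>\<in>T. \<mu> \<alpha> \<ge> 0) \<and>
           e = (\<Sum>\<alpha>\<in>T. \<mu> \<alpha> *\<^sub>R \<alpha>) \<and> (\<Sum>\<alpha>\<in>T. \<mu> \<alpha>) \<le> C * norm e"
    using cone_coefficients_bounded[OF finR] by blast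
  define M where "M = (\<Sum>\<alpha>\<in>R. \<alpha> \<bullet> \<alpha>)"
  have M: "\<alpha> \<bullet> \<alpha> \<le> M" if "\<alpha> \<in> R" for \<alpha>
    unfolding M_def by (rule member_le_sum) (use that finR in auto)
  have M0: "M \<ge> 0" by (simp add: M_def sum_nonneg)
  \<comment> \<open>The maximum of \<open>M * C * r - 2 * r^2\<close> over real \<open>r\<close>,
    attained at \<open>r = M * C / 4\<close>.\<close>
  define Z where "Z = (M * C)^2 / 8"
  have Z0: "Z \<ge> 0" by (simp add: Z_def)
  have bound: "2 * T * (\<theta> \<bullet> \<theta>) \<le> Z" if T: "T \<ge> 0" for T
  proof -
    define c where "c = y + T *\<^sub>R \<theta>"
    obtain p where p: "p \<in> B" "\<And>q. q \<in> B \<Longrightarrow> dist p c \<le> dist q c"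
      using nearest_lattice_point[of B c] B unfolding step_connected_def by blast
    define e where "e = y - p"
    have e: "e \<in> convex_cone hull (steps R B p)" using y(1) p(1) by (auto simp: step_hull_def e_def)
    obtain \<mu> where \<mu>: "\<forall>\<alpha>\<in>steps R B p. \<mu> \<alpha> \<ge> 0" "e = (\<Sum>\<alpha>\<in>steps R B p. \<mu> \<alpha> *\<^sub>R \<alpha>)"
      "(\<Sum>\<alpha>\<in>steps R B p. \<mu> \<alpha>) \<le> C * norm e" using C(2)[rule_format, OF steps_subset e] by blast
    \<comment> \<open>Since \<open>p\<close> is nearest to \<open>c\<close>, the step \<alpha> does
      not shorten \<open>e + T *\<^sub>R \<theta>\<close>; expanding the squares leaves this
      inequality.\<close>
    have step: "2 * (\<alpha> \<bullet> (e + T *\<^sub>R \<theta>)) \<le> M" if "\<alpha> \<in> steps R B p" for \<alpha>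
    proof -
      have "dist p c \<le> dist (p + \<alpha>) c" using p(2) that by (auto simp: steps_def)
      then have "norm (e + T *\<^sub>R \<theta>) \<le> norm (e + T *\<^sub>R \<theta> - \<alpha>)"
        by (simp add: dist_norm e_def c_def norm_minus_commute algebra_simps)
      then have "(e + T *\<^sub>R \<theta>) \<bullet> (e + T *\<^sub>R \<theta>) \<le> (e + T *\<^sub>R \<theta> - \<alpha>) \<bullet> (e + T *\<^sub>R \<theta> - \<alpha>)"
        by (simp only: norm_le)
      then have "2 * (\<alpha> \<bullet> (e + T *\<^sub>R \<theta>)) \<le> \<alpha> \<bullet> \<alpha>"
        by (simp add: inner_diff_left inner_diff_right inner_commute)
      then show ?thesis using M[of \<alpha>] that steps_subset by force
    qed
    have "2 * (e \<bullet> (e + T *\<^sub>R \<theta>)) = (\<Sum>\<alpha>\<in>steps R B p. \<mu> \<alpha> * (2 * (\<alpha> \<bullet> (e + T *\<^sub>R \<theta>))))"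
      by (subst (1) \<mu>(2)) (simp add: inner_sum_left sum_distrib_left mult.left_commute)
    also have "\<dots> \<le> (\<Sum>\<alpha>\<in>steps R B p. \<mu> \<alpha> * M)"
      using \<mu>(1) step by (intro sum_mono mult_left_mono) auto
    also have "\<dots> = M * (\<Sum>\<alpha>\<in>steps R B p. \<mu> \<alpha>)" by (simp add: sum_distrib_left mult.commute)
    also have "\<dots> \<le> M * (C * norm e)" using \<mu>(3) M0 by (rule mult_left_mono)
    finally have "2 * (e \<bullet> e) + 2 * T * (\<theta> \<bullet> e) \<le> M * C * norm e"
      by (simp add: inner_add_right inner_commute algebra_simps)
    moreover have "e \<bullet> e = (norm e)^2" by (simp add: power2_norm_eq_inner)
    moreover have "T * (\<theta> \<bullet> \<theta>) \<le> T * (\<theta> \<bullet> e)" using sep[OF p(1)] T by (intro mult_left_mono) (auto simp: e_def)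
    moreover have "M * C * norm e - 2 * (norm e)^2 \<le> Z"
    proof -
      have "0 \<le> 2 * (norm e - M * C / 4)^2" by simp
      then show ?thesis by (simp add: Z_def power2_eq_square field_simps)
    qed
    ultimately show ?thesis by linarith
  qed
  have pos: "\<theta> \<bullet> \<theta> > 0" using \<theta>0 by simp
  \<comment> \<open>Makes the left side of \<open>bound\<close> equal to \<open>2 * (Z + 1)\<close>,
    which exceeds \<open>Z\<close>.\<close>
  define T where "T = (Z + 1) / (\<theta> \<bullet> \<theta>)"
  have "T \<ge> 0" using pos Z0 by (simp add: T_def)
  moreover have "T * (\<theta> \<bullet> \<theta>) = Z + 1" using pos by (simp add: T_def)
  ultimately have "2 * (Z + 1) \<le> Z" using bound[of T] by (simp add: mult.assoc)
  then show False using Z0 by simp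
qed

lemma step_connected_max:
  assumes "step_connected R B" "p \<in> B" "\<And>\<alpha>. \<alpha> \<in> steps R B p \<Longrightarrow> w \<bullet> \<alpha> \<le> 0" "q \<in> B"
  shows "w \<bullet> q \<le> w \<bullet> p"
proof -
  have "q - p \<in> convex_cone hull (steps R B p)" using assms unfolding step_connected_def by blast
  from inner_le_0_convex_cone_hull[OF assms(3) this] show ?thesis by (simp add: inner_diff_right)
qed

lemma step_hull_le:
  assumes "y \<in> step_hull B" "p \<in> B" "\<And>q. q \<in> B \<Longrightarrow> w \<bullet> q \<le> w \<bullet> p"
  shows "w \<bullet> y \<le> w \<bullet> p"
proof -
  have le: "w \<bullet> \<alpha> \<le> 0" if "\<alpha> \<in> steps R B p" for \<alpha>
    using assms(3)[of "p + \<alpha>"] that by (simp add: steps_def inner_add_right)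
  have "y - p \<in> convex_cone hull (steps R B p)" using assms by (auto simp: step_hull_def)
  from inner_le_0_convex_cone_hull[OF le this] show ?thesis by (simp add: inner_diff_right)
qed

lemma step_hull_separation:
  assumes "step_connected R B" "x \<notin> step_hull B"
  obtains w p where "w \<in> small_functionals R" "p \<in> B" "\<And>q. q \<in> B \<Longrightarrow> w \<bullet> q \<le> w \<bullet> p" "w \<bullet> p < w \<bullet> x"
proof -
  obtain p where p: "p \<in> B" "x - p \<notin> convex_cone hull (steps R B p)" using assms(2) by (auto simp: step_hull_def)
  obtain w where w: "special R w" "\<And>\<alpha>. \<alpha> \<in> steps R B p \<Longrightarrow> w \<bullet> \<alpha> \<le> 0" "w \<bullet> (x - p) > 0"
    using special_separation[OF steps_subset p(2)] by blast
  obtain c where c: "c > 0" "c *\<^sub>R w \<in> small_functionals R" using special_rescale[OF w(1)] by blast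
  show ?thesis
  proof (rule that[OF c(2) p(1)])
    show "(c *\<^sub>R w) \<bullet> q \<le> (c *\<^sub>R w) \<bullet> p" if "q \<in> B" for q
      using step_connected_max[OF assms(1) p(1) w(2) that] c(1) by simp
    show "(c *\<^sub>R w) \<bullet> p < (c *\<^sub>R w) \<bullet> x" using w(3) c(1) by (simp add: inner_diff_right)
  qed
qed

text \<open>Differences within the maximal face have \<open>w\<close>-value 0, so a conical
  combination of steps, all of nonpositive value, can only use steps staying in the face.\<close>

lemma step_connected_face:
  assumes B: "step_connected R B" and p: "p \<in> B" "\<And>q. q \<in> B \<Longrightarrow> w \<bullet> q \<le> w \<bullet> p"
  shows "step_connected R {q\<in>B. w \<bullet> q = w \<bullet> p}"
    and "y \<in> step_hull B \<Longrightarrow> w \<bullet> y = w \<bullet> p \<Longrightarrow> y \<in> step_hull {q\<in>B. w \<bullet> q = w \<bullet> p}"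
proof -
  let ?B = "{q\<in>B. w \<bullet> q = w \<bullet> p}"
  have face: "x - r \<in> convex_cone hull (steps R ?B r)"
    if "r \<in> ?B" "x - r \<in> convex_cone hull (steps R B r)" "w \<bullet> x = w \<bullet> p" for x r
  proof -
    have "x - r \<in> convex_cone hull {\<alpha>\<in>steps R B r. w \<bullet> \<alpha> = 0}"
    proof (rule convex_cone_hull_face[OF finite_steps _ that(2)])
      show "w \<bullet> \<alpha> \<le> 0" if "\<alpha> \<in> steps R B r" for \<alpha>
        using p(2)[of "r + \<alpha>"] that \<open>r \<in> ?B\<close> by (simp add: steps_def inner_add_right)
    qed (use that in \<open>simp add: inner_diff_right\<close>)
    moreover have "{\<alpha>\<in>steps R B r. w \<bullet> \<alpha> = 0} \<subseteq> steps R ?B r"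
      using that(1) by (auto simp: steps_def inner_add_right)
    ultimately show ?thesis using hull_mono[of _ "steps R ?B r"] by blast
  qed
  show "step_connected R ?B"
    using B p face unfolding step_connected_def by auto
  show "y \<in> step_hull ?B" if "y \<in> step_hull B" "w \<bullet> y = w \<bullet> p"
    using that face unfolding step_hull_def by auto
qed

text \<open>Closedness of the hull is not yet known, so only relatively interior points are safe:
  these agree for a convex set and its closure. A point on a proper face is handled by induction on
  the dimension. Otherwise every small functional with a maximum on \<open>B\<close> is constant on
  \<open>B\<close> or has slack at \<open>y\<close>, so a relative neighbourhood of \<open>y\<close>
  lies in \<open>step_hull B\<close>.\<close>

lemma step_hull_subset_convex_hull:
  assumes "step_connected R B"
  shows "step_hull B \<subseteq> convex hull B"
  using assms
\<comment> \<open>Affine dimension starts at -1, hence the shift.\<close>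
proof (induction "nat (aff_dim B + 1)" arbitrary: B rule: less_induct)
  case less
  note B = less.prems
  show ?case
  proof
    fix y assume y: "y \<in> step_hull B"
    show "y \<in> convex hull B"
    proof (cases "\<exists>w p. p \<in> B \<and> (\<forall>q\<in>B. w \<bullet> q \<le> w \<bullet> p) \<and> w \<bullet> y = w \<bullet> p \<and> (\<exists>q\<in>B. w \<bullet> q \<noteq> w \<bullet> p)")
      case True
      then obtain w p q0 where w: "p \<in> B" "\<And>q. q \<in> B \<Longrightarrow> w \<bullet> q \<le> w \<bullet> p" "w \<bullet> y = w \<bullet> p" "q0 \<in> B" "w \<bullet> q0 \<noteq> w \<bullet> p"
        by blast
      define B' where "B' = {q\<in>B. w \<bullet> q = w \<bullet> p}"
      have face1: "step_connected R B'"
        unfolding B'_def by (rule step_connected_face(1)[OF B w(1)]) (rule w(2))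
      have face2: "y \<in> step_hull B'"
        unfolding B'_def by (rule step_connected_face(2)[OF B w(1) _ y w(3)]) (rule w(2))
      have "affine hull B' \<subseteq> {x. w \<bullet> x = w \<bullet> p}"
        by (intro hull_minimal) (auto simp: B'_def affine_hyperplane)
      then have "q0 \<notin> affine hull B'" using w(5) by auto
      moreover have "q0 \<in> affine hull B" using w(4) by (simp add: hull_inc)
      moreover have "affine hull B' \<subseteq> affine hull B" by (intro hull_mono) (auto simp: B'_def)
      ultimately have "aff_dim B' < aff_dim B" by (intro aff_dim_psubset) auto
      moreover have "aff_dim B' \<ge> -1" by (rule aff_dim_geq)
      ultimately have "step_hull B' \<subseteq> convex hull B'"
        using less.hyps[OF _ face1] by simp
      moreover have "convex hull B' \<subseteq> convex hull B" by (intro hull_mono) (auto simp: B'_def)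
      ultimately show ?thesis using face2 by blast
    next
      case False
      define Q where "Q = closure (convex hull B)"
      have ev: "\<forall>w\<in>small_functionals R. eventually (\<lambda>x. x \<in> affine hull B \<longrightarrow>
          (\<forall>p\<in>B. (\<forall>q\<in>B. w \<bullet> q \<le> w \<bullet> p) \<longrightarrow> w \<bullet> x \<le> w \<bullet> p)) (nhds y)"
      proof
        fix w
        show "eventually (\<lambda>x. x \<in> affine hull B \<longrightarrow>
          (\<forall>p\<in>B. (\<forall>q\<in>B. w \<bullet> q \<le> w \<bullet> p) \<longrightarrow> w \<bullet> x \<le> w \<bullet> p)) (nhds y)"
        proof (cases "\<exists>p\<in>B. \<forall>q\<in>B. w \<bullet> q \<le> w \<bullet> p")
          case True
          then obtain p where p: "p \<in> B" "\<And>q. q \<in> B \<Longrightarrow> w \<bullet> q \<le> w \<bullet> p" by blast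
          have eq: "w \<bullet> p' = w \<bullet> p" if "p' \<in> B" "\<forall>q\<in>B. w \<bullet> q \<le> w \<bullet> p'" for p'
            using that p by (meson order_antisym)
          show ?thesis
          proof (cases "w \<bullet> y = w \<bullet> p")
            case True
            then have "\<forall>q\<in>B. w \<bullet> q = w \<bullet> p" using False p by blast
            then have "affine hull B \<subseteq> {x. w \<bullet> x = w \<bullet> p}" by (intro hull_minimal) (auto simp: affine_hyperplane)
            then have "x \<in> affine hull B \<longrightarrow> (\<forall>p\<in>B. (\<forall>q\<in>B. w \<bullet> q \<le> w \<bullet> p) \<longrightarrow> w \<bullet> x \<le> w \<bullet> p)" for x
              using eq by auto
            then show ?thesis by simp
          next
            case ne: False
            have "w \<bullet> y < w \<bullet> p" using step_hull_le[OF y p] ne by simp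
            moreover have "((\<lambda>x. w \<bullet> x) \<longlongrightarrow> w \<bullet> y) (nhds y)" by (intro tendsto_intros) (simp add: filterlim_ident)
            ultimately have "eventually (\<lambda>x. w \<bullet> x < w \<bullet> p) (nhds y)" using order_tendstoD(2) by blast
            then show ?thesis
            proof eventually_elim
              case (elim x)
              then show ?case using eq by fastforce
            qed
          qed
        next
          case nomax: False
          then show ?thesis by (intro always_eventually) blast
        qed
      qed
      have "eventually (\<lambda>x. \<forall>w\<in>small_functionals R. x \<in> affine hull B \<longrightarrow>
          (\<forall>p\<in>B. (\<forall>q\<in>B. w \<bullet> q \<le> w \<bullet> p) \<longrightarrow> w \<bullet> x \<le> w \<bullet> p)) (nhds y)"
        using eventually_ball_finite[OF finite_small_functionals ev] .
      then obtain e where e: "e > 0" "\<And>x. dist x y < e \<Longrightarrow> \<forall>w\<in>small_functionals R. x \<in> affine hull B \<longrightarrow>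
          (\<forall>p\<in>B. (\<forall>q\<in>B. w \<bullet> q \<le> w \<bullet> p) \<longrightarrow> w \<bullet> x \<le> w \<bullet> p)"
        unfolding eventually_nhds_metric by blast
      have aff: "affine hull Q = affine hull B" by (simp add: Q_def)
      have "ball y e \<inter> affine hull Q \<subseteq> Q"
      proof
        fix x assume "x \<in> ball y e \<inter> affine hull Q"
        then have x: "dist x y < e" "x \<in> affine hull B" by (auto simp: aff dist_commute)
        have "x \<in> step_hull B"
        proof (rule ccontr)
          assume "x \<notin> step_hull B"
          then obtain w p where "w \<in> small_functionals R" "p \<in> B" "\<And>q. q \<in> B \<Longrightarrow> w \<bullet> q \<le> w \<bullet> p" "w \<bullet> p < w \<bullet> x"
            using step_hull_separation[OF B] by metis
          then show False using e(2)[OF x(1)] x(2) by fastforce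
        qed
        then show "x \<in> Q" using step_hull_subset_closure[OF B] by (auto simp: Q_def)
      qed
      moreover have "y \<in> Q" using step_hull_subset_closure[OF B] y by (auto simp: Q_def)
      ultimately have "y \<in> rel_interior Q" using e(1) by (auto simp: mem_rel_interior_ball)
      also have "rel_interior Q = rel_interior (convex hull B)"
        unfolding Q_def by (rule convex_rel_interior_closure) simp
      finally show ?thesis using rel_interior_subset by blast
    qed
  qed
qed

lemma step_hull_eq_convex_hull:
  assumes "step_connected R B"
  shows "step_hull B = convex hull B"
proof
  have eq: "step_hull B = (\<Inter>p\<in>B. (\<lambda>y. y - p) -` (convex_cone hull (steps R B p)))"
    by (auto simp: step_hull_def)
  have "convex ((\<lambda>y. y - p) -` (convex_cone hull (steps R B p)))" for p
  proof -
    have "(\<lambda>y. y - p) -` (convex_cone hull (steps R B p)) = (\<lambda>y. p + y) ` (convex_cone hull (steps R B p))"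
      by (force simp: image_iff)
    then show ?thesis by (simp add: convex_translation convex_convex_cone_hull)
  qed
  then have "convex (step_hull B)" unfolding eq by (intro convex_INT) auto
  moreover have "B \<subseteq> step_hull B" using assms by (auto simp: step_hull_def step_connected_def)
  ultimately show "convex hull B \<subseteq> step_hull B" by (simp add: hull_minimal)
qed (rule step_hull_subset_convex_hull[OF assms])

text \<open>For \<open>q\<close> in \<open>B\<close> the difference is the weighted sum of the
  vectors \<open>q - v\<close>, each in the cone at \<open>v\<close>; convexity extends this to the
  hull.\<close>

lemma hull_diff_in_cone:
  assumes B: "step_connected R B" and S: "finite S" "S \<subseteq> B" "\<And>v. v \<in> S \<Longrightarrow> u v > 0" "sum u S = 1"
    and q: "q \<in> convex hull B"
  shows "q - (\<Sum>v\<in>S. u v *\<^sub>R v) \<in> convex_cone hull (\<Union>v\<in>S. steps R B v)"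
proof -
  let ?p = "\<Sum>v\<in>S. u v *\<^sub>R v" and ?K = "convex_cone hull (\<Union>v\<in>S. steps R B v)"
  have "x - ?p \<in> ?K" if "x \<in> B" for x
  proof -
    have "x - ?p = sum u S *\<^sub>R x - ?p" using S(4) by simp
    also have "\<dots> = (\<Sum>v\<in>S. u v *\<^sub>R (x - v))"
      by (simp add: scaleR_diff_right sum_subtractf scaleR_sum_left)
    also have "\<dots> \<in> ?K"
    proof (rule convex_cone_hull_sum)
      fix v assume v: "v \<in> S"
      have "x - v \<in> convex_cone hull (steps R B v)" using B S v that unfolding step_connected_def by blast
      moreover have "steps R B v \<subseteq> (\<Union>v\<in>S. steps R B v)" using v by blast
      ultimately have "x - v \<in> ?K" using hull_mono[of "steps R B v"] by blast
      then show "u v *\<^sub>R (x - v) \<in> ?K" using S(3)[OF v] by (intro convex_cone_hull_mul) auto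
    qed
    finally show ?thesis .
  qed
  then have "B \<subseteq> (\<lambda>y. ?p + y) ` ?K" by (force simp: image_iff)
  then have "convex hull B \<subseteq> (\<lambda>y. ?p + y) ` ?K"
    by (intro hull_minimal) (simp_all add: convex_translation convex_convex_cone_hull)
  then show ?thesis using q by auto
qed

text \<open>The tangent cone at \<open>p\<close> is generated by all steps from the points carrying
  \<open>p\<close> in a convex combination. One inclusion is \<open>hull_diff_in_cone\<close>; for
  the other, shifting one carrier \<open>v\<close> to \<open>v + \<alpha>\<close> moves
  \<open>p\<close> by a positive multiple of \<alpha>.\<close>

theorem mpoly_convex_hull:
  assumes B: "step_connected R B"
  shows "mpoly R (convex hull B)"
  unfolding mpoly_def
proof (intro conjI ballI)
  show "convex hull B \<noteq> {}" using B by (auto simp: step_connected_def)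
  show "convex (convex hull B)" by simp
  have "step_hull B = (\<Inter>p\<in>B. (\<lambda>y. y - p) -` (convex_cone hull (steps R B p)))"
    by (auto simp: step_hull_def)
  also have "closed \<dots>"
    by (intro closed_INT ballI continuous_closed_vimage closed_convex_cone_hull finite_steps)
       (auto intro!: continuous_intros)
  finally show "closed (convex hull B)" by (simp add: step_hull_eq_convex_hull[OF B])
  have "B \<subseteq> (convex hull B) \<inter> lat R" using B by (auto simp: step_connected_def hull_inc)
  then have "convex hull B \<subseteq> convex hull ((convex hull B) \<inter> lat R)" by (rule hull_mono)
  moreover have "convex hull ((convex hull B) \<inter> lat R) \<subseteq> convex hull B" by (intro hull_minimal) auto
  ultimately show "convex hull B = convex hull ((convex hull B) \<inter> lat R)" by blast
  fix p assume "p \<in> convex hull B"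
  then obtain S u where S: "finite S" "S \<subseteq> B" "S \<noteq> {}" "\<And>v. v \<in> S \<Longrightarrow> u v > 0" "sum u S = 1" "(\<Sum>v\<in>S. u v *\<^sub>R v) = p"
    by (rule convex_hull_positive) (rule that)
  define R' where "R' = (\<Union>v\<in>S. steps R B v)"
  have fin: "finite R'" using S(1) finite_steps by (simp add: R'_def)
  have "tcone (convex hull B) p \<subseteq> convex_cone hull R'"
    unfolding tcone_def
  proof (rule closure_minimal[OF hull_minimal])
    show "(\<lambda>q. q - p) ` (convex hull B) \<subseteq> convex_cone hull R'"
      using hull_diff_in_cone[OF B S(1,2,4,5)] S(6) by (auto simp: R'_def)
  qed (simp_all add: convex_cone_convex_cone_hull closed_convex_cone_hull fin)
  moreover have "convex_cone hull R' \<subseteq> tcone (convex hull B) p"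
  proof -
    have "convex_cone hull R' \<subseteq> convex_cone hull ((\<lambda>q. q - p) ` (convex hull B))"
    proof (rule hull_minimal)
      show "R' \<subseteq> convex_cone hull ((\<lambda>q. q - p) ` (convex hull B))"
      proof
        fix \<alpha> assume "\<alpha> \<in> R'"
        then obtain v where v: "v \<in> S" "v + \<alpha> \<in> B" by (auto simp: R'_def steps_def)
        define f where "f x = (if x = v then v + \<alpha> else x)" for x
        have "(\<Sum>x\<in>S. u x *\<^sub>R f x) \<in> convex hull B"
          by (rule convex_sum) (use S v in \<open>auto simp: f_def less_imp_le hull_inc subsetD\<close>)
        also have "(\<Sum>x\<in>S. u x *\<^sub>R f x) = (\<Sum>x\<in>S. u x *\<^sub>R x + (if x = v then u v *\<^sub>R \<alpha> else 0))"
          by (intro sum.cong) (auto simp: f_def scaleR_right_distrib)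
        also have "\<dots> = p + u v *\<^sub>R \<alpha>" using v(1) S(1,6) by (simp add: sum.distrib)
        finally have "p + u v *\<^sub>R \<alpha> \<in> convex hull B" .
        then have "u v *\<^sub>R \<alpha> \<in> (\<lambda>q. q - p) ` (convex hull B)" by (force simp: image_iff)
        then have "(1 / u v) *\<^sub>R (u v *\<^sub>R \<alpha>) \<in> convex_cone hull ((\<lambda>q. q - p) ` (convex hull B))"
          using S(4)[OF v(1)] by (intro convex_cone_hull_mul hull_inc) auto
        then show "\<alpha> \<in> convex_cone hull ((\<lambda>q. q - p) ` (convex hull B))" using S(4)[OF v(1)] by simp
      qed
    qed (simp add: convex_cone_convex_cone_hull)
    then show ?thesis unfolding tcone_def using closure_subset by blast
  qed
  ultimately have "tcone (convex hull B) p = convex_cone hull R'" by blast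
  then show "\<exists>R'\<subseteq>R. tcone (convex hull B) p = convex_cone hull R'"
    using steps_subset by (intro exI[of _ R']) (auto simp: R'_def)
qed

end

section \<open>Cells and the extension determined by the local conditions\<close>

locale local_conditions = root_vectors R for R :: "'a::euclidean_space set" +
  fixes P :: "'a set" and D :: "'a set" and G :: "'a \<Rightarrow> real"
  assumes P: "mpoly R P" and D: "D = P \<inter> lat R"
    and subgradient: "p \<in> D \<Longrightarrow> \<exists>x. \<forall>\<alpha>\<in>steps R D p. x \<bullet> \<alpha> \<le> G (p + \<alpha>) - G p"
    and growth: "p \<in> D \<Longrightarrow> q \<in> D \<Longrightarrow> \<exists>\<mu>. (\<forall>\<alpha>\<in>steps R D p. \<mu> \<alpha> \<ge> 0) \<and>
      q - p = (\<Sum>\<alpha>\<in>steps R D p. \<mu> \<alpha> *\<^sub>R \<alpha>) \<and> G q \<ge> G p + (\<Sum>\<alpha>\<in>steps R D p. \<mu> \<alpha> * (G (p + \<alpha>) - G p))"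
begin

abbreviation arg :: "'a \<Rightarrow> 'a set" where "arg \<equiv> argmin_on D G"

lemma P_props: "closed P" "convex P" "P = convex hull D"
  using P unfolding mpoly_def D by blast+

lemma D_nonempty: "D \<noteq> {}"
  using P P_props(3) unfolding mpoly_def by auto

lemma D_lat: "D \<subseteq> lat R" using D by blast

lemma arg_D: "p \<in> arg x \<Longrightarrow> p \<in> D" by (simp add: argmin_on_def)

lemma local_min_imp_arg:
  assumes "p \<in> D" "\<And>\<alpha>. \<alpha> \<in> steps R D p \<Longrightarrow> x \<bullet> \<alpha> \<le> G (p + \<alpha>) - G p"
  shows "p \<in> arg x"
proof -
  have "G p - x \<bullet> p \<le> G q - x \<bullet> q" if q: "q \<in> D" for q
  proof -
    obtain \<mu> where \<mu>: "\<forall>\<alpha>\<in>steps R D p. \<mu> \<alpha> \<ge> 0" "q - p = (\<Sum>\<alpha>\<in>steps R D p. \<mu> \<alpha> *\<^sub>R \<alpha>)"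
      "G q \<ge> G p + (\<Sum>\<alpha>\<in>steps R D p. \<mu> \<alpha> * (G (p + \<alpha>) - G p))"
      using growth[OF assms(1) q] by blast
    have "x \<bullet> (q - p) = (\<Sum>\<alpha>\<in>steps R D p. \<mu> \<alpha> * (x \<bullet> \<alpha>))" by (simp add: \<mu>(2) inner_sum_right)
    also have "\<dots> \<le> (\<Sum>\<alpha>\<in>steps R D p. \<mu> \<alpha> * (G (p + \<alpha>) - G p))"
      using \<mu>(1) assms(2) by (intro sum_mono mult_left_mono) auto
    finally show ?thesis using \<mu>(3) by (simp add: inner_diff_right)
  qed
  then show ?thesis using assms(1) by (simp add: argmin_on_def)
qed

lemma arg_step_le:
  assumes "p \<in> arg x" "\<alpha> \<in> steps R D p"
  shows "x \<bullet> \<alpha> \<le> G (p + \<alpha>) - G p"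
  using assms by (auto simp: argmin_on_def steps_def inner_add_right algebra_simps)

lemma arg_exists: "p \<in> D \<Longrightarrow> \<exists>x. p \<in> arg x"
  using subgradient local_min_imp_arg by meson

lemma arg_step_mem:
  assumes "p \<in> arg x" "\<alpha> \<in> steps R D p" "x \<bullet> \<alpha> = G (p + \<alpha>) - G p"
  shows "p + \<alpha> \<in> arg x"
  using assms by (auto simp: argmin_on_def steps_def inner_add_right algebra_simps)

text \<open>Between two minimisers the growth inequality must be an equality, while each step costs
  at least its \<open>x\<close>-value. So every step used is tight and leads to another
  minimiser.\<close>

lemma step_connected_arg:
  assumes "arg x \<noteq> {}"
  shows "step_connected R (arg x)"
  unfolding step_connected_def
proof (intro conjI ballI)
  show "arg x \<subseteq> lat R" using D_lat arg_D by blast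
  fix p q assume pq: "p \<in> arg x" "q \<in> arg x"
  obtain \<mu> where \<mu>: "\<forall>\<alpha>\<in>steps R D p. \<mu> \<alpha> \<ge> 0" "q - p = (\<Sum>\<alpha>\<in>steps R D p. \<mu> \<alpha> *\<^sub>R \<alpha>)"
      "G q \<ge> G p + (\<Sum>\<alpha>\<in>steps R D p. \<mu> \<alpha> * (G (p + \<alpha>) - G p))"
    using growth[OF arg_D[OF pq(1)] arg_D[OF pq(2)]] by blast
  have "G p - x \<bullet> p = G q - x \<bullet> q" using pq by (auto simp: argmin_on_def intro: order_antisym)
  then have "(\<Sum>\<alpha>\<in>steps R D p. \<mu> \<alpha> * (G (p + \<alpha>) - G p)) \<le> x \<bullet> (q - p)"
    using \<mu>(3) by (simp add: inner_diff_right)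
  also have "x \<bullet> (q - p) = (\<Sum>\<alpha>\<in>steps R D p. \<mu> \<alpha> * (x \<bullet> \<alpha>))" by (simp add: \<mu>(2) inner_sum_right)
  finally have "(\<Sum>\<alpha>\<in>steps R D p. \<mu> \<alpha> * (G (p + \<alpha>) - G p - x \<bullet> \<alpha>)) \<le> 0"
    by (simp add: right_diff_distrib sum_subtractf)
  moreover have nonneg: "\<mu> \<alpha> * (G (p + \<alpha>) - G p - x \<bullet> \<alpha>) \<ge> 0" if "\<alpha> \<in> steps R D p" for \<alpha>
    using \<mu>(1) that arg_step_le[OF pq(1) that] by simp
  ultimately have "(\<Sum>\<alpha>\<in>steps R D p. \<mu> \<alpha> * (G (p + \<alpha>) - G p - x \<bullet> \<alpha>)) = 0"
    by (intro order_antisym sum_nonneg)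
  then have zero: "\<forall>\<alpha>\<in>steps R D p. \<mu> \<alpha> * (G (p + \<alpha>) - G p - x \<bullet> \<alpha>) = 0"
    by (subst (asm) sum_nonneg_eq_0_iff) (use nonneg finite_steps in auto)
  show "q - p \<in> convex_cone hull (steps R (arg x) p)"
    unfolding \<mu>(2)
  proof (rule convex_cone_hull_sum)
    fix \<alpha> assume \<alpha>: "\<alpha> \<in> steps R D p"
    show "\<mu> \<alpha> *\<^sub>R \<alpha> \<in> convex_cone hull (steps R (arg x) p)"
    proof (cases "\<mu> \<alpha> = 0")
      case False
      then have "x \<bullet> \<alpha> = G (p + \<alpha>) - G p" using zero \<alpha> by auto
      then have "p + \<alpha> \<in> arg x" using arg_step_mem[OF pq(1) \<alpha>] by blast
      then have "\<alpha> \<in> steps R (arg x) p" using \<alpha> by (simp add: steps_def)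
      then show ?thesis using \<mu>(1) \<alpha> by (intro convex_cone_hull_mul hull_inc) auto
    qed (simp add: convex_cone_hull_contains_0)
  qed
qed fact

lemma mpoly_arg: "arg x \<noteq> {} \<Longrightarrow> mpoly R (convex hull (arg x))"
  using mpoly_convex_hull step_connected_arg by blast

text \<open>Minus the conjugate of \<open>G\<close> at \<open>x\<close>: the constant making
  \<open>x \<bullet> y + minval x\<close> the best affine minorant of slope \<open>x\<close>.
  Meaningful when \<open>arg x\<close> is nonempty; all minimisers then give the same value.\<close>

definition minval :: "'a \<Rightarrow> real" where
  "minval x = (let p = (SOME p. p \<in> arg x) in G p - x \<bullet> p)"

lemma minval: "p \<in> arg x \<Longrightarrow> G p = x \<bullet> p + minval x"
proof -
  assume p: "p \<in> arg x"
  then have "(SOME p. p \<in> arg x) \<in> arg x" by (rule someI)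
  then have "G (SOME p. p \<in> arg x) - x \<bullet> (SOME p. p \<in> arg x) = G p - x \<bullet> p"
    using p by (auto simp: argmin_on_def intro: order_antisym)
  then show ?thesis by (simp add: minval_def Let_def)
qed

lemma minval_le: "arg x \<noteq> {} \<Longrightarrow> q \<in> D \<Longrightarrow> x \<bullet> q + minval x \<le> G q"
proof -
  assume "arg x \<noteq> {}" "q \<in> D"
  then obtain p where p: "p \<in> arg x" by blast
  then have "G p - x \<bullet> p \<le> G q - x \<bullet> q" using \<open>q \<in> D\<close> by (simp add: argmin_on_def)
  then show ?thesis using minval[OF p] by simp
qed

lemma affine_combination:
  assumes "sum u S = (1::real)" "(\<Sum>v\<in>S. u v *\<^sub>R v) = y"
  shows "(\<Sum>v\<in>S. u v * (x \<bullet> v + c)) = x \<bullet> y + c"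
proof -
  have "(\<Sum>v\<in>S. u v * (x \<bullet> v + c)) = x \<bullet> (\<Sum>v\<in>S. u v *\<^sub>R v) + sum u S * c"
    by (simp add: distrib_left sum.distrib inner_sum_right sum_distrib_right)
  then show ?thesis using assms by simp
qed

text \<open>On its own cell an affine minorant interpolates \<open>G\<close> at the carrying lattice
  points, where every other minorant lies below; convex combination preserves this. Hence the
  extension will be the maximum of all minorants.\<close>

lemma minorant_le:
  assumes "arg x' \<noteq> {}" "y \<in> convex hull (arg x)"
  shows "x' \<bullet> y + minval x' \<le> x \<bullet> y + minval x"
proof -
  obtain S u where S: "finite S" "S \<subseteq> arg x" "S \<noteq> {}" "\<And>v. v \<in> S \<Longrightarrow> u v > 0" "sum u S = 1" "(\<Sum>v\<in>S. u v *\<^sub>R v) = y"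
    using assms(2) by (rule convex_hull_positive) (rule that)
  have "x' \<bullet> y + minval x' = (\<Sum>v\<in>S. u v * (x' \<bullet> v + minval x'))" using affine_combination[OF S(5,6)] by simp
  also have "\<dots> \<le> (\<Sum>v\<in>S. u v * (x \<bullet> v + minval x))"
  proof (intro sum_mono mult_left_mono)
    fix v assume v: "v \<in> S"
    then have "v \<in> arg x" using S(2) by blast
    then show "x' \<bullet> v + minval x' \<le> x \<bullet> v + minval x"
      using minval_le[OF assms(1) arg_D] minval by metis
    show "0 \<le> u v" using S(4)[OF v] by simp
  qed
  also have "\<dots> = x \<bullet> y + minval x" by (rule affine_combination[OF S(5,6)])
  finally show ?thesis .
qed

text \<open>Cells meet in common faces: at \<open>y\<close> the two minorants coincide, their
  difference is nonnegative on \<open>S\<close>, and positive weights force it to vanish at every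
  point of \<open>S\<close>.\<close>

lemma support_in_arg:
  assumes S: "finite S" "S \<subseteq> arg x" "\<And>v. v \<in> S \<Longrightarrow> u v > 0" "sum u S = 1" "(\<Sum>v\<in>S. u v *\<^sub>R v) = y"
    and y: "y \<in> convex hull (arg x')"
  shows "S \<subseteq> arg x'"
proof -
  have "S \<noteq> {}" using S(4) by auto
  then have ne: "arg x' \<noteq> {}" "arg x \<noteq> {}" using y S(2) by auto
  have "y \<in> convex hull (arg x)"
    unfolding S(5)[symmetric]
    by (rule convex_sum) (use S in \<open>auto intro: hull_inc less_imp_le\<close>)
  then have eq: "x' \<bullet> y + minval x' = x \<bullet> y + minval x"
    using minorant_le[OF ne(1)] minorant_le[OF ne(2) y] by (intro order_antisym)
  have "(\<Sum>v\<in>S. u v * (x \<bullet> v + minval x)) - (\<Sum>v\<in>S. u v * (x' \<bullet> v + minval x')) = 0"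
    using eq by (simp add: affine_combination[OF S(4,5)])
  then have "(\<Sum>v\<in>S. u v * ((x \<bullet> v + minval x) - (x' \<bullet> v + minval x'))) = 0"
    by (simp only: right_diff_distrib sum_subtractf)
  moreover have le: "x' \<bullet> v + minval x' \<le> x \<bullet> v + minval x" if "v \<in> S" for v
    using minval_le[OF ne(1), of v] minval[of v x] arg_D[of v x] S(2) that by auto
  ultimately have "\<forall>v\<in>S. u v * ((x \<bullet> v + minval x) - (x' \<bullet> v + minval x')) = 0"
    by (subst (asm) sum_nonneg_eq_0_iff) (use S(1,3) in \<open>auto intro!: mult_nonneg_nonneg simp: less_imp_le\<close>)
  then have eqv: "x \<bullet> v + minval x = x' \<bullet> v + minval x'" if "v \<in> S" for v
    using S(3)[OF that] that by fastforce
  show ?thesis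
  proof
    fix v assume v: "v \<in> S"
    have vx: "v \<in> arg x" using S(2) v by blast
    have "G v = x' \<bullet> v + minval x'" using minval[OF vx] eqv[OF v] by simp
    then have "G v - x' \<bullet> v \<le> G q - x' \<bullet> q" if "q \<in> D" for q using minval_le[OF ne(1) that] by simp
    then show "v \<in> arg x'" using arg_D[OF vx] by (simp add: argmin_on_def)
  qed
qed

text \<open>Maximise \<open>x \<bullet> d\<close> over all \<open>x\<close> with \<open>S \<subseteq> arg x\<close>; by complementary slackness an optimal dual
  solution writes \<open>d\<close> in terms of roots leading from \<open>S\<close> into \<open>arg x\<close>.\<close>

lemma optimal_direction:
  assumes S: "finite S" "S \<subseteq> arg x0" "\<And>v. v \<in> S \<Longrightarrow> u v > 0" "sum u S = 1" "(\<Sum>v\<in>S. u v *\<^sub>R v) = y"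
    and y': "y' \<in> P"
  obtains x \<nu> where "S \<subseteq> arg x" "\<And>v \<alpha>. v \<in> S \<Longrightarrow> \<alpha> \<in> steps R D v \<Longrightarrow> \<nu> (v, \<alpha>) \<ge> (0::real)"
    "\<And>v \<alpha>. v \<in> S \<Longrightarrow> \<alpha> \<in> steps R D v \<Longrightarrow> \<nu> (v, \<alpha>) > 0 \<Longrightarrow> v + \<alpha> \<in> arg x"
    "y' - y = (\<Sum>v\<in>S. \<Sum>\<alpha>\<in>steps R D v. \<nu> (v, \<alpha>) *\<^sub>R \<alpha>)"
proof -
  define I where "I = Sigma S (steps R D)"
  have I: "finite I" using S(1) finite_steps by (simp add: I_def)
  have SD: "S \<subseteq> D" using S(2) arg_D by blast
  have D_conn: "step_connected R D"
    unfolding step_connected_def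
  proof (intro conjI ballI D_nonempty D_lat)
    fix p q assume "p \<in> D" "q \<in> D"
    from growth[OF this] show "q - p \<in> convex_cone hull (steps R D p)"
      unfolding convex_cone_hull_finite[OF finite_steps] by blast
  qed
  have "y' - y \<in> convex_cone hull (\<Union>v\<in>S. steps R D v)"
    using hull_diff_in_cone[OF D_conn S(1) SD S(3,4)] y' P_props(3) S(5) by blast
  also have "(\<Union>v\<in>S. steps R D v) = snd ` I" by (force simp: I_def)
  finally obtain \<mu> where \<mu>: "\<forall>i\<in>I. \<mu> i \<ge> (0::real)" "y' - y = (\<Sum>i\<in>I. \<mu> i *\<^sub>R snd i)"
    unfolding convex_cone_hull_image_finite[OF I] by blast
  have dual: "x0 \<bullet> snd i \<le> G (fst i + snd i) - G (fst i)" if "i \<in> I" for i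
    using that arg_step_le S(2) by (auto simp: I_def)
  obtain x \<nu> where x: "\<forall>i\<in>I. \<nu> i \<ge> 0 \<and> x \<bullet> snd i \<le> G (fst i + snd i) - G (fst i) \<and> (\<nu> i > 0 \<longrightarrow> x \<bullet> snd i = G (fst i + snd i) - G (fst i))"
    "y' - y = (\<Sum>i\<in>I. \<nu> i *\<^sub>R snd i)"
    using linear_programming_duality[OF I, of \<mu> "y' - y" snd x0 "\<lambda>i. G (fst i + snd i) - G (fst i)"] \<mu> dual by blast
  have Sx: "S \<subseteq> arg x"
  proof
    fix v assume v: "v \<in> S"
    show "v \<in> arg x"
    proof (rule local_min_imp_arg)
      show "v \<in> D" using v SD by blast
      fix \<alpha> assume "\<alpha> \<in> steps R D v"
      then have "(v, \<alpha>) \<in> I" using v by (simp add: I_def)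
      then show "x \<bullet> \<alpha> \<le> G (v + \<alpha>) - G v" using x(1) by force
    qed
  qed
  show ?thesis
  proof (rule that[of x \<nu>])
    show "S \<subseteq> arg x" by (rule Sx)
    fix v \<alpha> assume v: "v \<in> S" and \<alpha>: "\<alpha> \<in> steps R D v"
    then have i: "(v, \<alpha>) \<in> I" by (simp add: I_def)
    then show "\<nu> (v, \<alpha>) \<ge> 0" using x(1) by blast
    show "v + \<alpha> \<in> arg x" if "\<nu> (v, \<alpha>) > 0"
      using arg_step_mem[of v x \<alpha>] x(1) i that Sx v \<alpha> by force
  next
    show "y' - y = (\<Sum>v\<in>S. \<Sum>\<alpha>\<in>steps R D v. \<nu> (v, \<alpha>) *\<^sub>R \<alpha>)"
      unfolding x(2) I_def by (subst sum.Sigma) (use S(1) finite_steps in \<open>auto simp: case_prod_beta\<close>)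
  qed
qed

text \<open>The points carrying \<open>y\<close> are moved along the optimal combination of roots,
  each by its share, and \<open>convex_steps\<close> keeps every one of them in the hull of
  \<open>arg x\<close>.\<close>

lemma cover_step:
  assumes "y \<in> convex hull (arg x0)" "y' \<in> P"
  obtains \<epsilon> x where "0 < \<epsilon>" "\<epsilon> \<le> 1" "y + \<epsilon> *\<^sub>R (y' - y) \<in> convex hull (arg x)"
proof -
  obtain S u where S: "finite S" "S \<subseteq> arg x0" "S \<noteq> {}" "\<And>v. v \<in> S \<Longrightarrow> u v > 0" "sum u S = 1" "(\<Sum>v\<in>S. u v *\<^sub>R v) = y"
    using assms(1) by (rule convex_hull_positive) (rule that)
  obtain x \<nu> where x: "S \<subseteq> arg x" "\<And>v \<alpha>. v \<in> S \<Longrightarrow> \<alpha> \<in> steps R D v \<Longrightarrow> \<nu> (v, \<alpha>) \<ge> (0::real)"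
    "\<And>v \<alpha>. v \<in> S \<Longrightarrow> \<alpha> \<in> steps R D v \<Longrightarrow> \<nu> (v, \<alpha>) > 0 \<Longrightarrow> v + \<alpha> \<in> arg x"
    "y' - y = (\<Sum>v\<in>S. \<Sum>\<alpha>\<in>steps R D v. \<nu> (v, \<alpha>) *\<^sub>R \<alpha>)"
    by (rule optimal_direction[OF S(1,2,4,5,6) assms(2)], assumption) (rule that)
  define N where "N v = (\<Sum>\<alpha>\<in>steps R D v. \<nu> (v, \<alpha>))" for v
  have N: "N v \<ge> 0" if "v \<in> S" for v unfolding N_def using x(2) that by (intro sum_nonneg)
  \<comment> \<open>Ensures that \<epsilon> times the total \<open>N v\<close> of the steps at
    \<open>v\<close> is at most the weight \<open>u v\<close>; the summand \<open>u v\<close> keeps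
    the denominator positive when \<open>N v = 0\<close> and bounds \<epsilon> by 1.\<close>
  define \<epsilon> where "\<epsilon> = Min ((\<lambda>v. u v / (u v + N v)) ` S)"
  have "\<epsilon> \<in> (\<lambda>v. u v / (u v + N v)) ` S" unfolding \<epsilon>_def using S(1,3) by (intro Min_in) auto
  then obtain v0 where v0: "v0 \<in> S" "\<epsilon> = u v0 / (u v0 + N v0)" by blast
  have \<epsilon>: "0 < \<epsilon>" "\<epsilon> \<le> 1"
    unfolding v0(2) using S(4)[OF v0(1)] N[OF v0(1)] by (auto intro!: divide_pos_pos simp: divide_le_eq_1)
  have \<epsilon>N: "\<epsilon> * N v \<le> u v" if v: "v \<in> S" for v
  proof -
    have "\<epsilon> \<le> u v / (u v + N v)" unfolding \<epsilon>_def using S(1) v by (intro Min_le) auto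
    then have "\<epsilon> * (u v + N v) \<le> u v" using S(4)[OF v] N[OF v] by (simp add: pos_le_divide_eq)
    moreover have "\<epsilon> * u v \<ge> 0" using \<epsilon>(1) S(4)[OF v] by simp
    ultimately show ?thesis by (simp add: distrib_left)
  qed
  define f where "f v = v + (\<Sum>\<alpha>\<in>steps R D v. (\<epsilon> * \<nu> (v, \<alpha>) / u v) *\<^sub>R \<alpha>)" for v
  have f: "f v \<in> convex hull (arg x)" if v: "v \<in> S" for v
    unfolding f_def
  proof (rule convex_steps)
    show "v \<in> convex hull (arg x)" using v x(1) by (auto intro: hull_inc)
    show "finite (steps R D v)" by (rule finite_steps)
    fix \<alpha> assume \<alpha>: "\<alpha> \<in> steps R D v"
    show "0 \<le> \<epsilon> * \<nu> (v, \<alpha>) / u v" using x(2)[OF v \<alpha>] \<epsilon>(1) S(4)[OF v] by simp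
    assume "0 < \<epsilon> * \<nu> (v, \<alpha>) / u v"
    then have "\<nu> (v, \<alpha>) > 0" using \<epsilon>(1) S(4)[OF v] by (simp add: zero_less_divide_iff zero_less_mult_iff)
    then show "v + \<alpha> \<in> convex hull (arg x)" using x(3)[OF v \<alpha>] by (simp add: hull_inc)
  next
    have "(\<Sum>\<alpha>\<in>steps R D v. \<epsilon> * \<nu> (v, \<alpha>) / u v) = \<epsilon> * N v / u v"
      by (simp add: N_def sum_distrib_left sum_divide_distrib)
    also have "\<dots> \<le> 1" using \<epsilon>N[OF v] S(4)[OF v] by simp
    finally show "(\<Sum>\<alpha>\<in>steps R D v. \<epsilon> * \<nu> (v, \<alpha>) / u v) \<le> 1" .
  qed simp
  have "(\<Sum>v\<in>S. u v *\<^sub>R f v) \<in> convex hull (arg x)"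
    by (rule convex_sum) (use S f in \<open>auto intro: less_imp_le\<close>)
  also have "(\<Sum>v\<in>S. u v *\<^sub>R f v) = (\<Sum>v\<in>S. u v *\<^sub>R v + (\<Sum>\<alpha>\<in>steps R D v. (\<epsilon> * \<nu> (v, \<alpha>)) *\<^sub>R \<alpha>))"
  proof (rule sum.cong)
    fix v assume "v \<in> S"
    then have "u v \<noteq> 0" using S(4) by force
    then show "u v *\<^sub>R f v = u v *\<^sub>R v + (\<Sum>\<alpha>\<in>steps R D v. (\<epsilon> * \<nu> (v, \<alpha>)) *\<^sub>R \<alpha>)"
      by (simp add: f_def scaleR_right_distrib scaleR_sum_right)
  qed simp
  also have "\<dots> = y + \<epsilon> *\<^sub>R (y' - y)"
    by (simp add: sum.distrib S(6) x(4) scaleR_sum_right)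
  finally show ?thesis using that \<epsilon> by blast
qed

text \<open>A continuity argument along the segment from a point of \<open>D\<close> to
  \<open>y\<close>: by \<open>mpoly_near\<close> the supremum of the covered parameters is covered,
  and by \<open>cover_step\<close> it cannot be smaller than 1.\<close>

theorem cover:
  assumes y: "y \<in> P"
  obtains x where "y \<in> convex hull (arg x)"
proof -
  obtain v0 where v0: "v0 \<in> D" using D_nonempty by blast
  define \<phi> where "\<phi> t = v0 + t *\<^sub>R (y - v0)" for t :: real
  define T where "T = {t. 0 \<le> t \<and> t \<le> 1 \<and> (\<exists>x. \<phi> t \<in> convex hull (arg x))}"
  define s where "s = Sup T"
  obtain x0 where "v0 \<in> arg x0" using arg_exists[OF v0] by blast
  then have "0 \<in> T" by (auto simp: T_def \<phi>_def intro!: exI[of _ x0] hull_inc)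
  have bdd: "bdd_above T" by (auto simp: T_def intro: bdd_aboveI[of _ 1])
  have s01: "0 \<le> s" "s \<le> 1"
    unfolding s_def using \<open>0 \<in> T\<close> bdd by (auto intro: cSup_upper cSup_least simp: T_def)
  obtain \<epsilon> where \<epsilon>: "\<epsilon> > 0" "\<And>C z. mpoly R C \<Longrightarrow> z \<in> C \<Longrightarrow> dist z (\<phi> s) < \<epsilon> \<Longrightarrow> \<phi> s \<in> C"
    using mpoly_near[of "\<phi> s"] by blast
  \<comment> \<open>The summand 1 avoids division by zero when \<open>y = v0\<close>.\<close>
  define \<eta> where "\<eta> = \<epsilon> / (norm (y - v0) + 1)"
  have \<eta>: "\<eta> > 0" using \<epsilon>(1) by (simp add: \<eta>_def add_nonneg_pos)
  obtain t where t: "t \<in> T" "s - \<eta> < t"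
    using less_cSupE[of "s - \<eta>" T] \<open>0 \<in> T\<close> \<eta> by (auto simp: s_def)
  have "t \<le> s" unfolding s_def using t(1) bdd by (rule cSup_upper)
  obtain x where x: "\<phi> t \<in> convex hull (arg x)" using t(1) by (auto simp: T_def)
  have "dist (\<phi> t) (\<phi> s) = \<bar>t - s\<bar> * norm (y - v0)"
    by (simp add: \<phi>_def dist_norm flip: scaleR_diff_left)
  also have "\<dots> \<le> \<eta> * norm (y - v0)" using t(2) \<open>t \<le> s\<close> by (intro mult_right_mono) auto
  also have "\<dots> < \<eta> * (norm (y - v0) + 1)" using \<eta> by simp
  also have "\<dots> = \<epsilon>" unfolding \<eta>_def by (simp add: add_nonneg_eq_0_iff)
  finally have "dist (\<phi> t) (\<phi> s) < \<epsilon>" .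
  moreover have "arg x \<noteq> {}" using x by auto
  ultimately have sx: "\<phi> s \<in> convex hull (arg x)" using \<epsilon>(2)[OF mpoly_arg x] by blast
  have "s = 1"
  proof (rule ccontr)
    assume "s \<noteq> 1"
    then have "s < 1" using s01 by simp
    obtain \<delta> x' where \<delta>: "0 < \<delta>" "\<delta> \<le> 1" "\<phi> s + \<delta> *\<^sub>R (y - \<phi> s) \<in> convex hull (arg x')"
      using sx y by (rule cover_step) (rule that)
    have "\<phi> s + \<delta> *\<^sub>R (y - \<phi> s) = \<phi> (s + \<delta> * (1 - s))" by (simp add: \<phi>_def algebra_simps)
    moreover have "\<delta> * (1 - s) \<le> 1 * (1 - s)" using \<delta> \<open>s < 1\<close> by (intro mult_right_mono) auto
    moreover have "\<delta> * (1 - s) > 0" using \<delta> \<open>s < 1\<close> by simp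
    ultimately have "s + \<delta> * (1 - s) \<in> T" using \<delta>(3) s01 unfolding T_def by auto
    then have "s + \<delta> * (1 - s) \<le> s" unfolding s_def using bdd by (rule cSup_upper)
    then show False using \<open>\<delta> * (1 - s) > 0\<close> by simp
  qed
  then show ?thesis using that sx by (simp add: \<phi>_def)
qed

definition ext :: "'a \<Rightarrow> real" where
  "ext y = (let x = (SOME x. y \<in> convex hull (arg x)) in x \<bullet> y + minval x)"

lemma ext_eq:
  assumes "y \<in> convex hull (arg x)"
  shows "ext y = x \<bullet> y + minval x"
proof -
  let ?x = "SOME x. y \<in> convex hull (arg x)"
  have y: "y \<in> convex hull (arg ?x)" using assms by (rule someI)
  then have "arg ?x \<noteq> {}" "arg x \<noteq> {}" using assms by auto
  then have "?x \<bullet> y + minval ?x = x \<bullet> y + minval x"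
    using minorant_le assms y by (intro order_antisym)
  then show ?thesis by (simp add: ext_def Let_def)
qed

lemma ext_ge:
  assumes "arg x \<noteq> {}" "y \<in> P"
  shows "x \<bullet> y + minval x \<le> ext y"
proof -
  obtain x' where "y \<in> convex hull (arg x')" using assms(2) by (rule cover)
  then show ?thesis using ext_eq minorant_le[OF assms(1)] by metis
qed

lemma ext_D: "p \<in> D \<Longrightarrow> ext p = G p"
proof -
  assume "p \<in> D"
  then obtain x where "p \<in> arg x" using arg_exists by blast
  then show ?thesis using ext_eq[of p x] minval[of p x] by (simp add: hull_inc)
qed

lemma hull_arg_P: "convex hull (arg x) \<subseteq> P"
  unfolding P_props(3) using arg_D by (intro hull_mono) blast

text \<open>At a minimiser \<open>y\<close> the value of \<open>ext\<close> is an average of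
  \<open>G\<close> over lattice points carrying \<open>y\<close>. After subtracting \<open>x\<close>
  none of them falls below the minimum, so each attains it and belongs to
  \<open>arg x\<close>.\<close>

lemma argmin_ext:
  assumes "argmin_on P ext x \<noteq> {}"
  shows "argmin_on P ext x = convex hull (arg x)" and "arg x \<noteq> {}"
proof -
  have sub: "argmin_on P ext x \<subseteq> convex hull (arg x)"
  proof
    fix y assume y: "y \<in> argmin_on P ext x"
    then have yP: "y \<in> P" by (simp add: argmin_on_def)
    obtain x1 where x1: "y \<in> convex hull (arg x1)" using yP by (rule cover)
    obtain S u where S: "finite S" "S \<subseteq> arg x1" "S \<noteq> {}" "\<And>v. v \<in> S \<Longrightarrow> u v > 0" "sum u S = 1" "(\<Sum>v\<in>S. u v *\<^sub>R v) = y"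
      using x1 by (rule convex_hull_positive) (rule that)
    have DP: "D \<subseteq> P" using D by blast
    define m0 where "m0 = ext y - x \<bullet> y"
    have le: "m0 \<le> G v - x \<bullet> v" if "v \<in> D" for v
      using y that DP ext_D[OF that] by (force simp: argmin_on_def m0_def)
    have "(\<Sum>v\<in>S. u v * (G v - x \<bullet> v)) = (\<Sum>v\<in>S. u v * ((x1 - x) \<bullet> v + minval x1))"
    proof (rule sum.cong)
      fix v assume "v \<in> S"
      then have "v \<in> arg x1" using S(2) by blast
      then show "u v * (G v - x \<bullet> v) = u v * ((x1 - x) \<bullet> v + minval x1)" using minval by (simp add: inner_diff_left)
    qed simp
    also have "\<dots> = (x1 - x) \<bullet> y + minval x1" by (rule affine_combination[OF S(5,6)])
    also have "\<dots> = m0" using ext_eq[OF x1] by (simp add: m0_def inner_diff_left)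
    finally have "(\<Sum>v\<in>S. u v * (G v - x \<bullet> v)) - sum u S * m0 = 0" using S(5) by simp
    then have "(\<Sum>v\<in>S. u v * (G v - x \<bullet> v - m0)) = 0"
      by (simp add: right_diff_distrib sum_subtractf sum_distrib_right)
    then have "\<forall>v\<in>S. u v * (G v - x \<bullet> v - m0) = 0"
      by (subst (asm) sum_nonneg_eq_0_iff)
         (use S(1,2,4) le arg_D in \<open>auto intro!: mult_nonneg_nonneg simp: less_imp_le\<close>)
    then have eq: "G v - x \<bullet> v = m0" if "v \<in> S" for v using S(4)[OF that] that by fastforce
    have "S \<subseteq> arg x"
    proof
      fix v assume v: "v \<in> S"
      then have "v \<in> D" using S(2) arg_D by blast
      then show "v \<in> arg x" using eq[OF v] le by (simp add: argmin_on_def)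
    qed
    then show "y \<in> convex hull (arg x)"
      unfolding S(6)[symmetric]
      by (intro convex_sum) (use S in \<open>auto intro: hull_inc less_imp_le\<close>)
  qed
  then show ne: "arg x \<noteq> {}" using assms by auto
  have "convex hull (arg x) \<subseteq> argmin_on P ext x"
  proof
    fix y assume y: "y \<in> convex hull (arg x)"
    have "ext y - x \<bullet> y \<le> ext q - x \<bullet> q" if "q \<in> P" for q
      using ext_ge[OF ne that] ext_eq[OF y] by simp
    then show "y \<in> argmin_on P ext x" using y hull_arg_P by (auto simp: argmin_on_def)
  qed
  then show "argmin_on P ext x = convex hull (arg x)" using sub by blast
qed

text \<open>Every cell close to \<open>y\<close> contains \<open>y\<close>, so it is the cell of an \<open>x\<close> with \<open>S \<subseteq> arg x\<close>; on it \<open>ext\<close>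
  depends only on the set \<open>J\<close> of roots leading from \<open>S\<close> into \<open>arg x\<close>.\<close>

lemma ext_locally_finite:
  assumes y: "y \<in> P"
  obtains \<delta> X where "\<delta> > 0" "finite X" "\<And>x. x \<in> X \<Longrightarrow> arg x \<noteq> {}"
    "\<And>y'. y' \<in> P \<Longrightarrow> dist y' y < \<delta> \<Longrightarrow> \<exists>x\<in>X. ext y' = x \<bullet> y' + minval x"
proof -
  obtain x1 where x1: "y \<in> convex hull (arg x1)" using y by (rule cover)
  obtain S u where S: "finite S" "S \<subseteq> arg x1" "S \<noteq> {}" "\<And>v. v \<in> S \<Longrightarrow> u v > 0" "sum u S = 1" "(\<Sum>v\<in>S. u v *\<^sub>R v) = y"
    using x1 by (rule convex_hull_positive) (rule that)
  obtain \<epsilon> where \<epsilon>: "\<epsilon> > 0" "\<And>C z. mpoly R C \<Longrightarrow> z \<in> C \<Longrightarrow> dist z y < \<epsilon> \<Longrightarrow> y \<in> C"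
    using mpoly_near[of y] by blast
  define ok where "ok J x \<longleftrightarrow> S \<subseteq> arg x \<and> (\<forall>(v, \<alpha>)\<in>J. v + \<alpha> \<in> arg x)" for J x
  \<comment> \<open>One representative per \<open>J\<close>, independent of the cell that produced
    \<open>J\<close>; this keeps \<open>X\<close> finite.\<close>
  define pick where "pick J = (SOME x. ok J x)" for J
  define X where "X = pick ` {J. J \<subseteq> S \<times> R \<and> (\<exists>x. ok J x)}"
  have pick: "ok J (pick J)" if "ok J x" for J x
    unfolding pick_def using that by (rule someI)
  show ?thesis
  proof (rule that[OF \<epsilon>(1), of X])
    have "finite {J. J \<subseteq> S \<times> R \<and> (\<exists>x. ok J x)}"
      by (rule finite_subset[of _ "Pow (S \<times> R)"]) (use S(1) finR in auto)
    then show "finite X" unfolding X_def by (rule finite_imageI)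
    show "arg x \<noteq> {}" if x: "x \<in> X" for x
    proof -
      obtain J x' where "x = pick J" "ok J x'" using x by (auto simp: X_def)
      then have "S \<subseteq> arg x" using pick by (simp add: ok_def)
      then show ?thesis using S(3) by blast
    qed
    fix y' assume y': "y' \<in> P" "dist y' y < \<epsilon>"
    obtain x' where x': "y' \<in> convex hull (arg x')" using y'(1) by (rule cover)
    then have ne: "arg x' \<noteq> {}" by auto
    have yx': "y \<in> convex hull (arg x')" using \<epsilon>(2)[OF mpoly_arg[OF ne] x' y'(2)] .
    have Sx': "S \<subseteq> arg x'" by (rule support_in_arg[OF S(1,2,4,5,6) yx'])
    define J where "J = {(v, \<alpha>). v \<in> S \<and> \<alpha> \<in> steps R (arg x') v}"
    have J: "J \<subseteq> S \<times> R" by (auto simp: J_def steps_def)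
    have finJ: "finite J" using J S(1) finR finite_subset by blast
    have okx': "ok J x'" using Sx' by (auto simp: ok_def J_def steps_def)
    define x where "x = pick J"
    have okx: "ok J x" unfolding x_def by (rule pick[OF okx'])
    have "x \<in> X" using J okx' by (auto simp: X_def x_def)
    have "y' - y \<in> convex_cone hull (\<Union>v\<in>S. steps R (arg x') v)"
      using hull_diff_in_cone[OF step_connected_arg[OF ne] S(1) Sx' S(4,5) x'] S(6) by simp
    also have "(\<Union>v\<in>S. steps R (arg x') v) = snd ` J" by (force simp: J_def)
    finally obtain \<mu> where \<mu>: "y' - y = (\<Sum>i\<in>J. \<mu> i *\<^sub>R snd i)"
      unfolding convex_cone_hull_image_finite[OF finJ] by blast
    \<comment> \<open>Along a root of \<open>J\<close> both slopes equal the difference of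
      \<open>G\<close> between its two end points.\<close>
    have same: "x \<bullet> snd i = x' \<bullet> snd i" if "i \<in> J" for i
    proof -
      obtain v \<alpha> where i: "i = (v, \<alpha>)" by force
      have "v \<in> arg x" "v + \<alpha> \<in> arg x" "v \<in> arg x'" "v + \<alpha> \<in> arg x'"
        using that i okx okx' J by (auto simp: ok_def)
      then show ?thesis using minval[of v x] minval[of "v + \<alpha>" x] minval[of v x'] minval[of "v + \<alpha>" x']
        by (simp add: i inner_add_right)
    qed
    have d: "x \<bullet> (y' - y) = x' \<bullet> (y' - y)"
      unfolding \<mu> inner_sum_right by (intro sum.cong) (simp_all add: same)
    have "y \<in> convex hull (arg x)"
      unfolding S(6)[symmetric]
      by (intro convex_sum) (use S okx in \<open>auto intro: hull_inc less_imp_le simp: ok_def\<close>)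
    then have "x \<bullet> y + minval x = x' \<bullet> y + minval x'" using ext_eq yx' by metis
    then have "ext y' = x \<bullet> y' + minval x" using d ext_eq[OF x'] by (simp add: inner_diff_right)
    then show "\<exists>x\<in>X. ext y' = x \<bullet> y' + minval x" using \<open>x \<in> X\<close> by blast
  qed
qed

text \<open>There are finitely many small functionals, and those with an attained maximum already
  separate every outside point.\<close>

lemma P_halfspaces:
  obtains F :: "('a \<times> real) set" where "finite F" "\<And>y. y \<in> P \<longleftrightarrow> (\<forall>(w, b)\<in>F. w \<bullet> y \<le> b)"
proof -
  define b where "b w = (SOME b. \<exists>z\<in>P. b = w \<bullet> z \<and> (\<forall>q\<in>P. w \<bullet> q \<le> w \<bullet> z))" for w
  define F where "F = (\<lambda>w. (w, b w)) ` {w \<in> small_functionals R. \<exists>z\<in>P. \<forall>q\<in>P. w \<bullet> q \<le> w \<bullet> z}"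
  have b: "\<exists>z\<in>P. b w = w \<bullet> z \<and> (\<forall>q\<in>P. w \<bullet> q \<le> w \<bullet> z)" if "\<exists>z\<in>P. \<forall>q\<in>P. w \<bullet> q \<le> w \<bullet> z" for w
    unfolding b_def by (rule someI_ex) (use that in blast)
  show ?thesis
  proof (rule that[of F])
    show "finite F" unfolding F_def using finite_small_functionals by simp
    fix y
    show "y \<in> P \<longleftrightarrow> (\<forall>(w, b)\<in>F. w \<bullet> y \<le> b)"
    proof
      assume y: "y \<in> P"
      have "w \<bullet> y \<le> b w" if "\<exists>z\<in>P. \<forall>q\<in>P. w \<bullet> q \<le> w \<bullet> z" for w
        using b[OF that] y by auto
      then show "\<forall>(w, b)\<in>F. w \<bullet> y \<le> b" by (auto simp: F_def)
    next
      assume le: "\<forall>(w, b)\<in>F. w \<bullet> y \<le> b"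
      show "y \<in> P"
      proof (rule ccontr)
        assume "y \<notin> P"
        then obtain w z where w: "w \<in> small_functionals R" "z \<in> P" "\<And>q. q \<in> P \<Longrightarrow> w \<bullet> q \<le> w \<bullet> z" "w \<bullet> z < w \<bullet> y"
          using mpoly_separation_small[OF P] by metis
        have mx: "\<exists>z\<in>P. \<forall>q\<in>P. w \<bullet> q \<le> w \<bullet> z" using w(2,3) by blast
        then have "(w, b w) \<in> F" using w(1) by (simp add: F_def)
        then have "w \<bullet> y \<le> b w" using le by blast
        moreover obtain z' where "z' \<in> P" "b w = w \<bullet> z'" using b[OF mx] by blast
        then have "b w \<le> w \<bullet> z" using w(3) by simp
        ultimately show False using w(4) by simp
      qed
    qed
  qed
qed

text \<open>As a maximum of affine minorants on \<open>P\<close>, \<open>ext\<close> is convex. Over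
  the compact projection of a polytope, \<open>ext_locally_finite\<close> leaves finitely many
  minorants, so the epigraph agrees there with a finite intersection of halfspaces.\<close>

lemma locally_polyhedral_ext: "locally_polyhedral {(y, t). y \<in> P \<and> ext y \<le> t}"
  unfolding locally_polyhedral_def
proof (intro conjI allI impI)
  have mem: "y \<in> P \<and> ext y \<le> t \<longleftrightarrow> y \<in> P \<and> (\<forall>x. arg x \<noteq> {} \<longrightarrow> x \<bullet> y + minval x \<le> t)" for y t
  proof (cases "y \<in> P")
    case True
    then obtain x where x: "y \<in> convex hull (arg x)" by (rule cover)
    have ne: "arg x \<noteq> {}" using x by auto
    show ?thesis
    proof (intro iffI conjI True allI impI; elim conjE)
      fix x' assume "ext y \<le> t" "arg x' \<noteq> {}"
      then show "x' \<bullet> y + minval x' \<le> t" using ext_ge[OF _ True] order_trans by blast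
    next
      assume "\<forall>x. arg x \<noteq> {} \<longrightarrow> x \<bullet> y + minval x \<le> t"
      then show "ext y \<le> t" using ne ext_eq[OF x] by simp
    qed
  qed simp
  show "convex {(y, t). y \<in> P \<and> ext y \<le> t}"
  proof (rule convexI)
    fix a b and u v :: real
    assume ab: "a \<in> {(y, t). y \<in> P \<and> ext y \<le> t}" "b \<in> {(y, t). y \<in> P \<and> ext y \<le> t}"
      and uv: "0 \<le> u" "0 \<le> v" "u + v = 1"
    obtain y1 t1 y2 t2 where eq: "a = (y1, t1)" "b = (y2, t2)" by force
    have 1: "y1 \<in> P" "\<And>x. arg x \<noteq> {} \<Longrightarrow> x \<bullet> y1 + minval x \<le> t1"
      and 2: "y2 \<in> P" "\<And>x. arg x \<noteq> {} \<Longrightarrow> x \<bullet> y2 + minval x \<le> t2"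
      using ab mem unfolding eq by auto
    have "u *\<^sub>R y1 + v *\<^sub>R y2 \<in> P" using P_props(2) 1 2 uv by (intro convexD)
    moreover have "x \<bullet> (u *\<^sub>R y1 + v *\<^sub>R y2) + minval x \<le> u * t1 + v * t2" if "arg x \<noteq> {}" for x
    proof -
      have "x \<bullet> (u *\<^sub>R y1 + v *\<^sub>R y2) + minval x = u * (x \<bullet> y1) + v * (x \<bullet> y2) + (u + v) * minval x"
        using uv by (simp add: inner_add_right)
      also have "\<dots> = u * (x \<bullet> y1 + minval x) + v * (x \<bullet> y2 + minval x)" by (simp add: algebra_simps)
      also have "\<dots> \<le> u * t1 + v * t2" using 1(2)[OF that] 2(2)[OF that] uv by (intro add_mono mult_left_mono)
      finally show ?thesis .
    qed
    ultimately show "u *\<^sub>R a + v *\<^sub>R b \<in> {(y, t). y \<in> P \<and> ext y \<le> t}" using mem by (simp add: eq)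
  qed
  fix Q :: "('a \<times> real) set" assume Q: "polytope Q"
  have "compact (fst ` Q)"
    using polytope_imp_compact[OF Q] by (intro compact_continuous_image continuous_intros) auto
  then have comp: "compact (P \<inter> fst ` Q)" using P_props(1) by (simp add: closed_Int_compact)
  define good where "good y \<delta> X \<longleftrightarrow> \<delta> > (0::real) \<and> finite X \<and> (\<forall>x\<in>X. arg x \<noteq> {}) \<and>
    (\<forall>y'. y' \<in> P \<longrightarrow> dist y' y < \<delta> \<longrightarrow> (\<exists>x\<in>X. ext y' = x \<bullet> y' + minval x))" for y X \<delta>
  have "\<exists>\<delta> X. good y \<delta> X" if "y \<in> P" for y
  proof -
    obtain \<delta> X where "\<delta> > 0" "finite X" "\<And>x. x \<in> X \<Longrightarrow> arg x \<noteq> {}"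
      "\<And>y'. y' \<in> P \<Longrightarrow> dist y' y < \<delta> \<Longrightarrow> \<exists>x\<in>X. ext y' = x \<bullet> y' + minval x"
      using \<open>y \<in> P\<close> by (rule ext_locally_finite) (rule that)
    then have "good y \<delta> X" by (simp add: good_def)
    then show ?thesis by blast
  qed
  then obtain \<delta> X where \<delta>X: "\<And>y. y \<in> P \<Longrightarrow> good y (\<delta> y) (X y)" by metis
  obtain C where C: "C \<subseteq> P \<inter> fst ` Q" "finite C" "P \<inter> fst ` Q \<subseteq> (\<Union>c\<in>C. ball c (\<delta> c))"
  proof (rule compactE_image[OF comp, of "P \<inter> fst ` Q" "\<lambda>c. ball c (\<delta> c)"])
    show "P \<inter> fst ` Q \<subseteq> (\<Union>c\<in>P \<inter> fst ` Q. ball c (\<delta> c))"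
      using \<delta>X by (force simp: good_def)
  qed (use that in auto)
  define XX where "XX = (\<Union>c\<in>C. X c)"
  have XX: "finite XX" "\<And>x. x \<in> XX \<Longrightarrow> arg x \<noteq> {}"
    using C(1,2) \<delta>X by (auto simp: XX_def good_def)
  have XXe: "\<exists>x\<in>XX. ext y = x \<bullet> y + minval x" if yPQ: "y \<in> P" "y \<in> fst ` Q" for y
  proof -
    have "y \<in> (\<Union>c\<in>C. ball c (\<delta> c))" using C(3) yPQ by blast
    then obtain c where c: "c \<in> C" "dist c y < \<delta> c" by auto
    have "good c (\<delta> c) (X c)" using \<delta>X c(1) C(1) by blast
    then have "\<exists>x\<in>X c. ext y = x \<bullet> y + minval x" using c(2) yPQ(1) by (simp add: good_def dist_commute)
    then show ?thesis using c(1) by (auto simp: XX_def)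
  qed
  obtain F where F: "finite F" "\<And>y. y \<in> P \<longleftrightarrow> (\<forall>(w, b)\<in>F. w \<bullet> y \<le> b)"
    by (rule P_halfspaces) (rule that)
  define H where "H = (\<lambda>(w, b). {z. (w, 0::real) \<bullet> z \<le> b}) ` F \<union> (\<lambda>x. {z. (x, -1::real) \<bullet> z \<le> - minval x}) ` XX"
  have "{(y, t). y \<in> P \<and> ext y \<le> t} \<inter> Q = \<Inter>H \<inter> Q"
  proof (intro set_eqI iffI)
    fix z assume z: "z \<in> {(y, t). y \<in> P \<and> ext y \<le> t} \<inter> Q"
    obtain y t where yt: "z = (y, t)" by force
    have y: "y \<in> P" "\<And>x. x \<in> XX \<Longrightarrow> x \<bullet> y + minval x \<le> t"
      using z mem[of y t] XX(2) by (auto simp: yt)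
    have "z \<in> h" if "h \<in> H" for h
      using that unfolding H_def
    proof
      assume "h \<in> (\<lambda>(w, b). {z. (w, 0::real) \<bullet> z \<le> b}) ` F"
      then show ?thesis using y(1) F(2)[of y] by (auto simp: yt)
    next
      assume "h \<in> (\<lambda>x. {z. (x, -1::real) \<bullet> z \<le> - minval x}) ` XX"
      then obtain x where "x \<in> XX" "h = {z. (x, -1::real) \<bullet> z \<le> - minval x}" by blast
      then show ?thesis using y(2)[of x] by (simp add: yt)
    qed
    then show "z \<in> \<Inter>H \<inter> Q" using z by blast
  next
    fix z assume z: "z \<in> \<Inter>H \<inter> Q"
    obtain y t where yt: "z = (y, t)" by force
    have "w \<bullet> y \<le> b" if "(w, b) \<in> F" for w b
    proof -
      have "{z. (w, 0::real) \<bullet> z \<le> b} \<in> H" unfolding H_def using that by (intro UnI1) (rule image_eqI[of _ _ "(w, b)"], auto)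
      then have "z \<in> {z. (w, 0::real) \<bullet> z \<le> b}" using z by blast
      then show ?thesis by (simp add: yt)
    qed
    then have yP: "y \<in> P" using F(2)[of y] by blast
    moreover have "y \<in> fst ` Q" using z by (force simp: yt)
    ultimately obtain x where x: "x \<in> XX" "ext y = x \<bullet> y + minval x" using XXe by blast
    have "{z. (x, -1::real) \<bullet> z \<le> - minval x} \<in> H" unfolding H_def using x(1) by (intro UnI2 imageI)
    then have "z \<in> {z. (x, -1::real) \<bullet> z \<le> - minval x}" using z by blast
    then have "x \<bullet> y - t \<le> - minval x" by (simp add: yt)
    then show "z \<in> {(y, t). y \<in> P \<and> ext y \<le> t} \<inter> Q" using z x(2) yP by (simp add: yt)
  qed
  moreover have "polyhedron (\<Inter>H)"
    unfolding H_def using F(1) XX(1) by (intro polyhedron_Inter) (auto simp: polyhedron_halfspace_le)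
  ultimately show "polytope ({(y, t). y \<in> P \<and> ext y \<le> t} \<inter> Q)"
    using Q by (simp add: polyhedron_Int_polytope)
qed

theorem mfun_ext: "mfun R P ext"
  unfolding mfun_def
proof (intro conjI allI impI)
  show "P \<noteq> {}" using P by (auto simp: mpoly_def)
  show "mpoly R (argmin_on P ext x)" if "argmin_on P ext x \<noteq> {}" for x
    using argmin_ext[OF that] mpoly_arg by simp
qed (rule locally_polyhedral_ext)

end

section \<open>Local structure of M-convex functions\<close>

text \<open>The polytope \<open>Q\<close> is a window in which the epigraph is a polyhedron, so
  \<open>polyhedron_lower_supports\<close> provides finitely many slopes. A support valid near
  \<open>(y, H y)\<close> is valid on all of \<open>P\<close> by convexity.\<close>

lemma convex_on_subgradients:
  fixes P :: "'a::euclidean_space set" and H :: "'a \<Rightarrow> real"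
  assumes epi: "locally_polyhedral {(y, t). y \<in> P \<and> H y \<le> t}" (is "locally_polyhedral ?epi")
    and Q: "polytope Q"
  shows "\<exists>X. finite X \<and> (\<forall>y\<in>P. (y, H y) \<in> interior Q \<longrightarrow> (\<exists>x\<in>X. \<forall>y'\<in>P. H y + x \<bullet> (y' - y) \<le> H y'))"
proof -
  have conv: "convex ?epi" and "polytope (?epi \<inter> Q)"
    using epi Q unfolding locally_polyhedral_def by blast+
  then have "polyhedron (?epi \<inter> Q)" by (simp add: polytope_imp_polyhedron)
  from polyhedron_lower_supports[OF this] obtain X where X: "finite X"
    "\<forall>m t0 \<delta>. (m, t0) \<in> ?epi \<inter> Q \<longrightarrow> \<delta> > 0 \<longrightarrow> (\<forall>t. t0 - \<delta> < t \<and> t < t0 \<longrightarrow> (m, t) \<notin> ?epi \<inter> Q) \<longrightarrow>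
           (\<exists>x\<in>X. \<forall>y t. (y, t) \<in> ?epi \<inter> Q \<longrightarrow> t \<ge> t0 + x \<bullet> (y - m))" by (elim exE conjE)
  show ?thesis
  proof (intro exI[of _ X] conjI X(1) ballI impI)
    fix y assume y: "y \<in> P" "(y, H y) \<in> interior Q"
    then obtain e where e: "e > 0" "ball (y, H y) e \<subseteq> Q" by (meson mem_interior)
    have "(y, H y) \<in> ?epi \<inter> Q" using y interior_subset by auto
    moreover have "\<forall>t. H y - 1 < t \<and> t < H y \<longrightarrow> (y, t) \<notin> ?epi \<inter> Q" by auto
    ultimately have "\<exists>x\<in>X. \<forall>y' t. (y', t) \<in> ?epi \<inter> Q \<longrightarrow> t \<ge> H y + x \<bullet> (y' - y)"
      using X(2)[rule_format, of y "H y" 1] by simp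
    then obtain x where x: "x \<in> X" "\<And>y' t. (y', t) \<in> ?epi \<inter> Q \<Longrightarrow> t \<ge> H y + x \<bullet> (y' - y)" by blast
    show "\<exists>x\<in>X. \<forall>y'\<in>P. H y + x \<bullet> (y' - y) \<le> H y'"
    proof (intro bexI[OF _ x(1)] ballI)
      fix y' assume y': "y' \<in> P"
      define N where "N = norm (y' - y, H y' - H y)"
      \<comment> \<open>Small enough for the convex combination of the two graph points to stay in
        the ball inside \<open>Q\<close>.\<close>
      define \<tau> where "\<tau> = min 1 (e / (1 + N))"
      have N: "N \<ge> 0" by (simp add: N_def)
      have \<tau>: "0 < \<tau>" "\<tau> \<le> 1" using e(1) N by (auto simp: \<tau>_def)
      have "\<tau> * N \<le> e / (1 + N) * N" using N by (intro mult_right_mono) (auto simp: \<tau>_def)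
      also have "\<dots> < e" using e(1) N by (simp add: divide_simps)
      finally have small: "\<tau> * N < e" .
      define z where "z = (1 - \<tau>) *\<^sub>R (y, H y) + \<tau> *\<^sub>R (y', H y')"
      have "z \<in> ?epi" unfolding z_def using y(1) y' \<tau> by (intro convexD[OF conv]) auto
      moreover have "z \<in> Q"
      proof -
        have "z - (y, H y) = \<tau> *\<^sub>R (y' - y, H y' - H y)" by (simp add: z_def algebra_simps)
        then have "dist z (y, H y) = \<tau> * N" using \<tau>(1) by (simp only: dist_norm N_def norm_scaleR abs_of_pos)
        then have "dist (y, H y) z = \<tau> * N" by (simp only: dist_commute)
        then show ?thesis using small e(2) by auto
      qed
      moreover have "z = (y + \<tau> *\<^sub>R (y' - y), (1 - \<tau>) * H y + \<tau> * H y')" by (simp add: z_def algebra_simps)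
      ultimately have "(1 - \<tau>) * H y + \<tau> * H y' \<ge> H y + x \<bullet> ((y + \<tau> *\<^sub>R (y' - y)) - y)"
        using x(2)[of "y + \<tau> *\<^sub>R (y' - y)" "(1 - \<tau>) * H y + \<tau> * H y'"] by simp
      then have "\<tau> * (H y + x \<bullet> (y' - y)) \<le> \<tau> * H y'" by (simp add: algebra_simps)
      then show "H y + x \<bullet> (y' - y) \<le> H y'" using \<tau>(1) by simp
    qed
  qed
qed

lemma polytope_neighbourhood:
  fixes c :: "'a::euclidean_space"
  obtains Q where "polytope Q" "c \<in> interior Q"
proof -
  have "c \<in> box (c - One) (c + One)" by (simp add: mem_box inner_diff_left inner_add_left)
  then show ?thesis using that[of "cbox (c - One) (c + One)"]
    by (simp add: interior_cbox polytope_eq_bounded_polyhedron)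
qed

section \<open>Cells and domain of an M-convex function\<close>

locale lattice_mfun = root_vectors R for R :: "'a::euclidean_space set" +
  fixes P :: "'a set" and H :: "'a \<Rightarrow> real"
  assumes M: "mfun R P H"
begin

lemma epi: "locally_polyhedral {(y, t). y \<in> P \<and> H y \<le> t}" and P_ne: "P \<noteq> {}"
  using M by (auto simp: mfun_def)

lemma epi_convex: "convex {(y, t). y \<in> P \<and> H y \<le> t}"
  using epi by (simp add: locally_polyhedral_def)

lemma combination:
  assumes "p \<in> P" "q \<in> P" "0 \<le> \<tau>" "\<tau> \<le> 1"
  shows "p + \<tau> *\<^sub>R (q - p) \<in> P" "H (p + \<tau> *\<^sub>R (q - p)) \<le> (1 - \<tau>) * H p + \<tau> * H q"
proof -
  have "(1 - \<tau>) *\<^sub>R (p, H p) + \<tau> *\<^sub>R (q, H q) \<in> {(y, t). y \<in> P \<and> H y \<le> t}"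
    using assms by (intro convexD[OF epi_convex]) auto
  moreover have "(1 - \<tau>) *\<^sub>R (p, H p) + \<tau> *\<^sub>R (q, H q) = (p + \<tau> *\<^sub>R (q - p), (1 - \<tau>) * H p + \<tau> * H q)"
    by (simp add: algebra_simps)
  ultimately show "p + \<tau> *\<^sub>R (q - p) \<in> P" "H (p + \<tau> *\<^sub>R (q - p)) \<le> (1 - \<tau>) * H p + \<tau> * H q"
    by auto
qed

lemma argmin_iff: "p \<in> argmin_on P H x \<longleftrightarrow> p \<in> P \<and> (\<forall>q\<in>P. H p + x \<bullet> (q - p) \<le> H q)"
  by (auto simp: argmin_on_def inner_diff_right algebra_simps)

lemma argmin_mpoly: "p \<in> argmin_on P H x \<Longrightarrow> mpoly R (argmin_on P H x)"
  using M unfolding mfun_def by blast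

lemma argmin_exists:
  assumes "p \<in> P"
  obtains x where "p \<in> argmin_on P H x"
proof -
  obtain Q where Q: "polytope Q" "(p, H p) \<in> interior Q" by (rule polytope_neighbourhood)
  from convex_on_subgradients[OF epi Q(1)] show ?thesis
    using assms Q(2) that argmin_iff by blast
qed

text \<open>Near \<open>p\<close> there are only finitely many subgradients to choose from, so one of them serves
  infinitely many of the points \<open>p + (q - p) / (n + 1)\<close>, and hence \<open>p\<close> itself.\<close>

lemma argmin_initial_segment:
  assumes p: "p \<in> P" and q: "q \<in> P"
  obtains x \<epsilon> where "\<epsilon> > 0" "p \<in> argmin_on P H x" "p + \<epsilon> *\<^sub>R (q - p) \<in> argmin_on P H x"
proof -
  obtain Q where Q: "polytope Q" "(p, H p) \<in> interior Q" by (rule polytope_neighbourhood)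
  obtain X where X: "finite X" "\<forall>y\<in>P. (y, H y) \<in> interior Q \<longrightarrow> (\<exists>x\<in>X. \<forall>y'\<in>P. H y + x \<bullet> (y' - y) \<le> H y')"
    using convex_on_subgradients[OF epi Q(1)] by (elim exE conjE)
  define \<epsilon> where "\<epsilon> n = inverse (real (Suc n))" for n
  define m where "m n = p + \<epsilon> n *\<^sub>R (q - p)" for n
  have \<epsilon>: "0 < \<epsilon> n" "\<epsilon> n \<le> 1" for n by (auto simp: \<epsilon>_def inverse_le_1_iff)
  have \<epsilon>lim: "\<epsilon> \<longlonglongrightarrow> 0" unfolding \<epsilon>_def by (rule LIMSEQ_inverse_real_of_nat)
  have mP: "m n \<in> P" for n unfolding m_def using combination(1)[OF p q] \<epsilon>[of n] by simp
  obtain x0 where x0: "p \<in> argmin_on P H x0" using p by (rule argmin_exists)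
  have "(\<lambda>n. p + \<epsilon> n *\<^sub>R (q - p)) \<longlonglongrightarrow> p + 0 *\<^sub>R (q - p)" by (intro tendsto_intros \<epsilon>lim)
  then have mlim: "m \<longlonglongrightarrow> p" by (simp add: m_def[abs_def])
  \<comment> \<open>Continuity along the segment: a subgradient at \<open>p\<close> bounds the
    values from below, convexity bounds them from above.\<close>
  have Hlim: "(\<lambda>n. H (m n)) \<longlonglongrightarrow> H p"
  proof (rule tendsto_sandwich)
    have "(\<lambda>n. H p + \<epsilon> n * (x0 \<bullet> (q - p))) \<longlonglongrightarrow> H p + 0 * (x0 \<bullet> (q - p))" by (intro tendsto_intros \<epsilon>lim)
    then show "(\<lambda>n. H p + \<epsilon> n * (x0 \<bullet> (q - p))) \<longlonglongrightarrow> H p" by simp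
    have "(\<lambda>n. (1 - \<epsilon> n) * H p + \<epsilon> n * H q) \<longlonglongrightarrow> (1 - 0) * H p + 0 * H q" by (intro tendsto_intros \<epsilon>lim)
    then show "(\<lambda>n. (1 - \<epsilon> n) * H p + \<epsilon> n * H q) \<longlonglongrightarrow> H p" by simp
    show "eventually (\<lambda>n. H p + \<epsilon> n * (x0 \<bullet> (q - p)) \<le> H (m n)) sequentially"
    proof (intro always_eventually allI)
      fix n
      have "H p + x0 \<bullet> (m n - p) \<le> H (m n)" using x0 mP argmin_iff by blast
      then show "H p + \<epsilon> n * (x0 \<bullet> (q - p)) \<le> H (m n)" by (simp add: m_def)
    qed
    show "eventually (\<lambda>n. H (m n) \<le> (1 - \<epsilon> n) * H p + \<epsilon> n * H q) sequentially"
      using combination(2)[OF p q] \<epsilon> by (intro always_eventually allI) (simp add: m_def less_imp_le)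
  qed
  have "eventually (\<lambda>n. (m n, H (m n)) \<in> interior Q) sequentially"
    using tendsto_Pair[OF mlim Hlim] Q(2) by (rule topological_tendstoD[OF _ open_interior])
  then obtain n0 where n0: "\<And>n. n \<ge> n0 \<Longrightarrow> (m n, H (m n)) \<in> interior Q"
    unfolding eventually_sequentially by blast
  have "\<forall>n. \<exists>x\<in>X. n \<ge> n0 \<longrightarrow> m n \<in> argmin_on P H x"
  proof
    fix n
    show "\<exists>x\<in>X. n \<ge> n0 \<longrightarrow> m n \<in> argmin_on P H x"
    proof (cases "n \<ge> n0")
      case True
      then show ?thesis using X(2) mP[of n] n0[OF True] argmin_iff by blast
    next
      case False
      have "X \<noteq> {}" using X(2) mP[of n0] n0[of n0] by blast
      then show ?thesis using False by blast
    qed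
  qed
  then obtain f where f: "\<And>n. f n \<in> X" "\<And>n. n \<ge> n0 \<Longrightarrow> m n \<in> argmin_on P H (f n)" by metis
  have "finite (f ` UNIV)" using X(1) f(1) by (meson finite_subset image_subsetI)
  then obtain k where k: "infinite {n. f n = f k}"
    using pigeonhole_infinite[of UNIV f] by auto
  define x where "x = f k"
  have inf: "\<exists>n\<ge>N. m n \<in> argmin_on P H x" for N
  proof -
    obtain n where "n \<ge> max N n0" "n \<in> {n. f n = f k}"
      using k unfolding infinite_nat_iff_unbounded_le by blast
    then show ?thesis using f(2)[of n] by (auto simp: x_def)
  qed
  have "p \<in> argmin_on P H x"
    unfolding argmin_iff
  proof (intro conjI p ballI)
    fix y assume y: "y \<in> P"
    show "H p + x \<bullet> (y - p) \<le> H y"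
    proof (rule ccontr)
      assume "\<not> ?thesis"
      then have "H y < H p + x \<bullet> (y - p)" by simp
      moreover have "(\<lambda>n. H (m n) + x \<bullet> (y - m n)) \<longlonglongrightarrow> H p + x \<bullet> (y - p)"
        by (intro tendsto_intros mlim Hlim)
      ultimately have "eventually (\<lambda>n. H y < H (m n) + x \<bullet> (y - m n)) sequentially"
        using order_tendstoD(1) by blast
      then obtain N where N: "\<And>n. n \<ge> N \<Longrightarrow> H y < H (m n) + x \<bullet> (y - m n)"
        unfolding eventually_sequentially by blast
      obtain n where n: "n \<ge> N" "m n \<in> argmin_on P H x" using inf by blast
      have "H (m n) + x \<bullet> (y - m n) \<le> H y" using n(2) y argmin_iff by blast
      then show False using N[OF n(1)] by simp
    qed
  qed
  moreover obtain n where "m n \<in> argmin_on P H x" using inf by blast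
  ultimately show ?thesis using that[of "\<epsilon> n" x] \<epsilon>(1) by (simp add: m_def)
qed

lemma argmin_subset: "argmin_on P H x \<subseteq> P" by (auto simp: argmin_on_def)

text \<open>Every point of \<open>P\<close> lies in a cell. The neighbourhoods from
  \<open>mpoly_near\<close> do not depend on the cell, which gives closedness; the hull property is
  inherited from the cells; and each direction \<open>q - p\<close> enters a cell, whose tangent
  cone is generated by feasible roots.\<close>

theorem mpoly_domain: "mpoly R P"
  unfolding mpoly_def
proof (intro conjI ballI P_ne)
  show conv: "convex P"
  proof (rule convexI)
    fix p q and u v :: real assume "p \<in> P" "q \<in> P" and uv: "0 \<le> u" "0 \<le> v" "u + v = 1"
    then have "p + v *\<^sub>R (q - p) \<in> P" by (intro combination) auto
    moreover have "p + v *\<^sub>R (q - p) = u *\<^sub>R p + v *\<^sub>R q" using uv(3) by (simp add: algebra_simps flip: scaleR_left_distrib)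
    ultimately show "u *\<^sub>R p + v *\<^sub>R q \<in> P" by simp
  qed
  show "closed P"
  proof -
    have "y \<in> P" if y: "y \<in> closure P" for y
    proof -
      obtain \<epsilon> where \<epsilon>: "\<epsilon> > 0" "\<And>C z. mpoly R C \<Longrightarrow> z \<in> C \<Longrightarrow> dist z y < \<epsilon> \<Longrightarrow> y \<in> C"
        using mpoly_near[of y] by blast
      obtain z where z: "z \<in> P" "dist z y < \<epsilon>" using y \<epsilon>(1) unfolding closure_approachable by blast
      obtain x where x: "z \<in> argmin_on P H x" using z(1) by (rule argmin_exists)
      have "y \<in> argmin_on P H x" by (rule \<epsilon>(2)[OF argmin_mpoly[OF x] x z(2)])
      then show ?thesis using argmin_subset by blast
    qed
    then have "closure P \<subseteq> P" by blast
    then show ?thesis by (simp only: closure_subset_eq)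
  qed
  show "P = convex hull (P \<inter> lat R)"
  proof
    show "convex hull (P \<inter> lat R) \<subseteq> P" using conv by (intro hull_minimal) auto
    show "P \<subseteq> convex hull (P \<inter> lat R)"
    proof
      fix y assume "y \<in> P"
      then obtain x where x: "y \<in> argmin_on P H x" by (rule argmin_exists)
      then have "y \<in> convex hull (argmin_on P H x \<inter> lat R)" using argmin_mpoly[OF x] unfolding mpoly_def by blast
      moreover have "convex hull (argmin_on P H x \<inter> lat R) \<subseteq> convex hull (P \<inter> lat R)"
        using argmin_subset by (intro hull_mono) blast
      ultimately show "y \<in> convex hull (P \<inter> lat R)" by blast
    qed
  qed
  fix p assume p: "p \<in> P"
  define R' where "R' = {\<alpha>\<in>R. \<exists>t>0. p + t *\<^sub>R \<alpha> \<in> P}"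
  have fin: "finite R'" using finR by (simp add: R'_def)
  have "tcone P p \<subseteq> convex_cone hull R'"
    unfolding tcone_def
  proof (rule closure_minimal[OF hull_minimal])
    show "(\<lambda>q. q - p) ` P \<subseteq> convex_cone hull R'"
    proof
      fix d assume "d \<in> (\<lambda>q. q - p) ` P"
      then obtain q where q: "q \<in> P" "d = q - p" by blast
      obtain x \<epsilon> where x: "\<epsilon> > 0" "p \<in> argmin_on P H x" "p + \<epsilon> *\<^sub>R (q - p) \<in> argmin_on P H x"
        using p q(1) by (rule argmin_initial_segment) (rule that)
      let ?A = "argmin_on P H x"
      have A: "mpoly R ?A" by (rule argmin_mpoly[OF x(2)])
      obtain R'' where R'': "R'' \<subseteq> R" "tcone ?A p = convex_cone hull R''" using A x(2) unfolding mpoly_def by blast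
      have "\<epsilon> *\<^sub>R d \<in> tcone ?A p" using tcone_mem[OF x(3), of p] q(2) by simp
      then have "\<epsilon> *\<^sub>R d \<in> convex_cone hull R'"
        unfolding R''(2)
      proof (rule convex_cone_hull_mono_mem)
        fix \<alpha> assume \<alpha>: "\<alpha> \<in> R''"
        then have "\<alpha> \<in> tcone ?A p" unfolding R''(2) by (rule hull_inc)
        then obtain t where "t > 0" "p + t *\<^sub>R \<alpha> \<in> ?A" using mpoly_feasible_direction[OF A x(2)] by blast
        then have "\<alpha> \<in> R'" using \<alpha> R''(1) argmin_subset by (auto simp: R'_def)
        then show "\<alpha> \<in> convex_cone hull R'" by (rule hull_inc)
      qed
      then have "(1 / \<epsilon>) *\<^sub>R (\<epsilon> *\<^sub>R d) \<in> convex_cone hull R'" by (rule convex_cone_hull_mul) (use x(1) in simp)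
      moreover have "(1 / \<epsilon>) *\<^sub>R (\<epsilon> *\<^sub>R d) = d" using x(1) by simp
      ultimately show "d \<in> convex_cone hull R'" by (simp only:)
    qed
  qed (simp_all add: convex_cone_convex_cone_hull closed_convex_cone_hull fin)
  moreover have "convex_cone hull R' \<subseteq> tcone P p"
  proof -
    have "convex_cone hull R' \<subseteq> convex_cone hull ((\<lambda>q. q - p) ` P)"
    proof (rule hull_minimal)
      show "R' \<subseteq> convex_cone hull ((\<lambda>q. q - p) ` P)"
      proof
        fix \<alpha> assume "\<alpha> \<in> R'"
        then obtain t where t: "t > 0" "p + t *\<^sub>R \<alpha> \<in> P" by (auto simp: R'_def)
        then have "t *\<^sub>R \<alpha> \<in> (\<lambda>q. q - p) ` P" by (force simp: image_iff)
        then have "(1 / t) *\<^sub>R (t *\<^sub>R \<alpha>) \<in> convex_cone hull ((\<lambda>q. q - p) ` P)"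
          using t(1) by (intro convex_cone_hull_mul hull_inc) auto
        then show "\<alpha> \<in> convex_cone hull ((\<lambda>q. q - p) ` P)" using t(1) by simp
      qed
    qed (simp add: convex_cone_convex_cone_hull)
    then show ?thesis unfolding tcone_def using closure_subset by blast
  qed
  ultimately have "tcone P p = convex_cone hull R'" by blast
  then show "\<exists>R'\<subseteq>R. tcone P p = convex_cone hull R'" by (intro exI[of _ R']) (auto simp: R'_def)
qed

lemma local_subgradient:
  assumes "p \<in> P \<inter> lat R"
  shows "\<exists>x. \<forall>\<alpha>\<in>steps R (P \<inter> lat R) p. x \<bullet> \<alpha> \<le> H (p + \<alpha>) - H p"
proof -
  obtain x where x: "p \<in> argmin_on P H x" using assms by (auto intro: argmin_exists)
  have "x \<bullet> \<alpha> \<le> H (p + \<alpha>) - H p" if "\<alpha> \<in> steps R (P \<inter> lat R) p" for \<alpha>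
  proof -
    have "H p + x \<bullet> ((p + \<alpha>) - p) \<le> H (p + \<alpha>)" using x that unfolding argmin_iff steps_def by blast
    then show ?thesis by simp
  qed
  then show ?thesis by blast
qed

text \<open>All steps into the cell that contains the initial segment cost exactly their
  \<open>x\<close>-value, so the weighted cost of \<open>q - p\<close> is
  \<open>x \<bullet> (q - p)\<close>, which the subgradient inequality bounds by
  \<open>H q - H p\<close>.\<close>

lemma local_growth:
  assumes p: "p \<in> P \<inter> lat R" and q: "q \<in> P \<inter> lat R"
  defines "S \<equiv> steps R (P \<inter> lat R) p"
  shows "\<exists>\<mu>. (\<forall>\<alpha>\<in>S. \<mu> \<alpha> \<ge> 0) \<and> q - p = (\<Sum>\<alpha>\<in>S. \<mu> \<alpha> *\<^sub>R \<alpha>) \<and> H q \<ge> H p + (\<Sum>\<alpha>\<in>S. \<mu> \<alpha> * (H (p + \<alpha>) - H p))"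
proof -
  have pq: "p \<in> P" "q \<in> P" using p q by auto
  obtain x \<epsilon> where x: "\<epsilon> > 0" "p \<in> argmin_on P H x" "p + \<epsilon> *\<^sub>R (q - p) \<in> argmin_on P H x"
    using pq by (rule argmin_initial_segment) (rule that)
  let ?A = "argmin_on P H x"
  define T where "T = {\<beta>\<in>R. p + \<beta> \<in> ?A}"
  have T: "finite T" using finR by (simp add: T_def)
  have "\<epsilon> *\<^sub>R (q - p) \<in> tcone ?A p" using tcone_mem[OF x(3), of p] by simp
  then have "\<epsilon> *\<^sub>R (q - p) \<in> convex_cone hull T"
    unfolding T_def using tcone_lattice_point[OF argmin_mpoly[OF x(2)] x(2)] p by blast
  then have "(1 / \<epsilon>) *\<^sub>R (\<epsilon> *\<^sub>R (q - p)) \<in> convex_cone hull T" by (rule convex_cone_hull_mul) (use x(1) in simp)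
  moreover have "(1 / \<epsilon>) *\<^sub>R (\<epsilon> *\<^sub>R (q - p)) = q - p" using x(1) by simp
  ultimately have "q - p \<in> convex_cone hull T" by (simp only:)
  then obtain \<nu> where \<nu>: "q - p = (\<Sum>\<alpha>\<in>T. \<nu> \<alpha> *\<^sub>R \<alpha>)" "\<forall>\<alpha>\<in>T. \<nu> \<alpha> \<ge> 0"
    unfolding convex_cone_hull_finite[OF T] by blast
  have TS: "T \<subseteq> S"
  proof
    fix \<beta> assume "\<beta> \<in> T"
    then have \<beta>: "\<beta> \<in> R" "p + \<beta> \<in> P" using argmin_subset by (auto simp: T_def)
    moreover have "p + \<beta> \<in> lat R" using p \<beta>(1) lat_root[OF finR] by (intro lat_add) auto
    ultimately show "\<beta> \<in> S" by (simp add: S_def steps_def)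
  qed
  have finS: "finite S" using finite_steps by (simp add: S_def)
  define \<mu> where "\<mu> \<alpha> = (if \<alpha> \<in> T then \<nu> \<alpha> else 0)" for \<alpha>
  have sums: "(\<Sum>\<alpha>\<in>S. \<mu> \<alpha> *\<^sub>R \<alpha>) = (\<Sum>\<alpha>\<in>T. \<nu> \<alpha> *\<^sub>R \<alpha>)"
    "(\<Sum>\<alpha>\<in>S. \<mu> \<alpha> * (H (p + \<alpha>) - H p)) = (\<Sum>\<alpha>\<in>T. \<nu> \<alpha> * (H (p + \<alpha>) - H p))"
    by (rule sum.mono_neutral_cong_right[OF finS TS]; simp add: \<mu>_def)+
  have val: "H (p + \<alpha>) - H p = x \<bullet> \<alpha>" if "\<alpha> \<in> T" for \<alpha>
  proof -
    have "p + \<alpha> \<in> ?A" using that by (simp add: T_def)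
    then have "H p - x \<bullet> p = H (p + \<alpha>) - x \<bullet> (p + \<alpha>)"
      using x(2) unfolding argmin_on_def by (auto intro: order_antisym)
    then show ?thesis by (simp add: inner_add_right)
  qed
  have "(\<Sum>\<alpha>\<in>T. \<nu> \<alpha> * (H (p + \<alpha>) - H p)) = x \<bullet> (q - p)"
    unfolding \<nu>(1) inner_sum_right by (intro sum.cong) (simp_all add: val)
  moreover have "H p + x \<bullet> (q - p) \<le> H q" using x(2) q unfolding argmin_iff by blast
  ultimately show ?thesis using \<nu> sums by (intro exI[of _ \<mu>]) (auto simp: \<mu>_def)
qed

end

context root_vectors
begin

text \<open>The whole equivalence in \<open>V\<close> and in real numbers: infinite values are
  encoded by \<open>D\<close>, and the infimum over conical combinations is replaced by attained
  coefficients.\<close>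

theorem mfun_lattice_iff:
  "(\<exists>P H. mfun R P H \<and> P \<inter> lat R = D \<and> (\<forall>p\<in>D. H p = G p)) \<longleftrightarrow>
   (\<exists>P. mpoly R P \<and> D = P \<inter> lat R) \<and>
   (\<forall>p\<in>D. \<exists>x. \<forall>\<alpha>\<in>steps R D p. x \<bullet> \<alpha> \<le> G (p + \<alpha>) - G p) \<and>
   (\<forall>p\<in>D. \<forall>q\<in>D. \<exists>\<mu>. (\<forall>\<alpha>\<in>steps R D p. \<mu> \<alpha> \<ge> 0) \<and>
      q - p = (\<Sum>\<alpha>\<in>steps R D p. \<mu> \<alpha> *\<^sub>R \<alpha>) \<and>
      G q \<ge> G p + (\<Sum>\<alpha>\<in>steps R D p. \<mu> \<alpha> * (G (p + \<alpha>) - G p)))"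
  (is "?L \<longleftrightarrow> ?R1 \<and> ?R2 \<and> ?R3")
proof
  assume ?L
  then obtain P H where PH: "mfun R P H" "P \<inter> lat R = D" "\<forall>p\<in>D. H p = G p" by blast
  interpret lattice_mfun R P H by unfold_locales (rule PH(1))
  have HG: "H (p + \<alpha>) = G (p + \<alpha>)" if "\<alpha> \<in> steps R D p" for \<alpha> p using that PH(3) by (simp add: steps_def)
  have ?R1 using mpoly_domain PH(2) by blast
  moreover have ?R2
  proof
    fix p assume p: "p \<in> D"
    from local_subgradient[unfolded PH(2), OF p]
    show "\<exists>x. \<forall>\<alpha>\<in>steps R D p. x \<bullet> \<alpha> \<le> G (p + \<alpha>) - G p" using HG PH(3) p by simp
  qed
  moreover have ?R3
  proof (intro ballI)
    fix p q assume pq: "p \<in> D" "q \<in> D"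
    from local_growth[unfolded PH(2), OF pq]
    show "\<exists>\<mu>. (\<forall>\<alpha>\<in>steps R D p. \<mu> \<alpha> \<ge> 0) \<and> q - p = (\<Sum>\<alpha>\<in>steps R D p. \<mu> \<alpha> *\<^sub>R \<alpha>) \<and>
      G q \<ge> G p + (\<Sum>\<alpha>\<in>steps R D p. \<mu> \<alpha> * (G (p + \<alpha>) - G p))"
      using HG PH(3) pq by (simp cong: sum.cong)
  qed
  ultimately show "?R1 \<and> ?R2 \<and> ?R3" by blast
next
  assume R: "?R1 \<and> ?R2 \<and> ?R3"
  then obtain P where PD: "mpoly R P" "D = P \<inter> lat R" by blast
  interpret local_conditions R P D G
    by unfold_locales (use R PD in blast)+
  show ?L using mfun_ext ext_D PD(2) by blast
qed

end

section \<open>Classical root systems\<close>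

lemma linear_riesz: "linear (riesz :: 'v::euclidean_space dual \<Rightarrow> 'v)"
proof (rule linearI)
  show "riesz (p + q) = riesz p + riesz q" for p q :: "'v dual"
    by (rule vector_eq_rdot[THEN iffD1]) (simp add: riesz_inner inner_add_left plus_blinfun.rep_eq)
  show "riesz (c *\<^sub>R p) = c *\<^sub>R riesz p" for c and p :: "'v dual"
    by (rule vector_eq_rdot[THEN iffD1]) (simp add: riesz_inner scaleR_blinfun.rep_eq)
qed

lemmas riesz_add = linear_add[OF linear_riesz]
  and riesz_diff = linear_diff[OF linear_riesz]
  and riesz_scaleR = linear_scale[OF linear_riesz]
  and riesz_neg = linear_neg[OF linear_riesz]
  and riesz_0 = linear_0[OF linear_riesz]
  and riesz_sum = linear_sum[OF linear_riesz]

lemma inj_riesz: "inj (riesz :: 'v::euclidean_space dual \<Rightarrow> 'v)"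
proof (rule injI)
  fix p q :: "'v dual" assume "riesz p = riesz q"
  then have "norm (p - q) = 0" by (simp add: norm_riesz[symmetric] riesz_diff)
  then show "p = q" by simp
qed

lemma riesz_blinfun_inner: "riesz (blinfun_inner_right v) = v"
  by (rule vector_eq_rdot[THEN iffD1]) (simp add: riesz_inner)

lemma blinfun_inner_riesz: "blinfun_inner_right (riesz p) = p"
  using riesz_blinfun_inner inj_riesz by (metis injD)

lemma surj_riesz: "surj riesz"
  by (metis riesz_blinfun_inner surjI)

lemma lat_riesz: "lat (riesz ` \<Phi>) = riesz ` root_lattice \<Phi>"
proof -
  have inj: "inj_on riesz \<Phi>" using inj_riesz by (rule inj_on_subset) simp
  have *: "(\<Sum>\<alpha>\<in>riesz ` \<Phi>. of_int (c \<alpha>) *\<^sub>R \<alpha>) = riesz (\<Sum>\<alpha>\<in>\<Phi>. of_int (c (riesz \<alpha>)) *\<^sub>R \<alpha>)" for c :: "_ \<Rightarrow> int"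
    by (simp add: sum.reindex[OF inj] riesz_sum riesz_scaleR o_def)
  show ?thesis
  proof (intro set_eqI iffI)
    fix x assume "x \<in> lat (riesz ` \<Phi>)"
    then obtain c :: "_ \<Rightarrow> int" where "x = (\<Sum>\<alpha>\<in>riesz ` \<Phi>. of_int (c \<alpha>) *\<^sub>R \<alpha>)" unfolding lat_def by blast
    then have "x = riesz (\<Sum>\<alpha>\<in>\<Phi>. of_int (c (riesz \<alpha>)) *\<^sub>R \<alpha>)" by (simp only: *)
    moreover have "(\<Sum>\<alpha>\<in>\<Phi>. of_int (c (riesz \<alpha>)) *\<^sub>R \<alpha>) \<in> root_lattice \<Phi>"
      unfolding root_lattice_def by (rule CollectI, rule exI[of _ "\<lambda>\<alpha>. c (riesz \<alpha>)"]) simp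
    ultimately show "x \<in> riesz ` root_lattice \<Phi>" by (rule image_eqI)
  next
    fix x assume "x \<in> riesz ` root_lattice \<Phi>"
    then obtain c :: "_ \<Rightarrow> int" where c: "x = riesz (\<Sum>\<alpha>\<in>\<Phi>. of_int (c \<alpha>) *\<^sub>R \<alpha>)" unfolding root_lattice_def by blast
    have "x = (\<Sum>\<alpha>\<in>riesz ` \<Phi>. of_int (c (blinfun_inner_right \<alpha>)) *\<^sub>R \<alpha>)"
      unfolding * c by (simp add: blinfun_inner_riesz)
    then show "x \<in> lat (riesz ` \<Phi>)"
      unfolding lat_def by (intro CollectI exI[of _ "\<lambda>\<alpha>. c (blinfun_inner_right \<alpha>)"]) simp
  qed
qed

lemma coroot_eq: "blinfun_apply p (coroot \<beta>) = 2 * (riesz p \<bullet> riesz \<beta>) / (norm \<beta>)\<^sup>2"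
  by (simp add: coroot_def riesz_inner[symmetric] blinfun.scaleR_right)

text \<open>Take a smallest subset containing \<alpha> that is orthogonal to its complement. It is
  irreducible, because in a decomposition the summand containing \<alpha> would be a smaller such
  subset.\<close>

lemma irreducible_component_exists:
  assumes \<Phi>: "root_system \<Phi>" and \<alpha>: "\<alpha> \<in> \<Phi>"
  obtains \<Psi> where "irreducible_component \<Phi> \<Psi>" "\<alpha> \<in> \<Psi>"
proof -
  have rs: "finite \<Phi>" "0 \<notin> \<Phi>" "\<And>\<alpha> \<beta>. \<alpha> \<in> \<Phi> \<Longrightarrow> \<beta> \<in> \<Phi> \<Longrightarrow> reflection \<alpha> \<beta> \<in> \<Phi>"
    "\<And>\<alpha>. \<alpha> \<in> \<Phi> \<Longrightarrow> range (\<lambda>c. c *\<^sub>R \<alpha>) \<inter> \<Phi> = {\<alpha>, - \<alpha>}"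
    "\<And>\<alpha> \<beta>. \<alpha> \<in> \<Phi> \<Longrightarrow> \<beta> \<in> \<Phi> \<Longrightarrow> blinfun_apply \<alpha> (coroot \<beta>) \<in> \<int>"
    using \<Phi> unfolding root_system_def by blast+
  have pos: "riesz \<beta> \<bullet> riesz \<beta> > 0" if "\<beta> \<in> \<Phi>" for \<beta>
    using that rs(2) inj_riesz riesz_0 by (metis injD inner_gt_zero_iff)
  define ok where "ok S \<longleftrightarrow> \<alpha> \<in> S \<and> S \<subseteq> \<Phi> \<and> mutually_orthogonal S (\<Phi> - S)" for S
  have "ok \<Phi>" using \<alpha> by (simp add: ok_def mutually_orthogonal_def)
  then obtain \<Psi> where \<Psi>: "ok \<Psi>" and min: "\<And>S. ok S \<Longrightarrow> card \<Psi> \<le> card S"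
    using ex_has_least_nat[of ok \<Phi> card] by blast
  have sub: "\<Psi> \<subseteq> \<Phi>" "\<alpha> \<in> \<Psi>" and orth: "\<And>\<beta> \<gamma>. \<beta> \<in> \<Psi> \<Longrightarrow> \<gamma> \<in> \<Phi> - \<Psi> \<Longrightarrow> riesz \<beta> \<bullet> riesz \<gamma> = 0"
    using \<Psi> by (auto simp: ok_def mutually_orthogonal_def dual_inner_def)
  have fin: "finite \<Psi>" using sub(1) rs(1) finite_subset by blast
  have mem: "\<gamma> \<in> \<Psi>" if "\<gamma> \<in> \<Phi>" "\<beta> \<in> \<Psi>" "riesz \<beta> \<bullet> riesz \<gamma> \<noteq> 0" for \<beta> \<gamma>
    using orth[of \<beta> \<gamma>] that by blast
  have neg: "- \<beta> \<in> \<Psi>" if "\<beta> \<in> \<Psi>" for \<beta>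
  proof -
    have "\<beta> \<in> \<Phi>" using that sub by blast
    then have "- \<beta> \<in> \<Phi>" using rs(4)[of \<beta>] by blast
    moreover have "riesz \<beta> \<bullet> riesz (- \<beta>) \<noteq> 0" using pos[OF \<open>\<beta> \<in> \<Phi>\<close>] by (simp add: riesz_neg)
    ultimately show ?thesis using mem that by blast
  qed
  \<comment> \<open>A reflected root outside \<Psi> would be orthogonal to \<gamma> and \<beta>,
    hence to itself, being a combination of both.\<close>
  have refl: "reflection \<gamma> \<beta> \<in> \<Psi>" if "\<gamma> \<in> \<Psi>" "\<beta> \<in> \<Psi>" for \<gamma> \<beta>
  proof (rule ccontr)
    assume no: "reflection \<gamma> \<beta> \<notin> \<Psi>"
    have "reflection \<gamma> \<beta> \<in> \<Phi> - \<Psi>" using no rs(3) that sub by blast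
    then have z: "riesz \<gamma> \<bullet> riesz (reflection \<gamma> \<beta>) = 0" "riesz \<beta> \<bullet> riesz (reflection \<gamma> \<beta>) = 0"
      using orth that by blast+
    have r: "riesz (reflection \<gamma> \<beta>) = riesz \<beta> - blinfun_apply \<beta> (coroot \<gamma>) *\<^sub>R riesz \<gamma>"
      by (simp add: reflection_def riesz_diff riesz_scaleR)
    have "riesz (reflection \<gamma> \<beta>) \<bullet> riesz (reflection \<gamma> \<beta>) = 0"
      using z by (subst (1) r) (simp add: inner_diff_left)
    then show False using pos[of "reflection \<gamma> \<beta>"] rs(3) that sub by fastforce
  qed
  have rsP: "root_system \<Psi>"
    unfolding root_system_def
  proof (intro conjI ballI)
    show "finite \<Psi>" by (rule fin)
    show "\<Psi> \<noteq> {}" using sub by blast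
    show "0 \<notin> \<Psi>" using sub rs(2) by blast
    fix \<gamma> assume \<gamma>: "\<gamma> \<in> \<Psi>"
    show "range (\<lambda>c. c *\<^sub>R \<gamma>) \<inter> \<Psi> = {\<gamma>, - \<gamma>}"
      using rs(4)[of \<gamma>] sub \<gamma> neg[OF \<gamma>] by blast
    fix \<beta> assume "\<beta> \<in> \<Psi>"
    then show "reflection \<gamma> \<beta> \<in> \<Psi>" "blinfun_apply \<gamma> (coroot \<beta>) \<in> \<int>" using \<gamma> refl rs(5) sub by blast+
  qed
  have "\<not> (\<exists>A B. A \<noteq> {} \<and> B \<noteq> {} \<and> A \<union> B = \<Psi> \<and> A \<inter> B = {} \<and> mutually_orthogonal A B)"
  proof
    assume "\<exists>A B. A \<noteq> {} \<and> B \<noteq> {} \<and> A \<union> B = \<Psi> \<and> A \<inter> B = {} \<and> mutually_orthogonal A B"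
    then obtain A B where AB: "A \<noteq> {}" "B \<noteq> {}" "A \<union> B = \<Psi>" "A \<inter> B = {}" "mutually_orthogonal A B" by blast
    have "mutually_orthogonal B A" using AB(5) unfolding mutually_orthogonal_def dual_inner_def by (metis inner_commute)
    then have *: "\<exists>A B. A \<noteq> {} \<and> B \<noteq> {} \<and> A \<union> B = \<Psi> \<and> A \<inter> B = {} \<and> mutually_orthogonal A B \<and> \<alpha> \<in> A"
      using AB sub(2) by (metis UnE Un_commute Int_commute)
    then obtain A B where AB: "B \<noteq> {}" "A \<union> B = \<Psi>" "A \<inter> B = {}" "mutually_orthogonal A B" "\<alpha> \<in> A" by blast
    have "ok A"
      unfolding ok_def mutually_orthogonal_def
    proof (intro conjI ballI)
      fix \<beta> \<gamma> assume "\<beta> \<in> A" "\<gamma> \<in> \<Phi> - A"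
      then show "dual_inner \<beta> \<gamma> = 0"
        using AB orth[of \<beta> \<gamma>] by (cases "\<gamma> \<in> \<Psi>") (auto simp: mutually_orthogonal_def dual_inner_def)
    qed (use AB sub in auto)
    then have "card \<Psi> \<le> card A" by (rule min)
    moreover have "card A < card \<Psi>" using AB fin by (intro psubset_card_mono) auto
    ultimately show False by simp
  qed
  then have "irreducible_component \<Phi> \<Psi>"
    unfolding irreducible_component_def irreducible_root_system_def
    using rsP sub(1) \<Psi> by (simp add: ok_def)
  then show ?thesis using that sub(2) by blast
qed

section \<open>Coordinates supplied by the standard models\<close>

locale classical_component =
  fixes \<Phi> :: "'v::euclidean_space dual set" and \<Psi> :: "'v dual set" and N :: nat
    and T :: "'v dual \<Rightarrow> nat \<Rightarrow> real" and M :: "(nat \<Rightarrow> real) set"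
  assumes sub: "\<Psi> \<subseteq> \<Phi>" and orth: "mutually_orthogonal \<Psi> (\<Phi> - \<Psi>)" and zero: "0 \<notin> \<Psi>"
    and lin: "linear (\<lambda>p. T p k)" and bij: "bij_betw T \<Psi> M"
    and cartan: "\<alpha> \<in> \<Psi> \<Longrightarrow> \<beta> \<in> \<Psi> \<Longrightarrow>
      blinfun_apply \<alpha> (coroot \<beta>) = 2 * (\<Sum>k<N. T \<alpha> k * T \<beta> k) / (\<Sum>k<N. (T \<beta> k)\<^sup>2)"
begin

lemma T_add: "T (p + q) k = T p k + T q k"
  and T_diff: "T (p - q) k = T p k - T q k"
  and T_scaleR: "T (c *\<^sub>R p) k = c * T p k"
  using linear_add[OF lin] linear_diff[OF lin] linear_scale[OF lin] by auto

lemma cartan_span: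
  assumes "p \<in> span \<Psi>" "\<beta> \<in> \<Psi>"
  shows "blinfun_apply p (coroot \<beta>) = 2 * (\<Sum>k<N. T p k * T \<beta> k) / (\<Sum>k<N. (T \<beta> k)\<^sup>2)"
  using assms(1)
proof (induction rule: span_induct_alt)
  case base
  have "T 0 k = 0" for k using linear_0[OF lin] .
  then show ?case by simp
next
  case (step c x y)
  have "(\<Sum>k<N. T (c *\<^sub>R x + y) k * T \<beta> k) = c * (\<Sum>k<N. T x k * T \<beta> k) + (\<Sum>k<N. T y k * T \<beta> k)"
    by (simp add: T_add T_scaleR distrib_right sum.distrib sum_distrib_left mult.assoc)
  then show ?case
    using step cartan[OF step(1) assms(2)]
    by (simp add: plus_blinfun.rep_eq scaleR_blinfun.rep_eq add_divide_distrib distrib_left)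
qed

text \<open>Equal coordinates give equal pairings with all coroots of \<Psi>, so the difference is
  orthogonal to the span in which it lies.\<close>

lemma T_inj_span:
  assumes "p \<in> span \<Psi>" "q \<in> span \<Psi>" "\<And>k. k < N \<Longrightarrow> T p k = T q k"
  shows "p = q"
proof -
  have d: "p - q \<in> span \<Psi>" using assms by (simp add: span_diff)
  have "riesz (p - q) \<bullet> riesz \<beta> = 0" if "\<beta> \<in> \<Psi>" for \<beta>
  proof -
    have "blinfun_apply (p - q) (coroot \<beta>) = 0"
      unfolding cartan_span[OF d that] using assms(3) by (simp add: T_diff)
    moreover have "norm \<beta> \<noteq> 0" using that zero by auto
    ultimately show ?thesis by (simp add: coroot_eq)
  qed
  then have "\<Psi> \<subseteq> {x. riesz (p - q) \<bullet> riesz x = 0}" by blast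
  moreover have "subspace {x. riesz (p - q) \<bullet> riesz x = 0}"
    by (simp add: subspace_def riesz_0 riesz_add riesz_scaleR inner_add_right)
  ultimately have "riesz (p - q) \<bullet> riesz (p - q) = 0" using d span_minimal by blast
  then have "riesz (p - q) = riesz 0" by (simp add: riesz_0)
  then show ?thesis using inj_riesz by (metis injD right_minus_eq)
qed

text \<open>The functional is the linear form \<open>\<Sum>k<N. f k * T p k\<close>, projected onto the span of \<open>\<Psi>\<close>.\<close>

lemma functional_exists:
  "\<exists>w. (\<forall>\<delta>\<in>riesz ` \<Phi> - riesz ` \<Psi>. w \<bullet> \<delta> = 0) \<and> (\<forall>p\<in>span \<Psi>. w \<bullet> riesz p = (\<Sum>k<N. f k * T p k))"
proof -
  define F where "F v = (\<Sum>k<N. f k * T (blinfun_inner_right v) k)" for v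
  have linb: "linear (blinfun_inner_right :: 'v \<Rightarrow> 'v dual)"
    using bounded_linear_blinfun_inner_right bounded_linear.linear by blast
  have "linear F"
    by (rule linearI)
       (simp_all add: F_def linear_add[OF linb] linear_scale[OF linb] T_add T_scaleR distrib_left sum.distrib
          sum_distrib_left mult.left_commute)
  define u where "u = (\<Sum>b\<in>Basis. F b *\<^sub>R b)"
  have u: "u \<bullet> v = F v" for v
  proof -
    have "F v = F (\<Sum>b\<in>Basis. (v \<bullet> b) *\<^sub>R b)" by (simp add: euclidean_representation)
    also have "\<dots> = (\<Sum>b\<in>Basis. (v \<bullet> b) * F b)"
      by (simp add: linear_sum[OF \<open>linear F\<close>] linear_scale[OF \<open>linear F\<close>])
    also have "\<dots> = u \<bullet> v" by (simp add: u_def inner_sum_left inner_commute[of v] mult.commute)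
    finally show ?thesis by simp
  qed
  obtain w z where wz: "w \<in> span (riesz ` \<Psi>)" "\<And>x. x \<in> span (riesz ` \<Psi>) \<Longrightarrow> orthogonal z x" "u = w + z"
    using orthogonal_subspace_decomp_exists[of "riesz ` \<Psi>" u] by metis
  show ?thesis
  proof (intro exI[of _ w] conjI ballI)
    fix p assume "p \<in> span \<Psi>"
    then have "riesz p \<in> span (riesz ` \<Psi>)" using linear_span_image[OF linear_riesz] by blast
    then have "z \<bullet> riesz p = 0" using wz(2) by (simp add: orthogonal_def)
    then have "w \<bullet> riesz p = F (riesz p)" using u[of "riesz p"] wz(3) by (simp add: inner_add_left)
    then show "w \<bullet> riesz p = (\<Sum>k<N. f k * T p k)" by (simp add: F_def blinfun_inner_riesz)
  next
    fix \<delta> assume "\<delta> \<in> riesz ` \<Phi> - riesz ` \<Psi>"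
    then obtain \<gamma> where \<gamma>: "\<gamma> \<in> \<Phi> - \<Psi>" "\<delta> = riesz \<gamma>" by blast
    have "riesz ` \<Psi> \<subseteq> {x. \<delta> \<bullet> x = 0}"
      using orth \<gamma> by (auto simp: mutually_orthogonal_def dual_inner_def inner_commute)
    then have "span (riesz ` \<Psi>) \<subseteq> {x. \<delta> \<bullet> x = 0}" by (intro span_minimal) (auto simp: subspace_hyperplane)
    then show "w \<bullet> \<delta> = 0" using wz(1) by (auto simp: inner_commute)
  qed
qed

lemma preimage:
  assumes "m \<in> M"
  obtains \<alpha> where "\<alpha> \<in> \<Psi>" "T \<alpha> = m"
  using assms bij unfolding bij_betw_def by blast

end

lemma classical_type_A:
  assumes "classical_component \<Phi> \<Psi> (n + 1) T (model_A n)"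
  shows "\<exists>E. type_A (riesz ` \<Phi>) (riesz ` \<Psi>) n E"
proof -
  interpret classical_component \<Phi> \<Psi> "n + 1" T "model_A n" by (rule assms)
  have "\<forall>i. \<exists>\<alpha>. 0 < i \<and> i \<le> n \<longrightarrow> \<alpha> \<in> \<Psi> \<and> T \<alpha> = (\<lambda>k. unit_coord i k - unit_coord 0 k)"
  proof
    fix i
    show "\<exists>\<alpha>. 0 < i \<and> i \<le> n \<longrightarrow> \<alpha> \<in> \<Psi> \<and> T \<alpha> = (\<lambda>k. unit_coord i k - unit_coord 0 k)"
    proof (cases "0 < i \<and> i \<le> n")
      case True
      then have "(\<lambda>k. unit_coord i k - unit_coord 0 k) \<in> model_A n" unfolding model_A_def by blast
      then obtain \<alpha> where "\<alpha> \<in> \<Psi>" "T \<alpha> = (\<lambda>k. unit_coord i k - unit_coord 0 k)" by (rule preimage)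
      then show ?thesis by blast
    qed blast
  qed
  then obtain A where A: "\<And>i. 0 < i \<Longrightarrow> i \<le> n \<Longrightarrow> A i \<in> \<Psi>"
    "\<And>i. 0 < i \<Longrightarrow> i \<le> n \<Longrightarrow> T (A i) = (\<lambda>k. unit_coord i k - unit_coord 0 k)" by metis
  \<comment> \<open>The unit vectors of the model are not in the span of its roots; subtracting the
    one with index 0 is harmless because only differences matter.\<close>
  define E0 where "E0 i = (if i = 0 then 0 else A i)" for i
  have E0s: "E0 i \<in> span \<Psi>" if "i \<le> n" for i
    using that A(1) by (auto simp: E0_def span_zero span_base)
  have T0: "T 0 k = 0" for k using linear_0[OF lin] .
  have E0T: "T (E0 i) k = unit_coord i k - unit_coord 0 k" if "i \<le> n" for i k
    using that A(2) by (auto simp: E0_def T0)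
  have diff: "\<alpha> = E0 i - E0 j" if "\<alpha> \<in> \<Psi>" "T \<alpha> = (\<lambda>k. unit_coord i k - unit_coord j k)" "i \<le> n" "j \<le> n" for \<alpha> i j
    using that by (intro T_inj_span) (auto simp: span_base span_diff E0s T_diff E0T)
  have \<Psi>: "\<Psi> = {E0 i - E0 j | i j. i \<le> n \<and> j \<le> n \<and> i \<noteq> j}"
  proof (intro set_eqI iffI)
    fix \<alpha> assume \<alpha>: "\<alpha> \<in> \<Psi>"
    then have "T \<alpha> \<in> model_A n" using bij by (auto simp: bij_betw_def)
    then obtain i j where "T \<alpha> = (\<lambda>k. unit_coord i k - unit_coord j k)" "i \<le> n" "j \<le> n" "i \<noteq> j"
      unfolding model_A_def by blast
    then show "\<alpha> \<in> {E0 i - E0 j | i j. i \<le> n \<and> j \<le> n \<and> i \<noteq> j}" using diff[OF \<alpha>] by blast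
  next
    fix \<alpha> assume "\<alpha> \<in> {E0 i - E0 j | i j. i \<le> n \<and> j \<le> n \<and> i \<noteq> j}"
    then obtain i j where ij: "\<alpha> = E0 i - E0 j" "i \<le> n" "j \<le> n" "i \<noteq> j" by blast
    then have "(\<lambda>k. unit_coord i k - unit_coord j k) \<in> model_A n" unfolding model_A_def by blast
    then obtain \<beta> where "\<beta> \<in> \<Psi>" "T \<beta> = (\<lambda>k. unit_coord i k - unit_coord j k)" by (rule preimage)
    then show "\<alpha> \<in> \<Psi>" using diff ij by blast
  qed
  define E where "E i = riesz (E0 i)" for i
  have "type_A (riesz ` \<Phi>) (riesz ` \<Psi>) n E"
    unfolding type_A_def
  proof (intro conjI allI)
    show "riesz ` \<Psi> = {E i - E j | i j. i \<le> n \<and> j \<le> n \<and> i \<noteq> j}"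
      unfolding \<Psi> E_def riesz_diff[symmetric] by blast
    fix f :: "nat \<Rightarrow> real"
    obtain w where w: "\<forall>\<delta>\<in>riesz ` \<Phi> - riesz ` \<Psi>. w \<bullet> \<delta> = 0"
      "\<forall>p\<in>span \<Psi>. w \<bullet> riesz p = (\<Sum>k<n + 1. f k * T p k)" using functional_exists by blast
    have "w \<bullet> (E i - E j) = f i - f j" if "i \<le> n" "j \<le> n" for i j
    proof -
      have "w \<bullet> (E i - E j) = (\<Sum>k<n + 1. f k * T (E0 i - E0 j) k)"
        unfolding E_def riesz_diff[symmetric] using w(2) that by (simp add: span_diff E0s)
      also have "\<dots> = (\<Sum>k<n + 1. f k * unit_coord i k) - (\<Sum>k<n + 1. f k * unit_coord j k)"
        using that by (simp add: T_diff E0T right_diff_distrib sum_subtractf del: sum.lessThan_Suc)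
      also have "\<dots> = f i - f j"
        using that by (simp add: unit_coord_def if_distrib cong: if_cong del: sum.lessThan_Suc)
      finally show ?thesis .
    qed
    then show "\<exists>w. (\<forall>\<delta>\<in>riesz ` \<Phi> - riesz ` \<Psi>. w \<bullet> \<delta> = 0) \<and> (\<forall>i\<le>n. \<forall>j\<le>n. w \<bullet> (E i - E j) = f i - f j)"
      using w(1) by blast
  qed
  then show ?thesis by blast
qed

lemma classical_type_BCD:
  assumes "classical_component \<Phi> \<Psi> n T M" and n: "n \<ge> 2" and K: "K \<in> {{}, {1}, {2}}"
    and M: "M = model_D n \<union> {(\<lambda>k. c * s * unit_coord i k) | c s i. s \<in> {1, -1} \<and> c \<in> K \<and> i < n}"
  shows "\<exists>E. type_BCD (riesz ` \<Phi>) (riesz ` \<Psi>) n E K"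
proof -
  interpret classical_component \<Phi> \<Psi> n T M by (rule assms(1))
  have pairM: "(\<lambda>k. s * unit_coord i k + t * unit_coord j k) \<in> M"
    if "s \<in> {1, -1}" "t \<in> {1, -1}" "i < n" "j < n" "i \<noteq> j" for s t i j
    unfolding M model_D_def using that by blast
  have "\<forall>i. \<exists>p. i < n \<longrightarrow> p \<in> span \<Psi> \<and> (\<forall>k. T p k = unit_coord i k)"
  proof
    fix i
    show "\<exists>p. i < n \<longrightarrow> p \<in> span \<Psi> \<and> (\<forall>k. T p k = unit_coord i k)"
    proof (cases "i < n")
      case True
      \<comment> \<open>A second index, available since \<open>n \<ge> 2\<close>: the wanted vector
        is half the sum of the two roots with coordinates \<open>e_i + e_j\<close> and
        \<open>e_i - e_j\<close>, which works even when no multiple of it is a root.\<close>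
      define j where "j = (if i = 0 then 1 else 0 :: nat)"
      have j: "j < n" "i \<noteq> j" using n by (auto simp: j_def)
      obtain \<alpha> where \<alpha>: "\<alpha> \<in> \<Psi>" "T \<alpha> = (\<lambda>k. 1 * unit_coord i k + 1 * unit_coord j k)"
        using preimage[OF pairM[of 1 1 i j]] True j by auto
      obtain \<beta> where \<beta>: "\<beta> \<in> \<Psi>" "T \<beta> = (\<lambda>k. 1 * unit_coord i k + (-1) * unit_coord j k)"
        using preimage[OF pairM[of 1 "-1" i j]] True j by auto
      show ?thesis
        using \<alpha> \<beta> by (intro exI[of _ "(1/2) *\<^sub>R (\<alpha> + \<beta>)"])
          (simp add: span_scale span_add span_base T_scaleR T_add)
    qed simp
  qed
  then obtain E0 where E0s: "\<And>i. i < n \<Longrightarrow> E0 i \<in> span \<Psi>" and E0T: "\<And>i k. i < n \<Longrightarrow> T (E0 i) k = unit_coord i k"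
    by metis
  have pair: "\<alpha> = s *\<^sub>R E0 i + t *\<^sub>R E0 j"
    if "\<alpha> \<in> \<Psi>" "T \<alpha> = (\<lambda>k. s * unit_coord i k + t * unit_coord j k)" "i < n" "j < n" for \<alpha> s t i j
    using that by (intro T_inj_span) (auto simp: span_base span_add span_scale E0s T_add T_scaleR E0T)
  have single: "\<alpha> = (s * c) *\<^sub>R E0 i"
    if "\<alpha> \<in> \<Psi>" "T \<alpha> = (\<lambda>k. c * s * unit_coord i k)" "i < n" for \<alpha> s c i
    using that by (intro T_inj_span) (auto simp: span_base span_scale E0s T_scaleR E0T)
  have \<Psi>: "\<Psi> = {s *\<^sub>R E0 i + t *\<^sub>R E0 j | s t i j. s \<in> {1, -1} \<and> t \<in> {1, -1} \<and> i < n \<and> j < n \<and> i \<noteq> j}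
       \<union> {(s * k) *\<^sub>R E0 i | s k i. s \<in> {1, -1} \<and> k \<in> K \<and> i < n}" (is "_ = ?D \<union> ?K")
  proof (intro set_eqI iffI)
    fix \<alpha> assume \<alpha>: "\<alpha> \<in> \<Psi>"
    then have "T \<alpha> \<in> M" using bij by (auto simp: bij_betw_def)
    then show "\<alpha> \<in> ?D \<union> ?K"
      unfolding M
    proof
      assume "T \<alpha> \<in> model_D n"
      then obtain s t i j where "T \<alpha> = (\<lambda>k. s * unit_coord i k + t * unit_coord j k)"
        "s \<in> {1, -1}" "t \<in> {1, -1}" "i < n" "j < n" "i \<noteq> j" unfolding model_D_def by blast
      then have "\<alpha> \<in> ?D" using pair[OF \<alpha>] by blast
      then show ?thesis by blast
    next
      assume "T \<alpha> \<in> {(\<lambda>k. c * s * unit_coord i k) | c s i. s \<in> {1, -1} \<and> c \<in> K \<and> i < n}"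
      then obtain c s i where "T \<alpha> = (\<lambda>k. c * s * unit_coord i k)" "s \<in> {1, -1}" "c \<in> K" "i < n" by blast
      then have "\<alpha> \<in> ?K" using single[OF \<alpha>] by blast
      then show ?thesis by blast
    qed
  next
    fix \<alpha> assume "\<alpha> \<in> ?D \<union> ?K"
    then show "\<alpha> \<in> \<Psi>"
    proof
      assume "\<alpha> \<in> ?D"
      then obtain s t i j where st: "\<alpha> = s *\<^sub>R E0 i + t *\<^sub>R E0 j" "s \<in> {1, -1}" "t \<in> {1, -1}" "i < n" "j < n" "i \<noteq> j"
        by blast
      then obtain \<beta> where "\<beta> \<in> \<Psi>" "T \<beta> = (\<lambda>k. s * unit_coord i k + t * unit_coord j k)"
        using preimage[OF pairM] by metis
      then show ?thesis using pair st by blast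
    next
      assume "\<alpha> \<in> ?K"
      then obtain s c i where st: "\<alpha> = (s * c) *\<^sub>R E0 i" "s \<in> {1, -1}" "c \<in> K" "i < n" by blast
      then have "(\<lambda>k. c * s * unit_coord i k) \<in> M" unfolding M by blast
      then obtain \<beta> where "\<beta> \<in> \<Psi>" "T \<beta> = (\<lambda>k. c * s * unit_coord i k)" by (rule preimage)
      then show ?thesis using single st by blast
    qed
  qed
  define E where "E i = riesz (E0 i)" for i
  have "type_BCD (riesz ` \<Phi>) (riesz ` \<Psi>) n E K"
    unfolding type_BCD_def
  proof (intro conjI allI)
    have "riesz ` \<Psi> = riesz ` ?D \<union> riesz ` ?K" by (subst \<Psi>) (rule image_Un)
    also have "riesz ` ?D = {s *\<^sub>R E i + t *\<^sub>R E j | s t i j. s \<in> {1, -1} \<and> t \<in> {1, -1} \<and> i < n \<and> j < n \<and> i \<noteq> j}"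
      unfolding E_def riesz_scaleR[symmetric] riesz_add[symmetric] by blast
    also have "riesz ` ?K = {(s * k) *\<^sub>R E i | s k i. s \<in> {1, -1} \<and> k \<in> K \<and> i < n}"
      unfolding E_def riesz_scaleR[symmetric] by blast
    finally show "riesz ` \<Psi> = {s *\<^sub>R E i + t *\<^sub>R E j | s t i j. s \<in> {1, -1} \<and> t \<in> {1, -1} \<and> i < n \<and> j < n \<and> i \<noteq> j}
       \<union> {(s * k) *\<^sub>R E i | s k i. s \<in> {1, -1} \<and> k \<in> K \<and> i < n}" .
    fix f :: "nat \<Rightarrow> real"
    obtain w where w: "\<forall>\<delta>\<in>riesz ` \<Phi> - riesz ` \<Psi>. w \<bullet> \<delta> = 0"
      "\<forall>p\<in>span \<Psi>. w \<bullet> riesz p = (\<Sum>k<n. f k * T p k)" using functional_exists by blast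
    have "w \<bullet> E i = f i" if "i < n" for i
      using w(2) E0s[OF that] that by (simp add: E_def E0T unit_coord_def if_distrib cong: if_cong)
    then show "\<exists>w. (\<forall>\<delta>\<in>riesz ` \<Phi> - riesz ` \<Psi>. w \<bullet> \<delta> = 0) \<and> (\<forall>i<n. w \<bullet> E i = f i)"
      using w(1) by blast
  qed (use n K in auto)
  then show ?thesis by blast
qed

lemma classical_component_data:
  assumes comp: "irreducible_component \<Phi> \<Psi>" and cl: "classical_type \<Psi>"
  shows "(\<exists>n E. type_A (riesz ` \<Phi>) (riesz ` \<Psi>) n E) \<or> (\<exists>n E K. type_BCD (riesz ` \<Phi>) (riesz ` \<Psi>) n E K)"
proof -
  have comps: "\<exists>T. classical_component \<Phi> \<Psi> N T M" if iso: "isomorphic_to_model \<Psi> N M" for N M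
  proof -
    obtain T where T: "\<forall>k. linear (\<lambda>p. T p k)" "bij_betw T \<Psi> M"
      "\<forall>\<alpha>\<in>\<Psi>. \<forall>\<beta>\<in>\<Psi>. blinfun_apply \<alpha> (coroot \<beta>) = 2 * (\<Sum>k<N. T \<alpha> k * T \<beta> k) / (\<Sum>k<N. (T \<beta> k)\<^sup>2)"
      using iso unfolding isomorphic_to_model_def by blast
    have "classical_component \<Phi> \<Psi> N T M"
    proof (rule classical_component.intro)
      show "\<Psi> \<subseteq> \<Phi>" "mutually_orthogonal \<Psi> (\<Phi> - \<Psi>)" "0 \<notin> \<Psi>"
        using comp by (simp_all add: irreducible_component_def irreducible_root_system_def root_system_def)
      show "linear (\<lambda>p. T p k)" for k using T(1) by simp
      show "bij_betw T \<Psi> M" by (rule T(2))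
      show "blinfun_apply \<alpha> (coroot \<beta>) = 2 * (\<Sum>k<N. T \<alpha> k * T \<beta> k) / (\<Sum>k<N. (T \<beta> k)\<^sup>2)"
        if "\<alpha> \<in> \<Psi>" "\<beta> \<in> \<Psi>" for \<alpha> \<beta> using T(3) that by simp
    qed
    then show ?thesis by blast
  qed
  from cl show ?thesis
    unfolding classical_type_def
  proof (elim disjE exE conjE)
    fix n assume "isomorphic_to_model \<Psi> (n + 1) (model_A n)"
    from comps[OF this] obtain T where "classical_component \<Phi> \<Psi> (n + 1) T (model_A n)" by (elim exE)
    from classical_type_A[OF this] show ?thesis by blast
  next
    fix n :: nat assume n: "n \<ge> 2" "isomorphic_to_model \<Psi> n (model_B n)"
    from comps[OF n(2)] obtain T where T: "classical_component \<Phi> \<Psi> n T (model_B n)" by (elim exE)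
    have "\<exists>E. type_BCD (riesz ` \<Phi>) (riesz ` \<Psi>) n E {1}"
      by (rule classical_type_BCD[OF T]) (use n(1) in \<open>simp_all add: model_B_def\<close>)
    then show ?thesis by blast
  next
    fix n :: nat assume n: "n \<ge> 3" "isomorphic_to_model \<Psi> n (model_C n)"
    from comps[OF n(2)] obtain T where T: "classical_component \<Phi> \<Psi> n T (model_C n)" by (elim exE)
    have "\<exists>E. type_BCD (riesz ` \<Phi>) (riesz ` \<Psi>) n E {2}"
      by (rule classical_type_BCD[OF T]) (use n(1) in \<open>simp_all add: model_C_def\<close>)
    then show ?thesis by blast
  next
    fix n :: nat assume n: "n \<ge> 4" "isomorphic_to_model \<Psi> n (model_D n)"
    from comps[OF n(2)] obtain T where T: "classical_component \<Phi> \<Psi> n T (model_D n)" by (elim exE)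
    have "\<exists>E. type_BCD (riesz ` \<Phi>) (riesz ` \<Psi>) n E {}"
      by (rule classical_type_BCD[OF T]) (use n(1) in simp_all)
    then show ?thesis by blast
  qed
qed

theorem root_vectors_riesz:
  assumes \<Phi>: "root_system \<Phi>" and ess: "essential \<Phi>"
    and cl: "\<And>\<Psi>. irreducible_component \<Phi> \<Psi> \<Longrightarrow> classical_type \<Psi>"
  shows "root_vectors (riesz ` \<Phi>)"
proof
  show "finite (riesz ` \<Phi>)" using \<Phi> by (simp add: root_system_def)
  show "- \<alpha> \<in> riesz ` \<Phi>" if \<alpha>: "\<alpha> \<in> riesz ` \<Phi>" for \<alpha>
  proof -
    obtain \<beta> where \<beta>: "\<beta> \<in> \<Phi>" "\<alpha> = riesz \<beta>" using \<alpha> by blast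
    then have "- \<beta> \<in> \<Phi>" using \<Phi> unfolding root_system_def by blast
    then show ?thesis using \<beta> by (metis image_eqI riesz_neg)
  qed
  show "span (riesz ` \<Phi>) = UNIV"
    using ess surj_riesz by (simp add: linear_span_image[OF linear_riesz] essential_def)
  show "\<exists>\<Psi>\<subseteq>riesz ` \<Phi>. \<alpha> \<in> \<Psi> \<and> ((\<exists>n E. type_A (riesz ` \<Phi>) \<Psi> n E) \<or> (\<exists>n E K. type_BCD (riesz ` \<Phi>) \<Psi> n E K))"
    if \<alpha>: "\<alpha> \<in> riesz ` \<Phi>" for \<alpha>
  proof -
    obtain \<beta> where \<beta>: "\<beta> \<in> \<Phi>" "\<alpha> = riesz \<beta>" using \<alpha> by blast
    obtain \<Psi> where \<Psi>: "irreducible_component \<Phi> \<Psi>" "\<beta> \<in> \<Psi>"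
      using irreducible_component_exists[OF \<Phi> \<beta>(1)] by blast
    have "riesz ` \<Psi> \<subseteq> riesz ` \<Phi>" using \<Psi>(1) by (auto simp: irreducible_component_def)
    moreover have "\<alpha> \<in> riesz ` \<Psi>" using \<beta>(2) \<Psi>(2) by blast
    ultimately show ?thesis using classical_component_data[OF \<Psi>(1) cl[OF \<Psi>(1)]]
      by (intro exI[of _ "riesz ` \<Psi>"] conjI)
  qed
qed

section \<open>Transfer to the dual space\<close>

lemma closure_riesz: "closure (riesz ` S) = riesz ` closure S"
proof
  have bl: "bounded_linear riesz"
    by (rule bounded_linear_intro[where K = 1]) (simp_all add: riesz_add riesz_scaleR norm_riesz)
  show "riesz ` closure S \<subseteq> closure (riesz ` S)" by (rule closure_bounded_linear_image_subset[OF bl])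
  have "blinfun_inner_right ` closure (riesz ` S) \<subseteq> closure (blinfun_inner_right ` riesz ` S)"
    by (rule closure_bounded_linear_image_subset[OF bounded_linear_blinfun_inner_right])
  also have "blinfun_inner_right ` riesz ` S = S" by (simp add: image_comp o_def blinfun_inner_riesz)
  finally have "riesz ` blinfun_inner_right ` closure (riesz ` S) \<subseteq> riesz ` closure S" by (rule image_mono)
  then show "closure (riesz ` S) \<subseteq> riesz ` closure S" by (simp add: image_comp o_def riesz_blinfun_inner)
qed

lemma riesz_image_eq_iff: "riesz ` A = riesz ` B \<longleftrightarrow> A = B"
  using inj_riesz by (rule inj_image_eq_iff)

lemma riesz_image_Int: "riesz ` (A \<inter> B) = riesz ` A \<inter> riesz ` B"
  using inj_riesz by (rule image_Int)

lemma tcone_riesz: "tcone (riesz ` P) (riesz p) = riesz ` tangent_cone P p"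
proof -
  have "(\<lambda>q. q - riesz p) ` riesz ` P = riesz ` ((\<lambda>q. q - p) ` P)"
    by (simp add: image_comp o_def riesz_diff)
  then show ?thesis
    by (simp add: tcone_def tangent_cone_def convex_cone_hull_linear_image[OF linear_riesz] closure_riesz)
qed

lemma mpoly_riesz: "integral_M_convex_polyhedron \<Phi> P \<longleftrightarrow> mpoly (riesz ` \<Phi>) (riesz ` P)"
proof -
  have "closed P \<longleftrightarrow> closed (riesz ` P)"
    by (simp add: closure_eq[symmetric] closure_riesz riesz_image_eq_iff)
  moreover have "convex P \<longleftrightarrow> convex (riesz ` P)"
    by (simp add: convex_hull_eq[symmetric] convex_hull_linear_image[OF linear_riesz, symmetric] riesz_image_eq_iff)
  moreover have "M_convex_cone \<Phi> (tangent_cone P p) \<longleftrightarrow>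
      (\<exists>R'\<subseteq>riesz ` \<Phi>. tcone (riesz ` P) (riesz p) = convex_cone hull R')" for p
  proof -
    have "(\<exists>R'\<subseteq>riesz ` \<Phi>. riesz ` tangent_cone P p = convex_cone hull R') \<longleftrightarrow>
        (\<exists>\<Phi>'\<subseteq>\<Phi>. riesz ` tangent_cone P p = convex_cone hull (riesz ` \<Phi>'))"
      unfolding subset_image_iff by blast
    then show ?thesis
      unfolding M_convex_cone_def tcone_riesz
      by (simp add: convex_cone_hull_linear_image[OF linear_riesz] riesz_image_eq_iff)
  qed
  moreover have "P = convex hull (P \<inter> root_lattice \<Phi>) \<longleftrightarrow>
      riesz ` P = convex hull (riesz ` P \<inter> lat (riesz ` \<Phi>))"
    unfolding lat_riesz riesz_image_Int[symmetric] convex_hull_linear_image[OF linear_riesz, symmetric]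
      riesz_image_eq_iff ..
  ultimately show ?thesis
    unfolding integral_M_convex_polyhedron_def M_convex_polyhedron_def mpoly_def by auto
qed

lemma locally_polyhedral_linear_image:
  fixes f :: "'a::real_vector \<Rightarrow> 'b::real_vector" and g :: "'b \<Rightarrow> 'a"
  assumes "linear f" "linear g" "\<And>x. g (f x) = x" "\<And>y. f (g y) = y" "locally_polyhedral C"
  shows "locally_polyhedral (f ` C)"
  unfolding locally_polyhedral_def
proof (intro conjI allI impI)
  show "convex (f ` C)" using assms by (simp add: convex_linear_image locally_polyhedral_def)
  fix Q :: "'b set" assume "polytope Q"
  then have "polytope (g ` Q)" by (rule polytope_linear_image[OF assms(2)])
  then have "polytope (C \<inter> g ` Q)" using assms(5) by (simp add: locally_polyhedral_def)
  then have "polytope (f ` (C \<inter> g ` Q))" by (rule polytope_linear_image[OF assms(1)])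
  moreover have "f ` (C \<inter> g ` Q) = f ` C \<inter> Q"
  proof (intro set_eqI iffI)
    fix y assume "y \<in> f ` (C \<inter> g ` Q)"
    then obtain x z where "y = f x" "x \<in> C" "x = g z" "z \<in> Q" by auto
    then have "y \<in> f ` C" "y \<in> Q" using assms(4)[of z] by (blast, simp)
    then show "y \<in> f ` C \<inter> Q" by blast
  next
    fix y assume "y \<in> f ` C \<inter> Q"
    then obtain x where "y = f x" "x \<in> C" "f x \<in> Q" by blast
    moreover have "x = g (f x)" using assms(3)[of x] by simp
    ultimately show "y \<in> f ` (C \<inter> g ` Q)" by blast
  qed
  ultimately show "polytope (f ` C \<inter> Q)" by simp
qed

lemma locally_polyhedral_riesz:
  "locally_polyhedral ((\<lambda>(p, t::real). (riesz p, t)) ` C) \<longleftrightarrow> locally_polyhedral C"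
proof -
  let ?f = "\<lambda>(p :: 'a dual, t::real). (riesz p, t)" and ?g = "\<lambda>(v :: 'a, t::real). (blinfun_inner_right v, t)"
  have f: "linear ?f" by (rule linearI) (auto simp: riesz_add riesz_scaleR)
  have "linear (blinfun_inner_right :: 'a \<Rightarrow> 'a dual)"
    using bounded_linear_blinfun_inner_right bounded_linear.linear by blast
  then have g: "linear ?g" by (intro linearI) (auto simp: linear_add linear_scale)
  have gf: "?g (?f x) = x" for x by (cases x) (simp add: blinfun_inner_riesz)
  have fg: "?f (?g y) = y" for y by (cases y) (simp add: riesz_blinfun_inner)
  show ?thesis
  proof
    assume "locally_polyhedral C"
    then show "locally_polyhedral (?f ` C)" by (rule locally_polyhedral_linear_image[OF f g gf fg])
  next
    assume "locally_polyhedral (?f ` C)"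
    then have "locally_polyhedral (?g ` ?f ` C)" by (rule locally_polyhedral_linear_image[OF g f fg gf])
    moreover have "?g ` ?f ` C = C" unfolding image_image gf by simp
    ultimately show "locally_polyhedral C" by simp
  qed
qed

lemma mfun_cong:
  assumes "\<And>y. y \<in> P \<Longrightarrow> H y = H' y"
  shows "mfun R P H \<longleftrightarrow> mfun R P H'"
proof -
  have "{(y, t). y \<in> P \<and> H y \<le> t} = {(y, t). y \<in> P \<and> H' y \<le> t}" using assms by auto
  moreover have "argmin_on P H = argmin_on P H'" using assms by (auto simp: argmin_on_def fun_eq_iff)
  ultimately show ?thesis by (simp add: mfun_def)
qed

lemma primal_integral_riesz:
  assumes h: "\<And>p. h p \<noteq> -\<infinity>"
  shows "primal_integral_M_convex_fun \<Phi> h \<longleftrightarrow>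
    mfun (riesz ` \<Phi>) (riesz ` eff_dom UNIV h) (\<lambda>v. real_of_ereal (h (blinfun_inner_right v)))"
proof -
  define P where "P = riesz ` eff_dom UNIV h"
  define H where "H v = real_of_ereal (h (blinfun_inner_right v))" for v
  have dom: "p \<in> eff_dom UNIV h \<longleftrightarrow> h p \<noteq> \<infinity>" for p using h[of p] by (auto simp: eff_dom_def)
  have memP: "riesz p \<in> P \<longleftrightarrow> h p \<noteq> \<infinity>" for p
    unfolding P_def using inj_riesz dom by (auto dest: injD)
  have Hp: "H (riesz p) = real_of_ereal (h p)" for p by (simp add: H_def blinfun_inner_riesz)
  have fin: "h p = ereal (H (riesz p))" if "h p \<noteq> \<infinity>" for p
    using h[of p] that by (cases "h p") (auto simp: Hp)
  have proper: "proper_fun h \<longleftrightarrow> P \<noteq> {}" using h by (auto simp: proper_fun_def P_def)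
  have "(\<lambda>(p, t::real). (riesz p, t)) ` {(p, t). h p \<le> ereal t} = {(y, t). y \<in> P \<and> H y \<le> t}"
  proof (intro set_eqI iffI)
    fix z assume "z \<in> (\<lambda>(p, t::real). (riesz p, t)) ` {(p, t). h p \<le> ereal t}"
    then obtain p t where pt: "z = (riesz p, t)" "h p \<le> ereal t" by auto
    then have "h p \<noteq> \<infinity>" by auto
    then show "z \<in> {(y, t). y \<in> P \<and> H y \<le> t}" using pt memP fin[of p] by auto
  next
    fix z assume "z \<in> {(y, t). y \<in> P \<and> H y \<le> t}"
    then obtain y t where z: "z = (y, t)" "y \<in> P" "H y \<le> t" by auto
    obtain p where p: "y = riesz p" using surj_riesz by blast
    then have "h p \<le> ereal t" using z memP fin[of p] by auto
    then show "z \<in> (\<lambda>(p, t::real). (riesz p, t)) ` {(p, t). h p \<le> ereal t}" using z p by force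
  qed
  with locally_polyhedral_riesz[of "{(p, t). h p \<le> ereal t}"]
  have lp: "locally_polyhedral_convex_fun h \<longleftrightarrow> locally_polyhedral {(y, t). y \<in> P \<and> H y \<le> t}"
    unfolding locally_polyhedral_convex_fun_def by (simp only:)
  \<comment> \<open>For a function that is infinite everywhere \<open>argmin\<close> is the whole
    space while \<open>argmin_on\<close> is empty; hence the restriction to nonempty
    \<open>P\<close>.\<close>
  have arg: "riesz ` argmin (\<lambda>p. h p - ereal (blinfun_apply p x)) = argmin_on P H x" if ne: "P \<noteq> {}" for x
  proof -
    obtain q0 where q0: "h q0 \<noteq> \<infinity>" using ne dom by (auto simp: P_def)
    have inner: "x \<bullet> riesz p = blinfun_apply p x" for p by (simp add: riesz_inner inner_commute[of x])
    have "p \<in> argmin (\<lambda>p. h p - ereal (blinfun_apply p x)) \<longleftrightarrow> riesz p \<in> argmin_on P H x" for p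
    proof
      assume p: "p \<in> argmin (\<lambda>p. h p - ereal (blinfun_apply p x))"
      have "h p - ereal (blinfun_apply p x) \<le> h q0 - ereal (blinfun_apply q0 x)" using p by (simp add: argmin_def)
      then have hp: "h p \<noteq> \<infinity>" using fin[OF q0] by auto
      have "H (riesz p) - x \<bullet> riesz p \<le> H (riesz q) - x \<bullet> riesz q" if "h q \<noteq> \<infinity>" for q
      proof -
        have "h p - ereal (blinfun_apply p x) \<le> h q - ereal (blinfun_apply q x)" using p by (simp add: argmin_def)
        then show ?thesis using fin[OF that] fin[OF hp] by (simp add: inner)
      qed
      then show "riesz p \<in> argmin_on P H x"
        using hp memP surj_riesz dom by (auto simp: argmin_on_def P_def)
    next
      assume p: "riesz p \<in> argmin_on P H x"
      then have hp: "h p \<noteq> \<infinity>" using memP by (simp add: argmin_on_def)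
      have "h p - ereal (blinfun_apply p x) \<le> h q - ereal (blinfun_apply q x)" for q
      proof (cases "h q = \<infinity>")
        case False
        then have "H (riesz p) - x \<bullet> riesz p \<le> H (riesz q) - x \<bullet> riesz q"
          using p memP by (simp add: argmin_on_def)
        then show ?thesis using fin[OF False] fin[OF hp] by (simp add: inner)
      qed simp
      then show "p \<in> argmin (\<lambda>p. h p - ereal (blinfun_apply p x))" by (simp add: argmin_def)
    qed
    then have "argmin (\<lambda>p. h p - ereal (blinfun_apply p x)) = riesz -` argmin_on P H x" by auto
    then show ?thesis using surj_image_vimage_eq[OF surj_riesz] by (simp only:)
  qed
  have "(\<forall>A\<in>argmin_family h. integral_M_convex_polyhedron \<Phi> A) \<longleftrightarrow>
      (\<forall>x. argmin_on P H x \<noteq> {} \<longrightarrow> mpoly (riesz ` \<Phi>) (argmin_on P H x))" if "P \<noteq> {}"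
  proof -
    have "(\<forall>A\<in>argmin_family h. integral_M_convex_polyhedron \<Phi> A) \<longleftrightarrow>
      (\<forall>x. riesz ` argmin (\<lambda>p. h p - ereal (blinfun_apply p x)) \<noteq> {} \<longrightarrow>
         mpoly (riesz ` \<Phi>) (riesz ` argmin (\<lambda>p. h p - ereal (blinfun_apply p x))))"
      by (auto simp: argmin_family_def mpoly_riesz)
    then show ?thesis by (simp only: arg[OF that])
  qed
  then show ?thesis
    unfolding primal_integral_M_convex_fun_def mfun_def proper lp P_def[symmetric] H_def[symmetric] by blast
qed

section \<open>The conditions of the theorem expressed by real coefficients\<close>

locale lattice_function =
  fixes \<Phi> :: "'v::euclidean_space dual set" and g :: "'v dual \<Rightarrow> ereal"
  assumes finite_roots: "finite \<Phi>"
    and not_MInf: "p \<in> root_lattice \<Phi> \<Longrightarrow> g p \<noteq> -\<infinity>"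
    and dom_nonempty: "lattice_dom \<Phi> g \<noteq> {}"
begin

abbreviation "L \<equiv> root_lattice \<Phi>"
abbreviation "D \<equiv> lattice_dom \<Phi> g"

definition val :: "'v dual \<Rightarrow> real" where "val p = real_of_ereal (g p)"

definition S :: "'v dual \<Rightarrow> 'v dual set" where "S p = {\<alpha>\<in>\<Phi>. p + \<alpha> \<in> D}"

lemma D_iff: "p \<in> D \<longleftrightarrow> p \<in> L \<and> g p \<noteq> \<infinity>"
  using not_MInf[of p] by (auto simp: lattice_dom_def eff_dom_def)

lemma g_val: "p \<in> D \<Longrightarrow> g p = ereal (val p)"
  using not_MInf[of p] by (cases "g p") (auto simp: val_def D_iff)

lemma finite_S: "finite (S p)" using finite_roots by (simp add: S_def)

lemma step_lattice: "p \<in> D \<Longrightarrow> \<alpha> \<in> \<Phi> \<Longrightarrow> p + \<alpha> \<in> L"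
proof -
  assume "p \<in> D" "\<alpha> \<in> \<Phi>"
  then have "riesz p \<in> lat (riesz ` \<Phi>)" "riesz \<alpha> \<in> lat (riesz ` \<Phi>)"
    using lat_root[of "riesz ` \<Phi>" "riesz \<alpha>"] finite_roots by (auto simp: lat_riesz D_iff)
  then have "riesz (p + \<alpha>) \<in> riesz ` L" unfolding riesz_add lat_riesz[symmetric] by (rule lat_add)
  then show ?thesis by (simp only: inj_image_mem_iff[OF inj_riesz])
qed

lemma distance_outside: "p \<in> D \<Longrightarrow> \<alpha> \<in> \<Phi> - S p \<Longrightarrow> local_distance g p \<alpha> = \<infinity>"
  using step_lattice[of p \<alpha>] g_val[of p] by (auto simp: local_distance_def S_def D_iff)

lemma distance_S: "p \<in> D \<Longrightarrow> \<alpha> \<in> S p \<Longrightarrow> local_distance g p \<alpha> = ereal (val (p + \<alpha>) - val p)"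
  using g_val[of p] g_val[of "p + \<alpha>"] by (simp add: local_distance_def S_def)

lemma eff_dom_distance: "p \<in> D \<Longrightarrow> eff_dom \<Phi> (local_distance g p) = S p"
  using distance_outside[of p] distance_S[of p] by (force simp: eff_dom_def S_def)

lemma valid_iff:
  assumes "p \<in> D"
  shows "valid \<Phi> (local_distance g p) \<longleftrightarrow> (\<exists>x. \<forall>\<alpha>\<in>S p. blinfun_apply \<alpha> x \<le> val (p + \<alpha>) - val p)"
proof -
  have "(\<forall>\<alpha>\<in>\<Phi>. ereal (blinfun_apply \<alpha> x) \<le> local_distance g p \<alpha>) \<longleftrightarrow>
      (\<forall>\<alpha>\<in>S p. blinfun_apply \<alpha> x \<le> val (p + \<alpha>) - val p)" for x
  proof
    assume "\<forall>\<alpha>\<in>\<Phi>. ereal (blinfun_apply \<alpha> x) \<le> local_distance g p \<alpha>"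
    then show "\<forall>\<alpha>\<in>S p. blinfun_apply \<alpha> x \<le> val (p + \<alpha>) - val p"
      using distance_S[OF assms] by (force simp: S_def)
  next
    assume le: "\<forall>\<alpha>\<in>S p. blinfun_apply \<alpha> x \<le> val (p + \<alpha>) - val p"
    show "\<forall>\<alpha>\<in>\<Phi>. ereal (blinfun_apply \<alpha> x) \<le> local_distance g p \<alpha>"
    proof
      fix \<alpha> assume "\<alpha> \<in> \<Phi>"
      then show "ereal (blinfun_apply \<alpha> x) \<le> local_distance g p \<alpha>"
        using le distance_S[OF assms, of \<alpha>] distance_outside[OF assms, of \<alpha>] by (cases "\<alpha> \<in> S p") auto
    qed
  qed
  then show ?thesis by (simp add: valid_def)
qed

text \<open>A bound on the infimum is met by actual coefficients, by
  \<open>linear_programming_attained\<close>; the reformulation is valid even where the infimum is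
  minus infinity.\<close>

lemma cone_fun_le_iff:
  assumes p: "p \<in> D" and q: "q \<in> D"
  shows "g p + cone_fun \<Phi> (local_distance g p) (q - p) \<le> g q \<longleftrightarrow>
    (\<exists>\<mu>. (\<forall>\<alpha>\<in>S p. \<mu> \<alpha> \<ge> 0) \<and> q - p = (\<Sum>\<alpha>\<in>S p. \<mu> \<alpha> *\<^sub>R \<alpha>) \<and>
      val p + (\<Sum>\<alpha>\<in>S p. \<mu> \<alpha> * (val (p + \<alpha>) - val p)) \<le> val q)"
    (is "?L \<longleftrightarrow> (\<exists>\<mu>. ?P \<mu>)")
proof -
  let ?c = "\<lambda>\<alpha>. val (p + \<alpha>) - val p" and ?v = "val q - val p"
  let ?A = "{ereal (\<Sum>\<alpha>\<in>S p. \<mu> \<alpha> * ?c \<alpha>) | \<mu>. (\<forall>\<alpha>\<in>S p. \<mu> \<alpha> \<ge> 0) \<and> q - p = (\<Sum>\<alpha>\<in>S p. \<mu> \<alpha> *\<^sub>R \<alpha>)}"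
  have sum: "(\<Sum>\<alpha>\<in>S p. ereal (\<mu> \<alpha>) * local_distance g p \<alpha>) = ereal (\<Sum>\<alpha>\<in>S p. \<mu> \<alpha> * ?c \<alpha>)" for \<mu>
  proof -
    have "(\<Sum>\<alpha>\<in>S p. ereal (\<mu> \<alpha>) * local_distance g p \<alpha>) = (\<Sum>\<alpha>\<in>S p. ereal (\<mu> \<alpha> * ?c \<alpha>))"
      by (intro sum.cong refl) (simp add: distance_S[OF p])
    then show ?thesis by (simp only: sum_ereal)
  qed
  have cf: "cone_fun \<Phi> (local_distance g p) (q - p) = Inf ?A"
    unfolding cone_fun_def eff_dom_distance[OF p] sum ..
  have "?L \<longleftrightarrow> Inf ?A \<le> ereal ?v"
    unfolding cf g_val[OF p] g_val[OF q] by (cases "Inf ?A") (auto simp: algebra_simps)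
  also have "\<dots> \<longleftrightarrow> (\<exists>\<mu>. ?P \<mu>)"
  proof
    assume "\<exists>\<mu>. ?P \<mu>"
    then obtain \<mu> where \<mu>: "?P \<mu>" by (elim exE)
    then have "ereal (\<Sum>\<alpha>\<in>S p. \<mu> \<alpha> * ?c \<alpha>) \<in> ?A" by blast
    then have "Inf ?A \<le> ereal (\<Sum>\<alpha>\<in>S p. \<mu> \<alpha> * ?c \<alpha>)" by (rule Inf_lower)
    also have "\<dots> \<le> ereal ?v" using \<mu> by simp
    finally show "Inf ?A \<le> ereal ?v" .
  next
    assume le: "Inf ?A \<le> ereal ?v"
    \<comment> \<open>The linear program is solved in \<open>V\<close>, to which the equation is
      carried by the injective map \<open>riesz\<close>.\<close>
    have eq: "riesz (q - p) = (\<Sum>\<alpha>\<in>S p. \<mu> \<alpha> *\<^sub>R riesz \<alpha>) \<longleftrightarrow> q - p = (\<Sum>\<alpha>\<in>S p. \<mu> \<alpha> *\<^sub>R \<alpha>)" for \<mu>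
      unfolding riesz_scaleR[symmetric] riesz_sum[symmetric] using inj_riesz by (auto dest: injD)
    have "\<exists>\<mu>. (\<forall>\<alpha>\<in>S p. \<mu> \<alpha> \<ge> 0) \<and> riesz (q - p) = (\<Sum>\<alpha>\<in>S p. \<mu> \<alpha> *\<^sub>R riesz \<alpha>) \<and> (\<Sum>\<alpha>\<in>S p. \<mu> \<alpha> * ?c \<alpha>) \<le> ?v"
    proof (rule linear_programming_attained[OF finite_S])
      fix \<epsilon> :: real assume "\<epsilon> > 0"
      then have "ereal ?v < ereal (?v + \<epsilon>)" by simp
      then have "Inf ?A < ereal (?v + \<epsilon>)" using le by (rule le_less_trans[rotated])
      then obtain a where "a \<in> ?A" "a < ereal (?v + \<epsilon>)" unfolding Inf_less_iff by blast
      then show "\<exists>\<mu>. (\<forall>\<alpha>\<in>S p. \<mu> \<alpha> \<ge> 0) \<and> riesz (q - p) = (\<Sum>\<alpha>\<in>S p. \<mu> \<alpha> *\<^sub>R riesz \<alpha>) \<and> (\<Sum>\<alpha>\<in>S p. \<mu> \<alpha> * ?c \<alpha>) \<le> ?v + \<epsilon>"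
        unfolding eq by (auto intro: less_imp_le)
    qed
    then obtain \<mu> where \<mu>: "(\<forall>\<alpha>\<in>S p. \<mu> \<alpha> \<ge> 0) \<and> riesz (q - p) = (\<Sum>\<alpha>\<in>S p. \<mu> \<alpha> *\<^sub>R riesz \<alpha>) \<and> (\<Sum>\<alpha>\<in>S p. \<mu> \<alpha> * ?c \<alpha>) \<le> ?v" by (elim exE)
    then show "\<exists>\<mu>. ?P \<mu>" unfolding eq by (intro exI[of _ \<mu>]) (simp add: le_diff_eq add.commute)
  qed
  finally show ?thesis .
qed

text \<open>Coefficients of repeated roots are added up; conversely the roots in \<open>S p\<close>
  are enumerated. Every listed root has finite local distance, so all sums are real.\<close>

lemma list_representation_iff:
  assumes p: "p \<in> D" and q: "q \<in> D"
  shows "(\<exists>(k::nat) (\<beta> :: nat \<Rightarrow> 'v dual) (\<mu> :: nat \<Rightarrow> real).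
             (\<forall>l\<in>{1..k}. \<beta> l \<in> \<Phi> \<and> p + \<beta> l \<in> D \<and> \<mu> l \<ge> 0) \<and>
             p + (\<Sum>l=1..k. \<mu> l *\<^sub>R \<beta> l) = q \<and>
             g q \<ge> g p + (\<Sum>l=1..k. ereal (\<mu> l) * local_distance g p (\<beta> l))) \<longleftrightarrow>
    (\<exists>\<mu>. (\<forall>\<alpha>\<in>S p. \<mu> \<alpha> \<ge> 0) \<and> q - p = (\<Sum>\<alpha>\<in>S p. \<mu> \<alpha> *\<^sub>R \<alpha>) \<and>
      val p + (\<Sum>\<alpha>\<in>S p. \<mu> \<alpha> * (val (p + \<alpha>) - val p)) \<le> val q)"
    (is "?L \<longleftrightarrow> ?R")
proof
  let ?c = "\<lambda>\<alpha>. val (p + \<alpha>) - val p"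
  assume ?L
  then obtain k :: nat and \<beta> :: "nat \<Rightarrow> 'v dual" and \<mu> :: "nat \<Rightarrow> real" where
    \<beta>: "\<forall>l\<in>{1..k}. \<beta> l \<in> \<Phi> \<and> p + \<beta> l \<in> D \<and> \<mu> l \<ge> 0" "p + (\<Sum>l=1..k. \<mu> l *\<^sub>R \<beta> l) = q"
    "g q \<ge> g p + (\<Sum>l=1..k. ereal (\<mu> l) * local_distance g p (\<beta> l))" by blast
  have \<beta>S: "\<beta> ` {1..k} \<subseteq> S p" using \<beta>(1) by (auto simp: S_def)
  define \<nu> where "\<nu> \<alpha> = (\<Sum>l\<in>{l\<in>{1..k}. \<beta> l = \<alpha>}. \<mu> l)" for \<alpha>
  have "(\<Sum>\<alpha>\<in>S p. \<nu> \<alpha> *\<^sub>R \<alpha>) = (\<Sum>\<alpha>\<in>S p. \<Sum>l\<in>{l\<in>{1..k}. \<beta> l = \<alpha>}. \<mu> l *\<^sub>R \<beta> l)"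
    by (intro sum.cong refl) (simp add: \<nu>_def scaleR_sum_left)
  also have "\<dots> = (\<Sum>l=1..k. \<mu> l *\<^sub>R \<beta> l)" by (rule sum.group) (use finite_S \<beta>S in auto)
  finally have s1: "q - p = (\<Sum>\<alpha>\<in>S p. \<nu> \<alpha> *\<^sub>R \<alpha>)" using \<beta>(2) by auto
  have "(\<Sum>\<alpha>\<in>S p. \<nu> \<alpha> * ?c \<alpha>) = (\<Sum>\<alpha>\<in>S p. \<Sum>l\<in>{l\<in>{1..k}. \<beta> l = \<alpha>}. \<mu> l * ?c (\<beta> l))"
    by (intro sum.cong refl) (simp add: \<nu>_def sum_distrib_right)
  also have "\<dots> = (\<Sum>l=1..k. \<mu> l * ?c (\<beta> l))" by (rule sum.group) (use finite_S \<beta>S in auto)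
  finally have s2: "(\<Sum>\<alpha>\<in>S p. \<nu> \<alpha> * ?c \<alpha>) = (\<Sum>l=1..k. \<mu> l * ?c (\<beta> l))" .
  have "(\<Sum>l=1..k. ereal (\<mu> l) * local_distance g p (\<beta> l)) = (\<Sum>l=1..k. ereal (\<mu> l * ?c (\<beta> l)))"
    using \<beta>S distance_S[OF p] by (intro sum.cong refl) (simp add: image_subset_iff)
  then have "val p + (\<Sum>\<alpha>\<in>S p. \<nu> \<alpha> * ?c \<alpha>) \<le> val q"
    using \<beta>(3) g_val[OF p] g_val[OF q] by (simp add: s2)
  moreover have "\<forall>\<alpha>\<in>S p. \<nu> \<alpha> \<ge> 0" using \<beta>(1) by (auto simp: \<nu>_def intro: sum_nonneg)
  ultimately show ?R using s1 by blast
next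
  let ?c = "\<lambda>\<alpha>. val (p + \<alpha>) - val p"
  assume ?R
  then obtain \<mu> where \<mu>: "\<forall>\<alpha>\<in>S p. \<mu> \<alpha> \<ge> 0" "q - p = (\<Sum>\<alpha>\<in>S p. \<mu> \<alpha> *\<^sub>R \<alpha>)"
    "val p + (\<Sum>\<alpha>\<in>S p. \<mu> \<alpha> * ?c \<alpha>) \<le> val q" by blast
  obtain \<beta> where \<beta>: "bij_betw \<beta> {1..card (S p)} (S p)" using ex_bij_betw_nat_finite_1[OF finite_S] by blast
  have mem: "\<beta> l \<in> S p" if "l \<in> {1..card (S p)}" for l using \<beta> that by (auto simp: bij_betw_def)
  have "(\<Sum>l=1..card (S p). ereal (\<mu> (\<beta> l)) * local_distance g p (\<beta> l)) = (\<Sum>l=1..card (S p). ereal (\<mu> (\<beta> l) * ?c (\<beta> l)))"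
    using mem distance_S[OF p] by (intro sum.cong refl) simp
  also have "\<dots> = ereal (\<Sum>\<alpha>\<in>S p. \<mu> \<alpha> * ?c \<alpha>)"
    using sum.reindex_bij_betw[OF \<beta>, of "\<lambda>\<alpha>. \<mu> \<alpha> * ?c \<alpha>"] by simp
  finally have "g p + (\<Sum>l=1..card (S p). ereal (\<mu> (\<beta> l)) * local_distance g p (\<beta> l)) \<le> g q"
    using \<mu>(3) g_val[OF p] g_val[OF q] by simp
  moreover have "p + (\<Sum>l=1..card (S p). \<mu> (\<beta> l) *\<^sub>R \<beta> l) = q"
    using sum.reindex_bij_betw[OF \<beta>, of "\<lambda>\<alpha>. \<mu> \<alpha> *\<^sub>R \<alpha>"] \<mu>(2) by (simp add: algebra_simps)
  moreover have "\<forall>l\<in>{1..card (S p)}. \<beta> l \<in> \<Phi> \<and> p + \<beta> l \<in> D \<and> \<mu> (\<beta> l) \<ge> 0" using mem \<mu>(1) by (simp add: S_def)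
  ultimately show ?L
    by (intro exI[of _ "card (S p)"] exI[of _ \<beta>] exI[of _ "\<lambda>l. \<mu> (\<beta> l)"]) blast
qed

text \<open>For the converse the sublinear function may come from a different valid \<gamma>. A
  point \<open>x\<close> below that \<gamma> lies below its cone function, and the cone function of
  the local distance is at most the local distance at every root of \<open>S p\<close>.\<close>

lemma valid_iff_M_sublinear:
  assumes p: "p \<in> D"
  shows "valid \<Phi> (local_distance g p) \<longleftrightarrow> M_sublinear \<Phi> (cone_fun \<Phi> (local_distance g p))"
proof
  let ?\<gamma> = "local_distance g p"
  have dist: "distance_fun \<Phi> ?\<gamma>"
    unfolding distance_fun_def
  proof
    fix \<alpha> assume "\<alpha> \<in> \<Phi>"
    then show "?\<gamma> \<alpha> \<noteq> -\<infinity>" using distance_S[OF p, of \<alpha>] distance_outside[OF p, of \<alpha>] by (cases "\<alpha> \<in> S p") auto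
  qed
  then show "valid \<Phi> ?\<gamma> \<Longrightarrow> M_sublinear \<Phi> (cone_fun \<Phi> ?\<gamma>)" unfolding M_sublinear_def by blast
  assume "M_sublinear \<Phi> (cone_fun \<Phi> ?\<gamma>)"
  then obtain \<gamma> where \<gamma>: "valid \<Phi> \<gamma>" "cone_fun \<Phi> ?\<gamma> = cone_fun \<Phi> \<gamma>" unfolding M_sublinear_def by blast
  then obtain x where x: "\<And>\<alpha>. \<alpha> \<in> \<Phi> \<Longrightarrow> ereal (blinfun_apply \<alpha> x) \<le> \<gamma> \<alpha>" unfolding valid_def by blast
  have lower: "ereal (blinfun_apply d x) \<le> cone_fun \<Phi> \<gamma> d" for d
    unfolding cone_fun_def
  proof (rule Inf_greatest, clarify)
    fix \<mu> :: "'v dual \<Rightarrow> real" assume \<mu>: "\<forall>\<alpha>\<in>eff_dom \<Phi> \<gamma>. \<mu> \<alpha> \<ge> 0" "d = (\<Sum>\<alpha>\<in>eff_dom \<Phi> \<gamma>. \<mu> \<alpha> *\<^sub>R \<alpha>)"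
    have "ereal (blinfun_apply (\<Sum>\<alpha>\<in>eff_dom \<Phi> \<gamma>. \<mu> \<alpha> *\<^sub>R \<alpha>) x) = (\<Sum>\<alpha>\<in>eff_dom \<Phi> \<gamma>. ereal (\<mu> \<alpha> * blinfun_apply \<alpha> x))"
      by (simp add: blinfun.sum_left blinfun.scaleR_left)
    also have "\<dots> \<le> (\<Sum>\<alpha>\<in>eff_dom \<Phi> \<gamma>. ereal (\<mu> \<alpha>) * \<gamma> \<alpha>)"
    proof (rule sum_mono)
      fix \<alpha> assume \<alpha>: "\<alpha> \<in> eff_dom \<Phi> \<gamma>"
      then have "ereal (blinfun_apply \<alpha> x) \<le> \<gamma> \<alpha>" using x by (simp add: eff_dom_def)
      then have "ereal (\<mu> \<alpha>) * ereal (blinfun_apply \<alpha> x) \<le> ereal (\<mu> \<alpha>) * \<gamma> \<alpha>"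
        using \<mu>(1) \<alpha> by (intro ereal_mult_left_mono) auto
      then show "ereal (\<mu> \<alpha> * blinfun_apply \<alpha> x) \<le> ereal (\<mu> \<alpha>) * \<gamma> \<alpha>" by simp
    qed
    finally show "ereal (blinfun_apply (\<Sum>\<alpha>\<in>eff_dom \<Phi> \<gamma>. \<mu> \<alpha> *\<^sub>R \<alpha>) x) \<le> (\<Sum>\<alpha>\<in>eff_dom \<Phi> \<gamma>. ereal (\<mu> \<alpha>) * \<gamma> \<alpha>)" .
  qed
  have "blinfun_apply \<alpha> x \<le> val (p + \<alpha>) - val p" if \<alpha>: "\<alpha> \<in> S p" for \<alpha>
  proof -
    define \<mu> where "\<mu> \<beta> = (if \<beta> = \<alpha> then 1 else 0 :: real)" for \<beta> :: "'v dual"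
    have "cone_fun \<Phi> ?\<gamma> \<alpha> \<le> (\<Sum>\<beta>\<in>S p. ereal (\<mu> \<beta>) * ?\<gamma> \<beta>)"
      unfolding cone_fun_def eff_dom_distance[OF p]
    proof (rule Inf_lower, rule CollectI, rule exI[of _ \<mu>], intro conjI refl)
      show "\<alpha> = (\<Sum>\<beta>\<in>S p. \<mu> \<beta> *\<^sub>R \<beta>)"
        using \<alpha> finite_S by (simp add: \<mu>_def if_distrib[where f = "\<lambda>r. r *\<^sub>R _"] cong: if_cong)
    qed (simp add: \<mu>_def)
    also have "(\<Sum>\<beta>\<in>S p. ereal (\<mu> \<beta>) * ?\<gamma> \<beta>) = (\<Sum>\<beta>\<in>S p. if \<beta> = \<alpha> then ?\<gamma> \<alpha> else 0)"
      by (intro sum.cong refl) (simp add: \<mu>_def zero_ereal_def[symmetric] one_ereal_def[symmetric])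
    also have "\<dots> = ?\<gamma> \<alpha>" using \<alpha> finite_S by simp
    finally have "ereal (blinfun_apply \<alpha> x) \<le> ?\<gamma> \<alpha>" using lower[of \<alpha>] \<gamma>(2) by simp
    then show ?thesis using distance_S[OF p \<alpha>] by simp
  qed
  then show "valid \<Phi> ?\<gamma>" using valid_iff[OF p] by blast
qed

lemma M_convex_set_iff:
  "M_convex_set \<Phi> D \<longleftrightarrow> (\<exists>P. mpoly (riesz ` \<Phi>) P \<and> riesz ` D = P \<inter> lat (riesz ` \<Phi>))"
proof
  assume "M_convex_set \<Phi> D"
  then obtain P where "integral_M_convex_polyhedron \<Phi> P" "D = P \<inter> L" unfolding M_convex_set_def by blast
  then have "mpoly (riesz ` \<Phi>) (riesz ` P)" "riesz ` D = riesz ` P \<inter> lat (riesz ` \<Phi>)"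
    by (simp_all add: mpoly_riesz lat_riesz riesz_image_Int)
  then show "\<exists>P. mpoly (riesz ` \<Phi>) P \<and> riesz ` D = P \<inter> lat (riesz ` \<Phi>)" by blast
next
  assume "\<exists>P. mpoly (riesz ` \<Phi>) P \<and> riesz ` D = P \<inter> lat (riesz ` \<Phi>)"
  then obtain P' where P': "mpoly (riesz ` \<Phi>) P'" "riesz ` D = P' \<inter> lat (riesz ` \<Phi>)" by blast
  define P where "P = blinfun_inner_right ` P'"
  have "riesz ` P = P'" by (simp add: P_def image_comp o_def riesz_blinfun_inner)
  then have "integral_M_convex_polyhedron \<Phi> P" "riesz ` D = riesz ` (P \<inter> L)"
    using P' by (simp_all add: mpoly_riesz lat_riesz riesz_image_Int)
  then have "integral_M_convex_polyhedron \<Phi> P" "D = P \<inter> L" by (simp_all add: riesz_image_eq_iff)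
  then show "M_convex_set \<Phi> D" unfolding M_convex_set_def using dom_nonempty by blast
qed

lemma M_convex_fun_iff:
  "M_convex_fun \<Phi> g \<longleftrightarrow> (\<exists>P H. mfun (riesz ` \<Phi>) P H \<and> P \<inter> lat (riesz ` \<Phi>) = riesz ` D \<and>
     (\<forall>p\<in>riesz ` D. H p = val (blinfun_inner_right p)))"
proof
  assume "M_convex_fun \<Phi> g"
  then obtain h where h: "primal_integral_M_convex_fun \<Phi> h" "\<forall>p\<in>L. g p = h p" unfolding M_convex_fun_def by blast
  then have nm: "\<And>p. h p \<noteq> -\<infinity>" by (simp add: primal_integral_M_convex_fun_def proper_fun_def)
  let ?P = "riesz ` eff_dom UNIV h" and ?H = "\<lambda>v. real_of_ereal (h (blinfun_inner_right v))"
  have "mfun (riesz ` \<Phi>) ?P ?H" using h(1) primal_integral_riesz[of h, OF nm] by blast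
  moreover have "eff_dom UNIV h \<inter> L = D" using h(2) by (auto simp: lattice_dom_def eff_dom_def)
  then have "?P \<inter> lat (riesz ` \<Phi>) = riesz ` D" by (metis lat_riesz riesz_image_Int)
  moreover have "\<forall>p\<in>riesz ` D. ?H p = val (blinfun_inner_right p)"
    using h(2) by (auto simp: blinfun_inner_riesz val_def D_iff)
  ultimately show "\<exists>P H. mfun (riesz ` \<Phi>) P H \<and> P \<inter> lat (riesz ` \<Phi>) = riesz ` D \<and>
     (\<forall>p\<in>riesz ` D. H p = val (blinfun_inner_right p))" by blast
next
  assume "\<exists>P H. mfun (riesz ` \<Phi>) P H \<and> P \<inter> lat (riesz ` \<Phi>) = riesz ` D \<and>
     (\<forall>p\<in>riesz ` D. H p = val (blinfun_inner_right p))"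
  then obtain P H where PH: "mfun (riesz ` \<Phi>) P H" "P \<inter> lat (riesz ` \<Phi>) = riesz ` D"
    "\<And>p. p \<in> D \<Longrightarrow> H (riesz p) = val p" by (force simp: blinfun_inner_riesz)
  define h where "h p = (if riesz p \<in> P then ereal (H (riesz p)) else \<infinity>)" for p
  have nm: "h p \<noteq> -\<infinity>" for p by (simp add: h_def)
  have "eff_dom UNIV h = {p. riesz p \<in> P}" by (auto simp: h_def eff_dom_def)
  then have dom: "riesz ` eff_dom UNIV h = P" using surj_image_vimage_eq[OF surj_riesz, of P] by (simp add: vimage_def)
  have "mfun (riesz ` \<Phi>) P (\<lambda>v. real_of_ereal (h (blinfun_inner_right v)))"
    using PH(1) by (subst mfun_cong[of _ _ H]) (simp_all add: h_def riesz_blinfun_inner)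
  then have "primal_integral_M_convex_fun \<Phi> h" unfolding primal_integral_riesz[of h, OF nm] dom .
  moreover have "g p = h p" if p: "p \<in> L" for p
  proof (cases "p \<in> D")
    case True
    then have "riesz p \<in> P" using PH(2) by blast
    then show ?thesis using PH(3)[OF True] g_val[OF True] by (simp add: h_def)
  next
    case False
    have "riesz p \<notin> P"
    proof
      assume "riesz p \<in> P"
      then have "riesz p \<in> riesz ` D" using PH(2) p by (auto simp: lat_riesz)
      then show False using False by (simp only: inj_image_mem_iff[OF inj_riesz])
    qed
    then show ?thesis using False p by (simp add: h_def D_iff)
  qed
  ultimately show "M_convex_fun \<Phi> g" unfolding M_convex_fun_def by blast
qed

lemma steps_riesz: "steps (riesz ` \<Phi>) (riesz ` D) (riesz p) = riesz ` S p"
proof -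
  have "riesz p + riesz \<alpha> \<in> riesz ` D \<longleftrightarrow> p + \<alpha> \<in> D" for \<alpha>
    unfolding riesz_add[symmetric] using inj_riesz by (rule inj_image_mem_iff)
  then show ?thesis by (auto simp: steps_def S_def)
qed

lemma sum_steps_riesz: "(\<Sum>\<alpha>\<in>steps (riesz ` \<Phi>) (riesz ` D) (riesz p). f \<alpha>) = (\<Sum>\<alpha>\<in>S p. f (riesz \<alpha>))"
proof -
  have "inj_on riesz (S p)" using inj_riesz by (rule inj_on_subset) simp
  then show ?thesis unfolding steps_riesz by (simp add: sum.reindex)
qed

lemma subgradient_riesz:
  "(\<exists>x. \<forall>\<alpha>\<in>steps (riesz ` \<Phi>) (riesz ` D) (riesz p). x \<bullet> \<alpha> \<le>
      val (blinfun_inner_right (riesz p + \<alpha>)) - val (blinfun_inner_right (riesz p))) \<longleftrightarrow>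
   (\<exists>x. \<forall>\<alpha>\<in>S p. blinfun_apply \<alpha> x \<le> val (p + \<alpha>) - val p)"
proof -
  have "x \<bullet> riesz \<alpha> = blinfun_apply \<alpha> x" for x and \<alpha> :: "'v dual" by (simp add: riesz_inner inner_commute[of x])
  then show ?thesis by (simp add: steps_riesz riesz_add[symmetric] blinfun_inner_riesz)
qed

lemma growth_riesz:
  "(\<exists>\<mu>. (\<forall>\<alpha>\<in>steps (riesz ` \<Phi>) (riesz ` D) (riesz p). \<mu> \<alpha> \<ge> 0) \<and>
      riesz q - riesz p = (\<Sum>\<alpha>\<in>steps (riesz ` \<Phi>) (riesz ` D) (riesz p). \<mu> \<alpha> *\<^sub>R \<alpha>) \<and>
      val (blinfun_inner_right (riesz q)) \<ge> val (blinfun_inner_right (riesz p)) +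
        (\<Sum>\<alpha>\<in>steps (riesz ` \<Phi>) (riesz ` D) (riesz p).
           \<mu> \<alpha> * (val (blinfun_inner_right (riesz p + \<alpha>)) - val (blinfun_inner_right (riesz p))))) \<longleftrightarrow>
   (\<exists>\<mu>. (\<forall>\<alpha>\<in>S p. \<mu> \<alpha> \<ge> 0) \<and> q - p = (\<Sum>\<alpha>\<in>S p. \<mu> \<alpha> *\<^sub>R \<alpha>) \<and>
      val p + (\<Sum>\<alpha>\<in>S p. \<mu> \<alpha> * (val (p + \<alpha>) - val p)) \<le> val q)"
  (is "(\<exists>\<mu>. ?A \<mu>) \<longleftrightarrow> (\<exists>\<mu>. ?B \<mu>)")
proof -
  have eq: "?A \<mu> \<longleftrightarrow> ?B (\<lambda>\<alpha>. \<mu> (riesz \<alpha>))" for \<mu>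
  proof -
    have "riesz q - riesz p = (\<Sum>\<alpha>\<in>S p. \<mu> (riesz \<alpha>) *\<^sub>R riesz \<alpha>) \<longleftrightarrow> q - p = (\<Sum>\<alpha>\<in>S p. \<mu> (riesz \<alpha>) *\<^sub>R \<alpha>)"
      unfolding riesz_scaleR[symmetric] riesz_sum[symmetric] riesz_diff[symmetric] using inj_riesz by (auto dest: injD)
    then show ?thesis
      unfolding sum_steps_riesz by (simp add: steps_riesz riesz_add[symmetric] blinfun_inner_riesz)
  qed
  show ?thesis
  proof
    assume "\<exists>\<mu>. ?B \<mu>"
    then obtain \<mu> where "?B \<mu>" by (elim exE)
    then have "?A (\<lambda>\<alpha>. \<mu> (blinfun_inner_right \<alpha>))" unfolding eq by (simp add: blinfun_inner_riesz)
    then show "\<exists>\<mu>. ?A \<mu>" by (rule exI[of _ "\<lambda>\<alpha>. \<mu> (blinfun_inner_right \<alpha>)"])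
  next
    assume "\<exists>\<mu>. ?A \<mu>"
    then obtain \<mu> where "?A \<mu>" by (elim exE)
    then have "?B (\<lambda>\<alpha>. \<mu> (riesz \<alpha>))" unfolding eq .
    then show "\<exists>\<mu>. ?B \<mu>" by (rule exI[of _ "\<lambda>\<alpha>. \<mu> (riesz \<alpha>)"])
  qed
qed

end

theorem theorem7p7:
  fixes \<Phi> :: "'v::euclidean_space dual set"
    and g :: "'v dual \<Rightarrow> ereal"
  assumes "root_system \<Phi>" and "essential \<Phi>"
    and "\<And>\<Psi>. irreducible_component \<Phi> \<Psi> \<Longrightarrow> classical_type \<Psi>"
    and "\<And>p. p \<in> root_lattice \<Phi> \<Longrightarrow> g p \<noteq> -\<infinity>"
    and "lattice_dom \<Phi> g \<noteq> {}"
  shows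
    "(M_convex_fun \<Phi> g \<longleftrightarrow>
        M_convex_set \<Phi> (lattice_dom \<Phi> g) \<and>
        (\<forall>p\<in>lattice_dom \<Phi> g. valid \<Phi> (local_distance g p)) \<and>
        (\<forall>p\<in>lattice_dom \<Phi> g. \<forall>q\<in>lattice_dom \<Phi> g. g q \<ge> g p + cone_fun \<Phi> (local_distance g p) (q - p)))
     \<and> (\<forall>p\<in>lattice_dom \<Phi> g. valid \<Phi> (local_distance g p) \<longleftrightarrow>
          M_sublinear \<Phi> (cone_fun \<Phi> (local_distance g p)))
     \<and> (\<forall>p\<in>lattice_dom \<Phi> g. \<forall>q\<in>lattice_dom \<Phi> g.
          g q \<ge> g p + cone_fun \<Phi> (local_distance g p) (q - p) \<longleftrightarrow>
          (\<exists>(k::nat) (\<beta> :: nat \<Rightarrow> 'v dual) (\<mu> :: nat \<Rightarrow> real).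
             (\<forall>l\<in>{1..k}. \<beta> l \<in> \<Phi> \<and> p + \<beta> l \<in> lattice_dom \<Phi> g \<and> \<mu> l \<ge> 0) \<and>
             p + (\<Sum>l=1..k. \<mu> l *\<^sub>R \<beta> l) = q \<and>
             g q \<ge> g p + (\<Sum>l=1..k. ereal (\<mu> l) * local_distance g p (\<beta> l))))"
proof -
  interpret lattice_function \<Phi> g
    by unfold_locales (use assms in \<open>simp_all add: root_system_def\<close>)
  interpret R: root_vectors "riesz ` \<Phi>" by (rule root_vectors_riesz[OF assms(1-3)])
  have valid: "(\<forall>p\<in>riesz ` D. \<exists>x. \<forall>\<alpha>\<in>steps (riesz ` \<Phi>) (riesz ` D) p. x \<bullet> \<alpha> \<le>
      val (blinfun_inner_right (p + \<alpha>)) - val (blinfun_inner_right p)) \<longleftrightarrow>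
    (\<forall>p\<in>D. valid \<Phi> (local_distance g p))"
    unfolding ball_simps subgradient_riesz using valid_iff by blast
  have growth: "(\<forall>p\<in>riesz ` D. \<forall>q\<in>riesz ` D. \<exists>\<mu>. (\<forall>\<alpha>\<in>steps (riesz ` \<Phi>) (riesz ` D) p. \<mu> \<alpha> \<ge> 0) \<and>
      q - p = (\<Sum>\<alpha>\<in>steps (riesz ` \<Phi>) (riesz ` D) p. \<mu> \<alpha> *\<^sub>R \<alpha>) \<and>
      val (blinfun_inner_right q) \<ge> val (blinfun_inner_right p) + (\<Sum>\<alpha>\<in>steps (riesz ` \<Phi>) (riesz ` D) p.
           \<mu> \<alpha> * (val (blinfun_inner_right (p + \<alpha>)) - val (blinfun_inner_right p)))) \<longleftrightarrow>
    (\<forall>p\<in>D. \<forall>q\<in>D. g p + cone_fun \<Phi> (local_distance g p) (q - p) \<le> g q)"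
    unfolding ball_simps growth_riesz using cone_fun_le_iff by blast
  have main: "M_convex_fun \<Phi> g \<longleftrightarrow> M_convex_set \<Phi> D \<and> (\<forall>p\<in>D. valid \<Phi> (local_distance g p)) \<and>
      (\<forall>p\<in>D. \<forall>q\<in>D. g p + cone_fun \<Phi> (local_distance g p) (q - p) \<le> g q)"
    unfolding M_convex_fun_iff R.mfun_lattice_iff M_convex_set_iff valid growth by (rule refl)
  have reps: "g p + cone_fun \<Phi> (local_distance g p) (q - p) \<le> g q \<longleftrightarrow>
          (\<exists>(k::nat) (\<beta> :: nat \<Rightarrow> 'v dual) (\<mu> :: nat \<Rightarrow> real).
             (\<forall>l\<in>{1..k}. \<beta> l \<in> \<Phi> \<and> p + \<beta> l \<in> D \<and> \<mu> l \<ge> 0) \<and>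
             p + (\<Sum>l=1..k. \<mu> l *\<^sub>R \<beta> l) = q \<and>
             g q \<ge> g p + (\<Sum>l=1..k. ereal (\<mu> l) * local_distance g p (\<beta> l)))"
    if "p \<in> D" "q \<in> D" for p q
    unfolding cone_fun_le_iff[OF that] list_representation_iff[OF that] by (rule refl)
  show ?thesis
    by (intro conjI ballI main valid_iff_M_sublinear reps)
qed

end
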